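(* Let $X$ be an alphabet with $|X|\ge 2$, let $w\in\overline X^*$ be a cyclically reduced word and let $M=\mathrm{Inv}\langle X\mid w=1\rangle$. The special inverse monoid $M$ is strongly $F$-inverse if and only if every piece $w_i$ in the decomposition $w=w_1\cdots w_k$ of $w$ into minimal invertible pieces has length at most two.
   Context: Words and presentations: $\overline X=X\cup X^{-1}$ is the doubled alphabet. A word is reduced if it contains no subword $xx^{-1}$ or $x^{-1}x$ ($x\in X$), and cyclically reduced if it is reduced and its first and last letters are not mutually inverse. $\mathrm{Inv}\langle X\mid w=1\rangle$ is the quotient of the free inverse monoid on $X$ by the congruence generated by $(w,1)$. A group or inverse monoid $S$ is $X$-generated if it comes with a (not necessarily injective) map $X\to S$ whose image generates it; a morphism of $X$-generated structures is canonical if it respects the generators; $[w]$ is the element represented by $w$. Minimal invertible pieces: for $M=\mathrm{Inv}\langle X\mid w=1\rangle$ the word $w$ has a unique finest factorisation $w=w_1\cdots w_k$ into (non-empty) subwords each representing an invertible element (unit) of $M$, such that no proper non-empty prefix or suffix of any $w_i$ represents an invertible element of $M$. The $w_i$ are the minimal invertible pieces. Strong $F$-inverse property: for an inverse monoid $S$, $\sigma$ is the minimum group congruence and $\le$ the natural order ($x\le y$ iff $x=xx^{-1}y$); $S$ is $F$-inverse if every $\sigma$-class has a maximum element. For an $X$-generated group $G$, $\mathrm{Cay}(G,X)$ has vertex set $G$ and an edge labelled $x$ from $g$ to $g[x]$ for all $g\in G$, $x\in\overline X$, whose inverse is the edge labelled $x^{-1}$ from $g[x]$ to $g$; subgraphs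 are closed under endpoints and inversion of edges, and $G$ acts on them by left multiplication. The Margolis–Meakin expansion $M(G,X)$ is the inverse monoid of pairs $(\Gamma,g)$ with $\Gamma$ a finite connected subgraph of $\mathrm{Cay}(G,X)$ containing $1$ and $g$, with $(\Delta,g)(\Xi,h)=(\Delta\cup g\Xi,gh)$ and $(\Delta,g)^{-1}=(g^{-1}\Delta,g^{-1})$; it is $X$-generated via $x\mapsto(\Gamma_x,[x])$, $\Gamma_x$ being the subgraph spanned by the edge labelled $x$ starting at $1$. Its $\sigma$-classes are indexed by $g\in G$, and the maximal elements of the class of $g$ are the pairs $(\Pi,g)$ with $\Pi$ the subgraph spanned by a simple path (no repeated vertices; possibly empty) from $1$ to $g$. $M(G,X)$ is the universal $X$-generated $E$-unitary inverse monoid with maximum group image $G$; since $F$-inverse monoids are $E$-unitary, each $X$-generated $F$-inverse monoid $S$ admits a canonical morphism $M(S/\sigma,X)\to S$. $S$ is strongly $F$-inverse if it is $F$-inverse and, for each $\sigma$-class of $M(S/\sigma,X)$, all its maximal elements are mapped by this morphism to the maximum element of the corresponding $\sigma$-class of $S$. *)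

theory Defs
  imports
    "HOL-Algebra.Coset"
    "HOL-Library.Sublist"
    "Graph_Theory.Digraph_Component"
begin

section \<open>Words over the doubled alphabet\<close>

text \<open>The alphabet \<open>X\<close> is the type \<^typ>\<open>'x\<close>; \<open>Pos x\<close> stands for the letter \<open>x\<close> and \<open>Neg x\<close> for
  its formal inverse.\<close>

datatype 'x letter = Pos 'x | Neg 'x

fun letter_inv :: "'x letter \<Rightarrow> 'x letter" where
  "letter_inv (Pos x) = Neg x"
| "letter_inv (Neg x) = Pos x"

definition word_inv :: "'x letter list \<Rightarrow> 'x letter list" where
  "word_inv u = rev (map letter_inv u)"

definition reduced :: "'x letter list \<Rightarrow> bool" where
  "reduced u \<longleftrightarrow> (\<forall>a. \<not> sublist [a, letter_inv a] u)"

definition cyclically_reduced :: "'x letter list \<Rightarrow> bool" where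
  "cyclically_reduced u \<longleftrightarrow> reduced u \<and> (u \<noteq> [] \<longrightarrow> last u \<noteq> letter_inv (hd u))"


section \<open>Monoid congruences and quotients\<close>

definition monoid_congruence :: "('s, 'm) monoid_scheme \<Rightarrow> ('s \<times> 's) set \<Rightarrow> bool" where
  "monoid_congruence S r \<longleftrightarrow> equiv (carrier S) r \<and>
     (\<forall>a b c d. (a, b) \<in> r \<longrightarrow> (c, d) \<in> r \<longrightarrow> (a \<otimes>\<^bsub>S\<^esub> c, b \<otimes>\<^bsub>S\<^esub> d) \<in> r)"

definition generated_congruence ::
    "('s, 'm) monoid_scheme \<Rightarrow> ('s \<times> 's) set \<Rightarrow> ('s \<times> 's) set" where
  "generated_congruence S R = \<Inter>{r. monoid_congruence S r \<and> R \<subseteq> r}"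

text \<open>The set product \<^term>\<open>A <#>\<^bsub>S\<^esub> B\<close> of two classes is contained in a single class but, unlike
  for groups, need not be all of it; hence the saturation by \<open>r\<close>.\<close>

definition quotient_monoid :: "('s, 'm) monoid_scheme \<Rightarrow> ('s \<times> 's) set \<Rightarrow> 's set monoid" where
  "quotient_monoid S r =
     \<lparr> carrier = carrier S // r, monoid.mult = (\<lambda>A B. r `` (A <#>\<^bsub>S\<^esub> B)), one = r `` {\<one>\<^bsub>S\<^esub>} \<rparr>"


section \<open>Inverse monoids\<close>

definition inverse_monoid :: "('s, 'm) monoid_scheme \<Rightarrow> bool" where
  "inverse_monoid S \<longleftrightarrow> monoid S \<and>
     (\<forall>x \<in> carrier S. \<exists>!y. y \<in> carrier S \<and> x \<otimes>\<^bsub>S\<^esub> y \<otimes>\<^bsub>S\<^esub> x = x \<and> y \<otimes>\<^bsub>S\<^esub> x \<otimes>\<^bsub>S\<^esub> y = y)"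

text \<open>The inverse in the sense of inverse monoids; the library's \<^const>\<open>m_inv\<close> is only meaningful on
  units.\<close>

definition inverse_elt :: "('s, 'm) monoid_scheme \<Rightarrow> 's \<Rightarrow> 's" where
  "inverse_elt S x =
     (THE y. y \<in> carrier S \<and> x \<otimes>\<^bsub>S\<^esub> y \<otimes>\<^bsub>S\<^esub> x = x \<and> y \<otimes>\<^bsub>S\<^esub> x \<otimes>\<^bsub>S\<^esub> y = y)"

definition natural_le :: "('s, 'm) monoid_scheme \<Rightarrow> 's \<Rightarrow> 's \<Rightarrow> bool" where
  "natural_le S x y \<longleftrightarrow> x = x \<otimes>\<^bsub>S\<^esub> inverse_elt S x \<otimes>\<^bsub>S\<^esub> y"

definition is_maximum :: "('s, 'm) monoid_scheme \<Rightarrow> 's set \<Rightarrow> 's \<Rightarrow> bool" where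
  "is_maximum S C m \<longleftrightarrow> m \<in> C \<and> (\<forall>x \<in> C. natural_le S x m)"

definition is_maximal :: "('s, 'm) monoid_scheme \<Rightarrow> 's set \<Rightarrow> 's \<Rightarrow> bool" where
  "is_maximal S C m \<longleftrightarrow> m \<in> C \<and> (\<forall>x \<in> C. natural_le S m x \<longrightarrow> x = m)"

definition min_group_congruence :: "('s, 'm) monoid_scheme \<Rightarrow> ('s \<times> 's) set" where
  "min_group_congruence S = \<Inter>{r. monoid_congruence S r \<and> group (quotient_monoid S r)}"

definition F_inverse :: "('s, 'm) monoid_scheme \<Rightarrow> bool" where
  "F_inverse S \<longleftrightarrow> inverse_monoid S \<and>
     (\<forall>C \<in> carrier S // min_group_congruence S. \<exists>m. is_maximum S C m)"


section \<open>Generated inverse monoids\<close>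

inductive_set inverse_submonoid_generated :: "('s, 'm) monoid_scheme \<Rightarrow> 's set \<Rightarrow> 's set"
  for S (structure) and A where
  one: "\<one> \<in> inverse_submonoid_generated S A"
| incl: "a \<in> A \<Longrightarrow> a \<in> inverse_submonoid_generated S A"
| inv: "s \<in> inverse_submonoid_generated S A \<Longrightarrow> inverse_elt S s \<in> inverse_submonoid_generated S A"
| mult: "s \<in> inverse_submonoid_generated S A \<Longrightarrow> t \<in> inverse_submonoid_generated S A \<Longrightarrow>
    s \<otimes> t \<in> inverse_submonoid_generated S A"

definition X_generated :: "('s, 'm) monoid_scheme \<Rightarrow> ('x \<Rightarrow> 's) \<Rightarrow> bool" where
  "X_generated S \<iota> \<longleftrightarrow>
     range \<iota> \<subseteq> carrier S \<and> inverse_submonoid_generated S (range \<iota>) = carrier S"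

definition canonical_morphism ::
    "('s, 'm) monoid_scheme \<Rightarrow> ('x \<Rightarrow> 's) \<Rightarrow> ('t, 'n) monoid_scheme \<Rightarrow> ('x \<Rightarrow> 't) \<Rightarrow> ('s \<Rightarrow> 't) \<Rightarrow> bool"
  where
  "canonical_morphism S \<iota> T \<kappa> \<phi> \<longleftrightarrow>
     \<phi> \<in> hom S T \<and> \<phi> \<one>\<^bsub>S\<^esub> = \<one>\<^bsub>T\<^esub> \<and> (\<forall>x. \<phi> (\<iota> x) = \<kappa> x)"


section \<open>Cayley graphs and the Margolis--Meakin expansion\<close>

fun letter_val :: "('g, 'm) monoid_scheme \<Rightarrow> ('x \<Rightarrow> 'g) \<Rightarrow> 'x letter \<Rightarrow> 'g" where
  "letter_val G \<iota> (Pos x) = \<iota> x"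
| "letter_val G \<iota> (Neg x) = inv\<^bsub>G\<^esub> (\<iota> x)"

text \<open>The arc \<open>(g, a)\<close> is the edge with initial vertex \<open>g\<close> and label \<open>a\<close>.\<close>

definition cayley :: "('g, 'm) monoid_scheme \<Rightarrow> ('x \<Rightarrow> 'g) \<Rightarrow> ('g, 'g \<times> 'x letter) pre_digraph" where
  "cayley G \<iota> =
     \<lparr> verts = carrier G, arcs = carrier G \<times> UNIV,
       tail = fst, head = (\<lambda>(g, a). g \<otimes>\<^bsub>G\<^esub> letter_val G \<iota> a) \<rparr>"

definition edge_inv ::
    "('g, 'm) monoid_scheme \<Rightarrow> ('x \<Rightarrow> 'g) \<Rightarrow> 'g \<times> 'x letter \<Rightarrow> 'g \<times> 'x letter" where
  "edge_inv G \<iota> e = (head (cayley G \<iota>) e, letter_inv (snd e))"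

text \<open>\<^const>\<open>subgraph\<close> of the library only requires closure under endpoints.\<close>

definition cayley_subgraph ::
    "('g, 'm) monoid_scheme \<Rightarrow> ('x \<Rightarrow> 'g) \<Rightarrow> ('g, 'g \<times> 'x letter) pre_digraph \<Rightarrow> bool" where
  "cayley_subgraph G \<iota> \<Gamma> \<longleftrightarrow>
     subgraph \<Gamma> (cayley G \<iota>) \<and> (\<forall>e \<in> arcs \<Gamma>. edge_inv G \<iota> e \<in> arcs \<Gamma>)"

definition translate ::
    "('g, 'm) monoid_scheme \<Rightarrow> 'g \<Rightarrow> ('g, 'g \<times> 'x letter) pre_digraph \<Rightarrow> ('g, 'g \<times> 'x letter) pre_digraph"
  where
  "translate G g \<Gamma> =
     \<Gamma>\<lparr> verts := (\<lambda>h. g \<otimes>\<^bsub>G\<^esub> h) ` verts \<Gamma>, arcs := (\<lambda>(h, a). (g \<otimes>\<^bsub>G\<^esub> h, a)) ` arcs \<Gamma> \<rparr>"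

definition margolis_meakin ::
    "('g, 'm) monoid_scheme \<Rightarrow> ('x \<Rightarrow> 'g) \<Rightarrow> (('g, 'g \<times> 'x letter) pre_digraph \<times> 'g) monoid" where
  "margolis_meakin G \<iota> =
     \<lparr> carrier = {(\<Gamma>, g). cayley_subgraph G \<iota> \<Gamma> \<and> finite (verts \<Gamma>) \<and> finite (arcs \<Gamma>) \<and>
                     Digraph_Component.connected \<Gamma> \<and> \<one>\<^bsub>G\<^esub> \<in> verts \<Gamma> \<and> g \<in> verts \<Gamma>},
       monoid.mult = (\<lambda>(\<Delta>, g) (\<Xi>, h). (Digraph_Component.union \<Delta> (translate G g \<Xi>), g \<otimes>\<^bsub>G\<^esub> h)),
       one = ((cayley G \<iota>)\<lparr> verts := {\<one>\<^bsub>G\<^esub>}, arcs := {} \<rparr>, \<one>\<^bsub>G\<^esub>) \<rparr>"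

definition margolis_meakin_gen ::
    "('g, 'm) monoid_scheme \<Rightarrow> ('x \<Rightarrow> 'g) \<Rightarrow> 'x \<Rightarrow> ('g, 'g \<times> 'x letter) pre_digraph \<times> 'g" where
  "margolis_meakin_gen G \<iota> x =
     ((cayley G \<iota>)\<lparr> verts := {\<one>\<^bsub>G\<^esub>, \<iota> x},
                    arcs := {(\<one>\<^bsub>G\<^esub>, Pos x), edge_inv G \<iota> (\<one>\<^bsub>G\<^esub>, Pos x)} \<rparr>, \<iota> x)"


section \<open>Strongly F-inverse monoids\<close>

text \<open>The \<open>\<sigma>\<close>-class \<open>C\<close> of the expansion indexed by \<open>g\<close> consists of its elements with second component
  \<open>g\<close>. As \<open>g\<close> is an element of \<open>S/\<sigma>\<close>, it is itself the corresponding \<open>\<sigma>\<close>-class, a subset of \<open>S\<close>. The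
  canonical morphism is unique, because its domain is generated by the image of \<open>X\<close>.\<close>

definition strongly_F_inverse :: "('s, 'm) monoid_scheme \<Rightarrow> ('x \<Rightarrow> 's) \<Rightarrow> bool" where
  "strongly_F_inverse S \<iota> \<longleftrightarrow> F_inverse S \<and> X_generated S \<iota> \<and>
     (let \<sigma> = min_group_congruence S;
          G = quotient_monoid S \<sigma>;
          \<gamma> = (\<lambda>x. \<sigma> `` {\<iota> x});
          E = margolis_meakin G \<gamma>
      in \<exists>\<phi>. canonical_morphism E (margolis_meakin_gen G \<gamma>) S \<iota> \<phi> \<and>
           (\<forall>C \<in> carrier E // min_group_congruence E. \<forall>\<Gamma> g.
              is_maximal E C (\<Gamma>, g) \<longrightarrow> is_maximum S g (\<phi> (\<Gamma>, g))))"


section \<open>Special inverse monoids\<close>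

definition word_monoid :: "'x letter list monoid" where
  "word_monoid = \<lparr> carrier = UNIV, monoid.mult = (@), one = [] \<rparr>"

text \<open>Vagner's presentation of the free inverse monoid.\<close>

definition vagner_congruence :: "('x letter list \<times> 'x letter list) set" where
  "vagner_congruence = generated_congruence word_monoid
     ({(u @ word_inv u @ u, u) | u. True} \<union>
      {(u @ word_inv u @ v @ word_inv v, v @ word_inv v @ u @ word_inv u) | u v. True})"

definition free_inverse_monoid :: "'x letter list set monoid" where
  "free_inverse_monoid = quotient_monoid word_monoid vagner_congruence"

definition free_inverse_elt :: "'x letter list \<Rightarrow> 'x letter list set" where
  "free_inverse_elt u = vagner_congruence `` {u}"

definition special_congruence ::
    "'x letter list \<Rightarrow> ('x letter list set \<times> 'x letter list set) set" where
  "special_congruence w =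
     generated_congruence free_inverse_monoid {(free_inverse_elt w, \<one>\<^bsub>free_inverse_monoid\<^esub>)}"

definition special_inverse_monoid :: "'x letter list \<Rightarrow> 'x letter list set set monoid" where
  "special_inverse_monoid w = quotient_monoid free_inverse_monoid (special_congruence w)"

text \<open>The element \<open>[u]\<close> of \<open>Inv\<langle>X | w = 1\<rangle>\<close>.\<close>

definition special_elt :: "'x letter list \<Rightarrow> 'x letter list \<Rightarrow> 'x letter list set set" where
  "special_elt w u = special_congruence w `` {free_inverse_elt u}"

definition special_gen :: "'x letter list \<Rightarrow> 'x \<Rightarrow> 'x letter list set set" where
  "special_gen w x = special_elt w [Pos x]"

definition represents_unit :: "'x letter list \<Rightarrow> 'x letter list \<Rightarrow> bool" where
  "represents_unit w u \<longleftrightarrow> special_elt w u \<in> Units (special_inverse_monoid w)"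

definition minimal_invertible_pieces :: "'x letter list \<Rightarrow> 'x letter list list \<Rightarrow> bool" where
  "minimal_invertible_pieces w ws \<longleftrightarrow> concat ws = w \<and>
     (\<forall>u \<in> set ws. u \<noteq> [] \<and> represents_unit w u \<and>
        (\<forall>p. p \<noteq> [] \<and> strict_prefix p u \<longrightarrow> \<not> represents_unit w p) \<and>
        (\<forall>s. s \<noteq> [] \<and> strict_suffix s u \<longrightarrow> \<not> represents_unit w s))"

text \<open>The factorisation into minimal invertible pieces exists and is unique.\<close>

lemma quotient_mult:
  assumes "monoid_congruence S r" "a \<in> carrier S" "b \<in> carrier S"
  shows "r `` {a} \<otimes>\<^bsub>quotient_monoid S r\<^esub> r `` {b} = r `` {a \<otimes>\<^bsub>S\<^esub> b}"
proof -
  have e: "equiv (carrier S) r"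
    and c: "\<And>a b c d. (a, b) \<in> r \<Longrightarrow> (c, d) \<in> r \<Longrightarrow> (a \<otimes>\<^bsub>S\<^esub> c, b \<otimes>\<^bsub>S\<^esub> d) \<in> r"
    using assms(1) by (auto simp: monoid_congruence_def)
  have "r `` (r `` {a} <#>\<^bsub>S\<^esub> r `` {b}) = r `` {a \<otimes>\<^bsub>S\<^esub> b}" (is "?L = ?R")
  proof
    show "?L \<subseteq> ?R"
    proof
      fix z assume "z \<in> ?L"
      then obtain c' d where cd: "(a, c') \<in> r" "(b, d) \<in> r" "(c' \<otimes>\<^bsub>S\<^esub> d, z) \<in> r"
        unfolding set_mult_def by blast
      with c have "(a \<otimes>\<^bsub>S\<^esub> b, c' \<otimes>\<^bsub>S\<^esub> d) \<in> r" by blast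
      with cd(3) e show "z \<in> ?R" by (meson ImageI equivE singletonI transD)
    qed
    have "(a, a) \<in> r" "(b, b) \<in> r" using e assms(2,3) by (meson equivE refl_onD)+
    then have "a \<otimes>\<^bsub>S\<^esub> b \<in> r `` {a} <#>\<^bsub>S\<^esub> r `` {b}" unfolding set_mult_def by blast
    then show "?R \<subseteq> ?L" by blast
  qed
  then show ?thesis by (simp add: quotient_monoid_def)
qed

lemma monoid_quotient:
  assumes "monoid S" "monoid_congruence S r"
  shows "monoid (quotient_monoid S r)"
proof -
  interpret monoid S by fact
  have rep: "\<exists>a \<in> carrier S. A = r `` {a}" if "A \<in> carrier (quotient_monoid S r)" for A
    using that by (auto simp: quotient_monoid_def elim: quotientE)
  have cl: "r `` {a} \<in> carrier (quotient_monoid S r)" if "a \<in> carrier S" for a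
    using that by (simp add: quotient_monoid_def quotientI)
  have one: "\<one>\<^bsub>quotient_monoid S r\<^esub> = r `` {\<one>\<^bsub>S\<^esub>}" by (simp add: quotient_monoid_def)
  show ?thesis
  proof (rule monoidI)
    fix A B C
    assume A: "A \<in> carrier (quotient_monoid S r)" and B: "B \<in> carrier (quotient_monoid S r)"
      and C: "C \<in> carrier (quotient_monoid S r)"
    obtain a where a: "a \<in> carrier S" "A = r `` {a}" using rep[OF A] by (rule bexE)
    obtain b where b: "b \<in> carrier S" "B = r `` {b}" using rep[OF B] by (rule bexE)
    obtain c where c: "c \<in> carrier S" "C = r `` {c}" using rep[OF C] by (rule bexE)
    show "A \<otimes>\<^bsub>quotient_monoid S r\<^esub> B \<in> carrier (quotient_monoid S r)"
      using a b by (simp add: quotient_mult[OF assms(2)] cl)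
    show "A \<otimes>\<^bsub>quotient_monoid S r\<^esub> B \<otimes>\<^bsub>quotient_monoid S r\<^esub> C =
        A \<otimes>\<^bsub>quotient_monoid S r\<^esub> (B \<otimes>\<^bsub>quotient_monoid S r\<^esub> C)"
      using a b c by (simp add: quotient_mult[OF assms(2)] m_assoc)
    show "\<one>\<^bsub>quotient_monoid S r\<^esub> \<otimes>\<^bsub>quotient_monoid S r\<^esub> A = A"
      using a by (simp add: quotient_mult[OF assms(2)] one)
    show "A \<otimes>\<^bsub>quotient_monoid S r\<^esub> \<one>\<^bsub>quotient_monoid S r\<^esub> = A"
      using a by (simp add: quotient_mult[OF assms(2)] one)
  qed (simp add: one cl)
qed

lemma monoid_congruence_generated:
  assumes "monoid S" "R \<subseteq> carrier S \<times> carrier S"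
  shows "monoid_congruence S (generated_congruence S R)" and "R \<subseteq> generated_congruence S R"
proof -
  interpret monoid S by fact
  have top: "monoid_congruence S (carrier S \<times> carrier S)"
    by (auto simp: monoid_congruence_def equiv_def refl_on_def sym_def trans_def)
  let ?F = "{r. monoid_congruence S r \<and> R \<subseteq> r}"
  have "equiv (carrier S) (\<Inter>?F)"
  proof (rule equivI)
    show "\<Inter>?F \<subseteq> carrier S \<times> carrier S" using top assms(2) by auto
    show "refl_on (carrier S) (\<Inter>?F)"
      unfolding refl_on_def monoid_congruence_def equiv_def by blast
    show "sym (\<Inter>?F)"
      by (rule symI) (auto simp: monoid_congruence_def equiv_def dest: symD)
    show "trans (\<Inter>?F)"
    proof (rule transI)
      fix x y z assume "(x, y) \<in> \<Inter>?F" "(y, z) \<in> \<Inter>?F"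
      moreover have "trans r" if "r \<in> ?F" for r
        using that by (simp add: monoid_congruence_def equiv_def)
      ultimately show "(x, z) \<in> \<Inter>?F" by (blast dest: transD)
    qed
  qed
  then show "monoid_congruence S (generated_congruence S R)"
    unfolding generated_congruence_def monoid_congruence_def by blast
  show "R \<subseteq> generated_congruence S R" unfolding generated_congruence_def by blast
qed

lemma monoid_word_monoid: "monoid word_monoid"
  by (rule monoidI) (auto simp: word_monoid_def)

lemma vagner_congruence: "monoid_congruence word_monoid vagner_congruence"
  unfolding vagner_congruence_def
  by (rule monoid_congruence_generated[OF monoid_word_monoid]) (simp add: word_monoid_def)

lemma monoid_free_inverse_monoid: "monoid free_inverse_monoid"
  unfolding free_inverse_monoid_def by (rule monoid_quotient[OF monoid_word_monoid vagner_congruence])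

lemma free_inverse_elt:
  "free_inverse_elt u \<in> carrier free_inverse_monoid"
  "free_inverse_elt u \<otimes>\<^bsub>free_inverse_monoid\<^esub> free_inverse_elt v = free_inverse_elt (u @ v)"
  "\<one>\<^bsub>free_inverse_monoid\<^esub> = free_inverse_elt []"
proof -
  show "free_inverse_elt u \<in> carrier free_inverse_monoid"
    unfolding free_inverse_elt_def free_inverse_monoid_def quotient_monoid_def
    by (simp add: quotientI word_monoid_def)
  show "free_inverse_elt u \<otimes>\<^bsub>free_inverse_monoid\<^esub> free_inverse_elt v = free_inverse_elt (u @ v)"
    unfolding free_inverse_elt_def free_inverse_monoid_def
    by (subst quotient_mult[OF vagner_congruence]) (simp_all add: word_monoid_def)
  show "\<one>\<^bsub>free_inverse_monoid\<^esub> = free_inverse_elt []"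
    by (simp add: free_inverse_elt_def free_inverse_monoid_def quotient_monoid_def word_monoid_def)
qed

lemma special_congruence:
  "monoid_congruence free_inverse_monoid (special_congruence w)"
  "(free_inverse_elt w, \<one>\<^bsub>free_inverse_monoid\<^esub>) \<in> special_congruence w"
proof -
  have R: "{(free_inverse_elt w, \<one>\<^bsub>free_inverse_monoid\<^esub>)}
      \<subseteq> carrier free_inverse_monoid \<times> carrier free_inverse_monoid"
    by (simp add: free_inverse_elt)
  note * = monoid_congruence_generated[OF monoid_free_inverse_monoid R]
  show "monoid_congruence free_inverse_monoid (special_congruence w)"
    using * unfolding special_congruence_def by blast
  show "(free_inverse_elt w, \<one>\<^bsub>free_inverse_monoid\<^esub>) \<in> special_congruence w"
    using * unfolding special_congruence_def by blast
qed

lemma monoid_special_inverse_monoid: "monoid (special_inverse_monoid w)"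
  unfolding special_inverse_monoid_def
  by (rule monoid_quotient[OF monoid_free_inverse_monoid special_congruence(1)])

lemma special_elt:
  "special_elt w u \<in> carrier (special_inverse_monoid w)"
  "special_elt w u \<otimes>\<^bsub>special_inverse_monoid w\<^esub> special_elt w v = special_elt w (u @ v)"
  "\<one>\<^bsub>special_inverse_monoid w\<^esub> = special_elt w []"
  "special_elt w w = special_elt w []"
proof -
  show "special_elt w u \<in> carrier (special_inverse_monoid w)"
    unfolding special_elt_def special_inverse_monoid_def quotient_monoid_def
    by (simp add: quotientI free_inverse_elt)
  show "special_elt w u \<otimes>\<^bsub>special_inverse_monoid w\<^esub> special_elt w v = special_elt w (u @ v)"
    unfolding special_elt_def special_inverse_monoid_def
    by (subst quotient_mult[OF special_congruence(1)]) (simp_all add: free_inverse_elt)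
  show "\<one>\<^bsub>special_inverse_monoid w\<^esub> = special_elt w []"
    by (simp add: special_elt_def special_inverse_monoid_def quotient_monoid_def free_inverse_elt)
  show "special_elt w w = special_elt w []"
    unfolding special_elt_def
    using special_congruence[of w]
    by (metis equiv_class_eq free_inverse_elt(3) monoid_congruence_def)
qed

lemma Units_cancel:
  assumes "monoid S" "a \<in> carrier S" "b \<in> carrier S" "a \<otimes>\<^bsub>S\<^esub> b \<in> Units S"
  shows "a \<in> Units S \<Longrightarrow> b \<in> Units S" and "b \<in> Units S \<Longrightarrow> a \<in> Units S"
proof -
  interpret monoid S by fact
  show "b \<in> Units S" if a: "a \<in> Units S"
  proof -
    have "inv\<^bsub>S\<^esub> a \<otimes>\<^bsub>S\<^esub> (a \<otimes>\<^bsub>S\<^esub> b) = b"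
      using a assms(2,3) by (simp add: m_assoc[symmetric])
    then show ?thesis using a assms(4) by (metis Units_inv_Units Units_m_closed)
  qed
  show "a \<in> Units S" if b: "b \<in> Units S"
  proof -
    have "(a \<otimes>\<^bsub>S\<^esub> b) \<otimes>\<^bsub>S\<^esub> inv\<^bsub>S\<^esub> b = a"
      using b assms(2,3) by (simp add: m_assoc)
    then show ?thesis using b assms(4) by (metis Units_inv_Units Units_m_closed)
  qed
qed

lemma represents_unit:
  "represents_unit w []" "represents_unit w w"
  "represents_unit w u \<Longrightarrow> represents_unit w v \<Longrightarrow> represents_unit w (u @ v)"
  "represents_unit w (u @ v) \<Longrightarrow> represents_unit w u \<Longrightarrow> represents_unit w v"
  "represents_unit w (u @ v) \<Longrightarrow> represents_unit w v \<Longrightarrow> represents_unit w u"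
proof -
  interpret monoid "special_inverse_monoid w" by (rule monoid_special_inverse_monoid)
  show "represents_unit w []" unfolding represents_unit_def by (metis Units_one_closed special_elt(3))
  then show "represents_unit w w" unfolding represents_unit_def by (simp add: special_elt(4))
  show "represents_unit w u \<Longrightarrow> represents_unit w v \<Longrightarrow> represents_unit w (u @ v)"
    unfolding represents_unit_def by (metis Units_m_closed special_elt(2))
  show "represents_unit w (u @ v) \<Longrightarrow> represents_unit w u \<Longrightarrow> represents_unit w v"
    unfolding represents_unit_def
    by (metis Units_cancel(1) monoid_special_inverse_monoid special_elt(1,2))
  show "represents_unit w (u @ v) \<Longrightarrow> represents_unit w v \<Longrightarrow> represents_unit w u"
    unfolding represents_unit_def
    by (metis Units_cancel(2) monoid_special_inverse_monoid special_elt(1,2))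
qed

lemma ex1_minimal_invertible_pieces: "\<exists>!ws. minimal_invertible_pieces w ws"
proof -
  define P where "P u \<longleftrightarrow> u \<noteq> [] \<and> represents_unit w u \<and>
        (\<forall>p. p \<noteq> [] \<and> strict_prefix p u \<longrightarrow> \<not> represents_unit w p) \<and>
        (\<forall>s. s \<noteq> [] \<and> strict_suffix s u \<longrightarrow> \<not> represents_unit w s)" for u
  have ex: "\<exists>ws. concat ws = v \<and> (\<forall>u \<in> set ws. P u)" if "represents_unit w v" for v
    using that
  proof (induction v rule: length_induct)
    case (1 v)
    show ?case
    proof (cases "v = []")
      case True then show ?thesis by (intro exI[of _ "[]"]) simp
    next
      case False
      let ?Q = "\<lambda>p. p \<noteq> [] \<and> prefix p v \<and> represents_unit w p"
      have "?Q v" using False 1 by simp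
      then obtain p where p: "?Q p" and min: "\<And>q. ?Q q \<Longrightarrow> length p \<le> length q"
        using ex_has_least_nat[of ?Q v length] by blast
      have pre: "\<not> represents_unit w q" if "q \<noteq> []" "strict_prefix q p" for q
        using that p min[of q] prefix_length_less[of q p]
        by (metis leD prefix_order.less_imp_le prefix_order.trans)
      have suf: "\<not> represents_unit w s" if "s \<noteq> []" "strict_suffix s p" for s
      proof
        assume s: "represents_unit w s"
        from that(2) obtain q where q: "p = q @ s" "q \<noteq> []"
          by (auto simp: strict_suffix_def suffix_def)
        with s p have "represents_unit w q" using represents_unit(5) by blast
        moreover have "strict_prefix q p" using q that(1) by (auto simp: strict_prefix_def)
        ultimately show False using pre q(2) by blast
      qed
      obtain z where z: "v = p @ z" using p by (auto simp: prefix_def)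
      then have "represents_unit w z" "length z < length v"
        using p 1 represents_unit(4) by auto
      with 1 obtain ws where "concat ws = z" "\<forall>u \<in> set ws. P u" by blast
      moreover have "P p" using p pre suf by (auto simp: P_def)
      ultimately show ?thesis using z by (intro exI[of _ "p # ws"]) simp
    qed
  qed
  have uniq: "ws = ws'" if "concat ws = concat ws'" "\<forall>u \<in> set ws. P u" "\<forall>u \<in> set ws'. P u" for ws ws'
    using that
  proof (induction ws arbitrary: ws')
    case Nil then show ?case by (cases ws') (auto simp: P_def)
  next
    case (Cons u ws)
    have P: "P u" and "ws' \<noteq> []" using Cons.prems by (auto simp: P_def)
    then obtain u' us where ws': "ws' = u' # us" by (cases ws') simp_all
    have P': "P u'" using Cons.prems(3) ws' by simp
    have "prefix u (concat ws')"
      using Cons.prems(1) by (intro prefixI[of _ _ "concat ws"]) simp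
    moreover have "prefix u' (concat ws')" using ws' by simp
    ultimately have "prefix u u' \<or> prefix u' u" using prefix_same_cases by blast
    with P P' have u: "u = u'" unfolding P_def strict_prefix_def by blast
    have "ws = us" using Cons.prems ws' u by (intro Cons.IH) simp_all
    with u ws' show ?case by simp
  qed
  show ?thesis
    using ex[OF represents_unit(2)] uniq
    unfolding minimal_invertible_pieces_def P_def[symmetric] by metis
qed

end

theory Submission
  imports Defs "HOL-Library.Countable_Set"
begin

text \<open>If all pieces have length at most two, the maximum group image \<open>G\<close> is a free product of the group of
  units with a free group. It acts on normal forms, and every normal form has a value in the inverse
  monoid which bounds from above all words representing it. A simple path in the Cayley graph never
  returns through an edge of the Bass--Serre tree at the cost of information, because it would have to
  revisit an endpoint of that edge; so its label attains the bound.

  Conversely, by Weinbaum's theorem \<open>w\<close> labels a simple closed path of the Cayley graph. If a piece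
  \<open>y b z\<close> of \<open>w = p y b z s\<close> has length at least three, then \<open>b\<close> and \<open>(z s p y)\<^sup>-\<^sup>1\<close> label simple paths with the
  same endpoints, so they are equal in a strongly \<open>F\<close>-inverse monoid. This makes \<open>y\<close> or \<open>z\<close> a unit if \<open>b\<close> is
  a left or right unit; otherwise two copies of the Schuetzenberger graph of \<open>1\<close> joined by an edge \<open>b\<close>
  separate the two words.

  Weinbaum's theorem follows from Magnus' Freiheitssatz. Both are obtained by induction on the length of the
  relator: weighting the letters so that the relator has total weight zero, one rewrites it to a shorter one
  whose translates form a staggered presentation, and amalgamates one-relator groups along free subgroups.\<close>

section \<open>Group presentations\<close>

text \<open>Magnus's classical argument adjoins a root of a generator when no letter has exponent
  sum zero in the relator. Here that substitution is absorbed into the weights: only the forward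
  direction is used, that consequences of the relator rewrite to consequences of its translates, and
  triviality comes back because rewriting keeps reduced words reduced. Rewriting changes the type of
  the words, which an induction hypothesis cannot follow; hence the inductions run over natural
  number letters.

  The inverse monoid is given only by a congruence, so elements are told apart through models of its
  relations. For upper bounds, the value of a normal form follows the group action only up to the
  natural order, and the point is to locate where the inequality can be strict. The canonical
  morphism must be constructed too: the graph spanned by a path, with its end vertex, has to
  determine the element represented by the label.\<close>

lemma letter_inv_letter_inv [simp]: "letter_inv (letter_inv a) = a"
  by (cases a) auto

lemma letter_inv_eq_iff [simp]: "letter_inv a = letter_inv b \<longleftrightarrow> a = b"
  by (metis letter_inv_letter_inv)

fun letter_name :: "'x letter \<Rightarrow> 'x" where
  "letter_name (Pos x) = x"
| "letter_name (Neg x) = x"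

lemma letter_name_inv [simp]: "letter_name (letter_inv a) = letter_name a"
  by (cases a) auto

lemma letter_eq_or_inv: "letter_name a = letter_name b \<Longrightarrow> a = b \<or> a = letter_inv b"
  by (cases a; cases b) auto

abbreviation names :: "'x letter list \<Rightarrow> 'x set" where
  "names u \<equiv> letter_name ` set u"

lemma word_inv_simps [simp]:
  "word_inv [] = []"
  "word_inv (a # u) = word_inv u @ [letter_inv a]"
  "word_inv (u @ v) = word_inv v @ word_inv u"
  by (simp_all add: word_inv_def)

lemma word_inv_word_inv [simp]: "word_inv (word_inv u) = u"
  by (induction u) auto

lemma names_word_inv [simp]: "names (word_inv u) = names u"
  by (simp add: word_inv_def image_image)

text \<open>Equality in the group with relators \<open>R\<close>, kept as a derivation relation on
  words: enlarging \<open>R\<close>, renaming letters or extracting finitely many relators is then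
  an induction. \<open>gpeq {}\<close> is equality in the free group.\<close>

inductive gpeq :: "'x letter list set \<Rightarrow> 'x letter list \<Rightarrow> 'x letter list \<Rightarrow> bool" for R where
  refl [simp]: "gpeq R u u"
| sym: "gpeq R u v \<Longrightarrow> gpeq R v u"
| trans [trans]: "gpeq R u v \<Longrightarrow> gpeq R v z \<Longrightarrow> gpeq R u z"
| app: "gpeq R u u' \<Longrightarrow> gpeq R v v' \<Longrightarrow> gpeq R (u @ v) (u' @ v')"
| pair: "gpeq R [a, letter_inv a] []"
| rel: "r \<in> R \<Longrightarrow> gpeq R r []"

lemma gpeq_word_inv_right: "gpeq R (u @ word_inv u) []"
proof (induction u rule: rev_induct)
  case (snoc a u)
  have "gpeq R (u @ [a, letter_inv a] @ word_inv u) (u @ [] @ word_inv u)"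
    by (intro gpeq.app gpeq.pair gpeq.refl)
  with snoc show ?case by (auto intro: gpeq.trans)
qed simp

lemma gpeq_word_inv_left: "gpeq R (word_inv u @ u) []"
  using gpeq_word_inv_right[of R "word_inv u"] by simp

lemma gpeq_append_left_iff [simp]: "gpeq R (u @ v) (u @ v') \<longleftrightarrow> gpeq R v v'"
proof
  have *: "gpeq R ((word_inv u @ u) @ z) ([] @ z)" for z
    by (intro gpeq.app gpeq_word_inv_left gpeq.refl)
  assume "gpeq R (u @ v) (u @ v')"
  then have "gpeq R (word_inv u @ u @ v) (word_inv u @ u @ v')" by (rule gpeq.app[OF gpeq.refl])
  with *[of v] *[of v'] show "gpeq R v v'" by (metis append_Nil append.assoc gpeq.sym gpeq.trans)
qed (blast intro: gpeq.app gpeq.refl)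

lemma gpeq_append_right_iff [simp]: "gpeq R (u @ v) (u' @ v) \<longleftrightarrow> gpeq R u u'"
proof
  have *: "gpeq R (z @ v @ word_inv v) (z @ [])" for z
    by (intro gpeq.app gpeq_word_inv_right gpeq.refl)
  assume "gpeq R (u @ v) (u' @ v)"
  then have "gpeq R ((u @ v) @ word_inv v) ((u' @ v) @ word_inv v)" by (rule gpeq.app[OF _ gpeq.refl])
  with *[of u] *[of u'] show "gpeq R u u'"
    by (metis append_Nil2 append.assoc gpeq.sym gpeq.trans)
qed (blast intro: gpeq.app gpeq.refl)

lemma gpeq_iff_Nil: "gpeq R u v \<longleftrightarrow> gpeq R (u @ word_inv v) []"
  by (metis gpeq.sym gpeq.trans gpeq_append_right_iff gpeq_word_inv_right)

lemma gpeq_word_inv: "gpeq R u v \<Longrightarrow> gpeq R (word_inv u) (word_inv v)"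
  by (metis gpeq.sym gpeq.trans gpeq_append_left_iff gpeq_append_right_iff gpeq_word_inv_left)

lemma gpeq_word_inv_Nil_iff [simp]: "gpeq R (word_inv u) [] \<longleftrightarrow> gpeq R u []"
  by (metis gpeq_word_inv word_inv_simps(1) word_inv_word_inv)

lemma gpeq_rotate: "gpeq R (u @ v) [] \<longleftrightarrow> gpeq R (v @ u) []"
proof -
  have "gpeq R (v @ u) []" if "gpeq R (u @ v) []" for u v
  proof -
    have "gpeq R (v @ (u @ v) @ word_inv v) (v @ [] @ word_inv v)"
      by (intro gpeq.app gpeq.refl that)
    then have "gpeq R ((v @ u) @ v @ word_inv v) []"
      using gpeq_word_inv_right gpeq.trans by fastforce
    moreover have "gpeq R ((v @ u) @ v @ word_inv v) ((v @ u) @ [])"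
      by (intro gpeq.app gpeq.refl gpeq_word_inv_right)
    ultimately show ?thesis by (metis append_Nil2 gpeq.sym gpeq.trans)
  qed
  then show ?thesis by blast
qed

lemma gpeq_relators:
  assumes "gpeq R u v" and "\<And>r. r \<in> R \<Longrightarrow> gpeq R' r []"
  shows "gpeq R' u v"
  using assms(1) by induction (auto intro: gpeq.intros assms(2))

lemma gpeq_mono: "gpeq R u v \<Longrightarrow> R \<subseteq> R' \<Longrightarrow> gpeq R' u v"
  by (erule gpeq_relators) (auto intro: gpeq.rel)

text \<open>A derivation is finite. This reduces the family of all integer translates of a relator
  to a finite interval of it.\<close>

lemma gpeq_finite_relators:
  assumes "gpeq R u v" shows "\<exists>R'. finite R' \<and> R' \<subseteq> R \<and> gpeq R' u v"
  using assms
proof induction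
  case (trans u v z)
  then obtain R1 R2 where "finite R1" "R1 \<subseteq> R" "gpeq R1 u v" "finite R2" "R2 \<subseteq> R" "gpeq R2 v z"
    by blast
  then show ?case by (intro exI[of _ "R1 \<union> R2"]) (auto intro: gpeq.trans gpeq_mono)
next
  case (app u u' v v')
  then obtain R1 R2 where "finite R1" "R1 \<subseteq> R" "gpeq R1 u u'" "finite R2" "R2 \<subseteq> R" "gpeq R2 v v'"
    by blast
  then show ?case by (intro exI[of _ "R1 \<union> R2"]) (auto intro: gpeq.app gpeq_mono)
next
  case (rel r)
  then show ?case by (intro exI[of _ "{r}"]) (auto intro: gpeq.rel)
qed (blast intro: gpeq.intros)+

lemma gpeq_map:
  assumes "gpeq R u v"
  shows "gpeq (map (map_letter f) ` R) (map (map_letter f) u) (map (map_letter f) v)"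
  using assms
proof induction
  case (pair a)
  have "map_letter f (letter_inv a) = letter_inv (map_letter f a)" by (cases a) auto
  then show ?case by (simp add: gpeq.pair)
qed (auto intro: gpeq.intros)

text \<open>Letters acting on \<open>\<Omega>\<close> by mutually inverse permutations, with all
  relators acting trivially, make the presented group act. Free reduction, the amalgamated product
  and the normal forms of the inverse monoid are all treated in this way.\<close>

lemma gpeq_action:
  assumes "gpeq R u v"
    and "\<And>a s. s \<in> \<Omega> \<Longrightarrow> \<delta> a s \<in> \<Omega>"
    and "\<And>a s. s \<in> \<Omega> \<Longrightarrow> \<delta> (letter_inv a) (\<delta> a s) = s"
    and "\<And>r s. r \<in> R \<Longrightarrow> s \<in> \<Omega> \<Longrightarrow> fold \<delta> r s = s"
  shows "s \<in> \<Omega> \<Longrightarrow> fold \<delta> u s = fold \<delta> v s"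
proof -
  have cl: "s \<in> \<Omega> \<Longrightarrow> fold \<delta> u s \<in> \<Omega>" for u s
    by (induction u arbitrary: s) (auto simp: assms(2))
  show "s \<in> \<Omega> \<Longrightarrow> fold \<delta> u s = fold \<delta> v s"
    using assms(1) by (induction arbitrary: s) (auto simp: assms(3,4) cl)
qed

section \<open>Reduced words and the free group\<close>

lemma sublist_pair_iff:
  "sublist [a, b] (c # u) \<longleftrightarrow> (c = a \<and> u \<noteq> [] \<and> hd u = b) \<or> sublist [a, b] u"
  by (cases u) (auto simp: sublist_Cons_right)

lemma reduced_Nil [simp]: "reduced []"
  by (auto simp: reduced_def)

lemma reduced_Cons: "reduced (a # u) \<longleftrightarrow> (u \<noteq> [] \<longrightarrow> hd u \<noteq> letter_inv a) \<and> reduced u"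
  by (auto simp: reduced_def sublist_pair_iff)

lemma reduced_append:
  "reduced (u @ v) \<longleftrightarrow> reduced u \<and> reduced v \<and> (u \<noteq> [] \<longrightarrow> v \<noteq> [] \<longrightarrow> hd v \<noteq> letter_inv (last u))"
  by (induction u) (auto simp: reduced_Cons)

lemma reduced_word_inv: "reduced u \<Longrightarrow> reduced (word_inv u)"
proof (induction u)
  case (Cons a u)
  then show ?case
    by (cases u) (auto simp: reduced_Cons reduced_append)
qed simp

lemma cyclically_reduced_iff: "cyclically_reduced u \<longleftrightarrow> reduced (u @ u)"
  by (cases "u = []") (auto simp: cyclically_reduced_def reduced_append)

lemma ex_reduced: "\<exists>v. reduced v \<and> gpeq {} u v \<and> names v \<subseteq> names u"
proof (induction u)
  case (Cons a u)
  then obtain v where v: "reduced v" "gpeq {} u v" "names v \<subseteq> names u" by blast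
  have av: "gpeq {} (a # u) (a # v)" using gpeq.app[OF gpeq.refl v(2), of "[a]"] by simp
  show ?case
  proof (cases "v \<noteq> [] \<and> hd v = letter_inv a")
    case True
    then obtain v' where v': "v = letter_inv a # v'" by (cases v) auto
    have "gpeq {} (a # v) v'" using gpeq.app[OF gpeq.pair gpeq.refl, of "{}" a v'] v' by simp
    with av v v' show ?thesis by (intro exI[of _ v']) (auto simp: reduced_Cons intro: gpeq.trans)
  next
    case False
    with av v show ?thesis by (intro exI[of _ "a # v"]) (auto simp: reduced_Cons)
  qed
qed auto

text \<open>Van der Waerden's argument: a letter is put on a stack or cancels its top. A reduced
  word never cancels, so from the empty stack it is reproduced, in reverse order.\<close>

lemma reduced_gpeq_Nil:
  assumes "reduced u" "gpeq {} u []" shows "u = []"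
proof -
  define \<delta> where "\<delta> a s = (if s \<noteq> [] \<and> hd s = letter_inv a then tl s else a # s)" for a and s :: "'a letter list"
  have run: "fold \<delta> u s = rev u @ s" if "reduced (rev s @ u)" for u s
    using that
  proof (induction u arbitrary: s)
    case (Cons a u)
    have "s = [] \<or> hd s \<noteq> letter_inv a"
      using Cons.prems by (cases s) (auto simp: reduced_append reduced_Cons)
    then have "\<delta> a s = a # s" by (auto simp: \<delta>_def)
    then show ?case using Cons by simp
  qed simp
  have "fold \<delta> u [] = fold \<delta> [] []"
  proof (rule gpeq_action[OF assms(2), where \<Omega> = "{s. reduced s}"])
    fix a and s :: "'a letter list" assume "s \<in> {s. reduced s}"
    then show "\<delta> a s \<in> {s. reduced s}" "\<delta> (letter_inv a) (\<delta> a s) = s"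
      by (cases s; cases "tl s"; auto simp: \<delta>_def reduced_Cons)+
  qed simp_all
  with run[of "[]" u] assms(1) show ?thesis by simp
qed

section \<open>Amalgamation\<close>

definition gp_rep :: "'x letter list set \<Rightarrow> 'x letter list \<Rightarrow> 'x letter list" where
  "gp_rep R u = (SOME v. gpeq R u v)"

text \<open>The chosen property depends only on the left coset of \<open>u\<close> modulo the
  subgroup generated by \<open>W\<close>. So the choice is literally the same word for all members
  of a coset, and equality of words expresses equality of cosets.\<close>

definition coset_rep :: "'x letter list set \<Rightarrow> 'x set \<Rightarrow> 'x letter list \<Rightarrow> 'x letter list" where
  "coset_rep R W u = (SOME s. \<exists>a. names a \<subseteq> W \<and> gpeq R u (s @ a))"

definition coset_part :: "'x letter list set \<Rightarrow> 'x set \<Rightarrow> 'x letter list \<Rightarrow> 'x letter list" where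
  "coset_part R W u = (SOME a. names a \<subseteq> W \<and> gpeq R u (coset_rep R W u @ a))"

lemma gp_rep: "gpeq R u (gp_rep R u)"
  unfolding gp_rep_def by (rule someI[of _ u]) simp

lemma gp_rep_cong:
  assumes "gpeq R u v" shows "gp_rep R u = gp_rep R v"
proof -
  have "gpeq R u z \<longleftrightarrow> gpeq R v z" for z using assms gpeq.sym gpeq.trans by blast
  then show ?thesis by (simp add: gp_rep_def)
qed

lemma gp_rep_eq_iff: "gp_rep R u = gp_rep R v \<longleftrightarrow> gpeq R u v"
  by (metis gp_rep gp_rep_cong gpeq.sym gpeq.trans)

lemma gp_rep_gp_rep [simp]: "gp_rep R (gp_rep R u) = gp_rep R u"
  by (metis gp_rep gp_rep_cong)

lemma gp_rep_append [simp]: "gp_rep R (gp_rep R u @ v) = gp_rep R (u @ v)"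
  by (metis gp_rep gp_rep_eq_iff gpeq.sym gpeq_append_right_iff)

lemma coset_part: "names (coset_part R W u) \<subseteq> W" "gpeq R u (coset_rep R W u @ coset_part R W u)"
proof -
  have "\<exists>s a. names a \<subseteq> W \<and> gpeq R u (s @ a)" by (intro exI[of _ u] exI[of _ "[]"]) simp
  then have "\<exists>a. names a \<subseteq> W \<and> gpeq R u (coset_rep R W u @ a)"
    unfolding coset_rep_def by (rule someI_ex)
  then have "names (coset_part R W u) \<subseteq> W \<and> gpeq R u (coset_rep R W u @ coset_part R W u)"
    unfolding coset_part_def by (rule someI_ex)
  then show "names (coset_part R W u) \<subseteq> W" "gpeq R u (coset_rep R W u @ coset_part R W u)" by blast+
qed

lemma coset_rep_cong:
  assumes "gpeq R u' (u @ a)" "names a \<subseteq> W" shows "coset_rep R W u' = coset_rep R W u"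
proof -
  have "(\<exists>b. names b \<subseteq> W \<and> gpeq R u' (s @ b)) \<longleftrightarrow> (\<exists>b. names b \<subseteq> W \<and> gpeq R u (s @ b))" for s
  proof safe
    fix b assume b: "names b \<subseteq> W" "gpeq R u' (s @ b)"
    then have "gpeq R (u @ a) (s @ b)" using assms(1) by (metis gpeq.sym gpeq.trans)
    then have "gpeq R ((u @ a) @ word_inv a) ((s @ b) @ word_inv a)" by (simp only: gpeq_append_right_iff)
    moreover have "gpeq R (u @ (a @ word_inv a)) (u @ [])"
      by (intro gpeq.app gpeq_word_inv_right gpeq.refl)
    ultimately have "gpeq R u (s @ b @ word_inv a)" by (metis append.assoc append_Nil2 gpeq.sym gpeq.trans)
    with b assms(2) show "\<exists>b. names b \<subseteq> W \<and> gpeq R u (s @ b)"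
      by (intro exI[of _ "b @ word_inv a"]) (simp add: image_Un)
  next
    fix b assume b: "names b \<subseteq> W" "gpeq R u (s @ b)"
    then have "gpeq R (u @ a) ((s @ b) @ a)" by (simp only: gpeq_append_right_iff)
    with assms(1) have "gpeq R u' (s @ b @ a)" by (metis append.assoc gpeq.trans)
    with b assms(2) show "\<exists>b. names b \<subseteq> W \<and> gpeq R u' (s @ b)"
      by (intro exI[of _ "b @ a"]) (simp add: image_Un)
  qed
  then show ?thesis by (simp add: coset_rep_def)
qed

lemma coset_rep_coset_rep [simp]: "coset_rep R W (coset_rep R W u) = coset_rep R W u"
  by (metis coset_part coset_rep_cong)

lemma coset_rep_append [simp]: "names a \<subseteq> W \<Longrightarrow> coset_rep R W (u @ a) = coset_rep R W u"
  by (rule coset_rep_cong) auto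

lemma coset_rep_gp_rep [simp]: "coset_rep R W (gp_rep R u) = coset_rep R W u"
  by (rule coset_rep_cong[where a = "[]"]) (auto intro: gpeq.sym gp_rep)

text \<open>The permutational product: if \<open>T\<^sub>1\<close> and \<open>T\<^sub>2\<close> are transversals of the common subgroup \<open>A\<close> in
  \<open>P\<close> and \<open>Q\<close>, then \<open>P \<times> T\<^sub>2\<close> and \<open>T\<^sub>1 \<times> Q\<close> are both in bijection with \<open>T\<^sub>1 \<times> A \<times> T\<^sub>2\<close>, and so \<open>P\<close> and
  \<open>Q\<close> act on the same set by right multiplication, in agreement on \<open>A\<close>.\<close>

lemma amalgam_embedding:
  assumes R1: "\<And>r. r \<in> R1 \<Longrightarrow> names r \<subseteq> Z1" and R2: "\<And>r. r \<in> R2 \<Longrightarrow> names r \<subseteq> Z2"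
    and Z0: "\<And>v. names v \<subseteq> Z1 \<inter> Z2 \<Longrightarrow> gpeq R1 v [] \<longleftrightarrow> gpeq R2 v []"
    and v: "names v \<subseteq> Z1" "gpeq (R1 \<union> R2) v []"
  shows "gpeq R1 v []"
proof -
  let ?W = "Z1 \<inter> Z2"
  have Z0': "gpeq R1 u v \<longleftrightarrow> gpeq R2 u v" if "names u \<subseteq> ?W" "names v \<subseteq> ?W" for u v
    using Z0[of "u @ word_inv v"] that by (simp add: image_Un gpeq_iff_Nil[of _ u v])
  define n1 n2 c1 c2 d1 d2 where nc: "n1 = gp_rep R1" "n2 = gp_rep R2"
    "c1 = coset_rep R1 ?W" "c2 = coset_rep R2 ?W" "d1 = coset_part R1 ?W" "d2 = coset_part R2 ?W"
  define \<Omega> where "\<Omega> = {(p, t). n1 p = p \<and> c2 t = t}"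
  define \<beta> where "\<beta> = (\<lambda>(p, t). (c1 p, n2 (t @ d1 p)))"
  define \<gamma> where "\<gamma> = (\<lambda>(s, q). (n1 (s @ d2 q), c2 q))"
  \<comment> \<open>Letters of \<open>Z1\<close> multiply the coordinate in the first group. All
    other letters are carried out in the other picture, with \<open>\<gamma>\<close> leading back;
    for letters outside both alphabets this is harmless and keeps every letter invertible.\<close>
  define \<delta> where "\<delta> a = (\<lambda>(p, t). if letter_name a \<in> Z1 then (n1 (p @ [a]), t)
     else \<gamma> (c1 p, n2 (t @ d1 p @ [a])))" for a
  have cd1: "gpeq R1 p (c1 p @ d1 p)" and dW1: "names (d1 p) \<subseteq> ?W" for p
    by (simp_all only: nc coset_part)
  have cd2: "gpeq R2 p (c2 p @ d2 p)" and dW2: "names (d2 p) \<subseteq> ?W" for p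
    by (simp_all only: nc coset_part)
  have part1: "gpeq R2 (d1 p) a" if "gpeq R1 p (c1 p @ a)" "names a \<subseteq> ?W" for p a
  proof -
    have "gpeq R1 (c1 p @ d1 p) (c1 p @ a)" using cd1 that(1) by (metis gpeq.sym gpeq.trans)
    then show ?thesis using Z0'[OF dW1 that(2)] by simp
  qed
  have part2: "gpeq R1 (d2 p) a" if "gpeq R2 p (c2 p @ a)" "names a \<subseteq> ?W" for p a
  proof -
    have "gpeq R2 (c2 p @ d2 p) (c2 p @ a)" using cd2 that(1) by (metis gpeq.sym gpeq.trans)
    then show ?thesis using Z0'[OF dW2 that(2)] by simp
  qed
  have \<gamma>\<beta>: "\<gamma> (c1 p, n2 (t @ d1 p)) = (p, t)" if "(p, t) \<in> \<Omega>" for p t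
  proof -
    from that have p: "n1 p = p" and t: "c2 t = t" by (auto simp: \<Omega>_def)
    have c2: "c2 (n2 (t @ d1 p)) = t" using dW1 t by (simp add: nc)
    have "gpeq R2 (n2 (t @ d1 p)) (t @ d1 p)" by (simp add: nc gpeq.sym gp_rep)
    then have "gpeq R1 (d2 (n2 (t @ d1 p))) (d1 p)" using part2 c2 dW1 by metis
    then have "gpeq R1 (c1 p @ d2 (n2 (t @ d1 p))) (c1 p @ d1 p)" by simp
    then have "gpeq R1 (c1 p @ d2 (n2 (t @ d1 p))) p" using cd1 by (metis gpeq.sym gpeq.trans)
    then have "n1 (c1 p @ d2 (n2 (t @ d1 p))) = n1 p" by (simp add: nc gp_rep_eq_iff)
    with c2 p show ?thesis by (simp add: \<gamma>_def)
  qed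
  have \<beta>\<gamma>: "\<beta> (\<gamma> (s, q)) = (s, q)" "\<gamma> (s, q) \<in> \<Omega>" if "c1 s = s" "n2 q = q" for s q
  proof -
    have c1: "c1 (n1 (s @ d2 q)) = s" using dW2 that(1) by (simp add: nc)
    have "gpeq R1 (n1 (s @ d2 q)) (s @ d2 q)" by (simp add: nc gpeq.sym gp_rep)
    then have "gpeq R2 (d1 (n1 (s @ d2 q))) (d2 q)" using part1 c1 dW2 by metis
    then have "gpeq R2 (c2 q @ d1 (n1 (s @ d2 q))) (c2 q @ d2 q)" by simp
    then have "gpeq R2 (c2 q @ d1 (n1 (s @ d2 q))) q" using cd2 by (metis gpeq.sym gpeq.trans)
    then have "n2 (c2 q @ d1 (n1 (s @ d2 q))) = n2 q" by (simp add: nc gp_rep_eq_iff)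
    with c1 that show "\<beta> (\<gamma> (s, q)) = (s, q)" by (simp add: \<gamma>_def \<beta>_def)
    show "\<gamma> (s, q) \<in> \<Omega>" by (simp add: \<gamma>_def \<Omega>_def nc)
  qed
  have \<beta>1: "c1 (c1 p) = c1 p" "n2 (n2 p) = n2 p" for p by (simp_all add: nc)
  \<comment> \<open>A common letter is executed in the first group. That the second picture gives
    the same state is the agreement of the two actions on the amalgamated subgroup.\<close>
  have \<delta>2: "\<delta> a (p, t) = \<gamma> (c1 p, n2 (t @ d1 p @ [a]))"
    if \<Omega>: "(p, t) \<in> \<Omega>" and a: "letter_name a \<in> Z2" for a p t
  proof (cases "letter_name a \<in> Z1")
    case True
    with a have aW: "names [a] \<subseteq> ?W" by simp
    let ?p = "n1 (p @ [a])"
    have c: "c1 ?p = c1 p" using aW by (simp add: nc)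
    have "gpeq R1 (p @ [a]) ((c1 p @ d1 p) @ [a])" by (simp only: gpeq_append_right_iff cd1)
    then have "gpeq R1 ?p (c1 p @ d1 p @ [a])" by (metis append.assoc gp_rep gpeq.sym gpeq.trans nc(1))
    then have "gpeq R2 (d1 ?p) (d1 p @ [a])" using part1[of ?p "d1 p @ [a]"] c aW dW1
      by (simp add: image_Un)
    then have "n2 (t @ d1 ?p) = n2 (t @ d1 p @ [a])" by (simp add: nc gp_rep_eq_iff)
    moreover have "(?p, t) \<in> \<Omega>" using \<Omega> by (simp add: \<Omega>_def nc)
    ultimately show ?thesis using \<gamma>\<beta>[of ?p t] c True by (simp add: \<delta>_def)
  qed (simp add: \<delta>_def)
  have cl: "\<delta> a \<omega> \<in> \<Omega>" if "\<omega> \<in> \<Omega>" for a \<omega>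
  proof -
    obtain p t where \<omega>: "\<omega> = (p, t)" by (cases \<omega>)
    show ?thesis
      using that \<beta>\<gamma>(2)[of "c1 p" "n2 (t @ d1 p @ [a])"] by (auto simp: \<omega> \<delta>_def \<Omega>_def nc)
  qed
  have pair: "gpeq R (u @ [a] @ [letter_inv a]) u" for R and a :: "'a letter" and u
    using gpeq.app[OF gpeq.refl gpeq.pair, of R u a] by simp
  have inv: "\<delta> (letter_inv a) (\<delta> a \<omega>) = \<omega>" if "\<omega> \<in> \<Omega>" for a \<omega>
  proof -
    obtain p t where \<omega>: "\<omega> = (p, t)" by (cases \<omega>)
    from that have p: "n1 p = p" and t: "c2 t = t" by (auto simp: \<omega> \<Omega>_def)
    show ?thesis
    proof (cases "letter_name a \<in> Z1")
      case True
      then show ?thesis using p gp_rep_cong[OF pair, of R1 p a] by (simp add: \<delta>_def \<omega> nc)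
    next
      case False
      let ?q = "n2 (t @ d1 p @ [a])"
      obtain p' t' where p't': "\<gamma> (c1 p, ?q) = (p', t')" by (cases "\<gamma> (c1 p, ?q)")
      have "\<beta> (p', t') = (c1 p, ?q)" using \<beta>\<gamma>(1)[of "c1 p" ?q] \<beta>1 p't' by simp
      then have *: "c1 p' = c1 p" "n2 (t' @ d1 p') = ?q" by (auto simp: \<beta>_def)
      have "n2 (t' @ d1 p' @ [letter_inv a]) = n2 (n2 (t' @ d1 p') @ [letter_inv a])" by (simp add: nc)
      also have "\<dots> = n2 ((t @ d1 p) @ [a] @ [letter_inv a])" by (simp only: *) (simp add: nc)
      also have "\<dots> = n2 (t @ d1 p)" unfolding nc by (rule gp_rep_cong[OF pair])
      finally show ?thesis using False \<gamma>\<beta>[of p t] that by (simp add: \<delta>_def \<omega> p't' *)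
    qed
  qed
  have fold1: "fold \<delta> u (p, t) = (n1 (p @ u), t)" if "names u \<subseteq> Z1" "n1 p = p" for u p t
    using that
  proof (induction u arbitrary: p)
    case (Cons a u)
    then show ?case by (simp add: \<delta>_def nc)
  qed simp
  have fold2: "fold \<delta> u (p, t) = \<gamma> (c1 p, n2 (t @ d1 p @ u))" if "names u \<subseteq> Z2" "(p, t) \<in> \<Omega>" for u p t
    using that
  proof (induction u arbitrary: p t)
    case Nil
    then show ?case using \<gamma>\<beta> by simp
  next
    case (Cons a u)
    obtain p' t' where p't': "\<delta> a (p, t) = (p', t')" by (cases "\<delta> a (p, t)")
    then have \<gamma>: "\<gamma> (c1 p, n2 (t @ d1 p @ [a])) = (p', t')" using \<delta>2[of p t a] Cons.prems by simp
    then have "\<beta> (p', t') = (c1 p, n2 (t @ d1 p @ [a]))"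
      using \<beta>\<gamma>(1)[of "c1 p" "n2 (t @ d1 p @ [a])"] \<beta>1 by simp
    then have *: "c1 p' = c1 p" "n2 (t' @ d1 p') = n2 (t @ d1 p @ [a])" by (auto simp: \<beta>_def)
    have "(p', t') \<in> \<Omega>" using cl[of "(p, t)" a] Cons.prems p't' by simp
    then have "fold \<delta> (a # u) (p, t) = \<gamma> (c1 p', n2 (t' @ d1 p' @ u))"
      using Cons p't' by simp
    also have "n2 (t' @ d1 p' @ u) = n2 (n2 (t' @ d1 p') @ u)" by (simp add: nc)
    also have "\<dots> = n2 (t @ d1 p @ a # u)" by (simp only: *) (simp add: nc)
    finally show ?case by (simp only: *)
  qed
  have "fold \<delta> v \<omega> = fold \<delta> [] \<omega>" if "\<omega> \<in> \<Omega>" for \<omega>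
  proof (rule gpeq_action[OF v(2), where \<delta> = \<delta> and \<Omega> = \<Omega>, OF cl inv _ that])
    fix r \<omega> assume r: "r \<in> R1 \<union> R2" and \<omega>: "\<omega> \<in> \<Omega>"
    obtain p t where pt: "\<omega> = (p, t)" by (cases \<omega>)
    have p: "n1 p = p" using \<omega> by (auto simp: pt \<Omega>_def)
    from r show "fold \<delta> r \<omega> = \<omega>"
    proof
      assume r: "r \<in> R1"
      then have "gpeq R1 (p @ r) (p @ [])" by (intro gpeq.app gpeq.refl gpeq.rel)
      then have "n1 (p @ r) = n1 p" by (simp add: nc gp_rep_eq_iff)
      with r p show ?thesis by (simp add: pt fold1 R1)
    next
      assume r: "r \<in> R2"
      then have "gpeq R2 ((t @ d1 p) @ r) ((t @ d1 p) @ [])" by (intro gpeq.app gpeq.refl gpeq.rel)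
      then have "n2 (t @ d1 p @ r) = n2 (t @ d1 p)" by (simp add: nc gp_rep_eq_iff)
      with r \<omega> show ?thesis by (simp add: pt fold2 R2 \<gamma>\<beta>)
    qed
  qed
  from this[of "(n1 [], c2 [])"] have "n1 (n1 [] @ v) = n1 []"
    using fold1[OF v(1), of "n1 []"] by (simp add: \<Omega>_def nc)
  then show ?thesis by (simp add: nc gp_rep_eq_iff)
qed

section \<open>Staggered presentations\<close>

text \<open>The \<open>k\<close>-th relator occupies the window from \<open>m + s * k\<close> to
  \<open>M + s * k\<close> and touches both ends; letters with \<open>pos x = None\<close> may occur
  anywhere. The assumption \<open>free\<close> is the Freiheitssatz for one relator, which in its
  own proof is the induction hypothesis.\<close>

locale staggered =
  fixes \<rho> :: "int \<Rightarrow> 'x letter list" and pos :: "'x \<Rightarrow> int option" and m M s :: int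
  assumes s: "s > 0"
    and range: "x \<in> names (\<rho> k) \<Longrightarrow> pos x = Some i \<Longrightarrow> m + s * k \<le> i \<and> i \<le> M + s * k"
    and lo: "\<exists>x \<in> names (\<rho> k). pos x = Some (m + s * k)"
    and hi: "\<exists>x \<in> names (\<rho> k). pos x = Some (M + s * k)"
    and free: "b \<in> names (\<rho> k) \<Longrightarrow> b \<notin> names v \<Longrightarrow> gpeq {\<rho> k} v [] \<Longrightarrow> gpeq {} v []"
begin

definition confined :: "int \<Rightarrow> int \<Rightarrow> 'x letter list \<Rightarrow> bool" where
  "confined p q v \<longleftrightarrow> (\<forall>x \<in> names v. \<forall>i. pos x = Some i \<longrightarrow> p \<le> i \<and> i \<le> q)"

definition short_free :: "int \<Rightarrow> int \<Rightarrow> bool" where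
  "short_free k l \<longleftrightarrow> (\<forall>v p q. gpeq (\<rho> ` {k..<l}) v [] \<longrightarrow> confined p q v \<longrightarrow> q - p < M - m \<longrightarrow> gpeq {} v [])"

text \<open>Amalgamate the relators below \<open>l\<close> with \<open>\<rho> l\<close> along the
  letters whose position, if any, lies in the window of \<open>\<rho> l\<close> without its top end.
  Words over these are narrower than a window, so \<open>IH\<close> gives freeness on one side; they
  miss a letter of \<open>\<rho> l\<close>, so \<open>free\<close> gives it on the other. A word
  below that top end lives in the first factor.\<close>

lemma peel_top:
  assumes "k \<le> l" and IH: "short_free k l" and v: "gpeq (\<rho> ` {k..<l + 1}) v []"
    and q: "confined p q v" "q < M + s * l"
  shows "gpeq (\<rho> ` {k..<l}) v []"
proof (rule amalgam_embedding)
  have "{k..<l + 1} = insert l {k..<l}" using \<open>k \<le> l\<close> by auto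
  with v show "gpeq (\<rho> ` {k..<l} \<union> {\<rho> l}) v []" by (elim gpeq_mono) auto
  let ?Z1 = "{x. \<forall>i. pos x = Some i \<longrightarrow> i < M + s * l}" and ?Z2 = "{x. \<forall>i. pos x = Some i \<longrightarrow> m + s * l \<le> i}"
  show "names r \<subseteq> ?Z1" if "r \<in> \<rho> ` {k..<l}" for r
  proof -
    from that obtain j where j: "r = \<rho> j" "j < l" by auto
    have "s * j < s * l" using j(2) s by simp
    then show ?thesis using j(1) range[of _ j] by fastforce
  qed
  show "names r \<subseteq> ?Z2" if "r \<in> {\<rho> l}" for r using that range[of _ l] by auto
  show "names v \<subseteq> ?Z1" using q unfolding confined_def by fastforce
  fix u assume u: "names u \<subseteq> ?Z1 \<inter> ?Z2"
  then have "confined (m + s * l) (M + s * l - 1) u" unfolding confined_def by fastforce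
  then have "gpeq (\<rho> ` {k..<l}) u [] \<Longrightarrow> gpeq {} u []" using IH unfolding short_free_def by fastforce
  moreover have "gpeq {\<rho> l} u [] \<Longrightarrow> gpeq {} u []" using hi[of l] u free[of _ l u] by blast
  ultimately show "gpeq (\<rho> ` {k..<l}) u [] \<longleftrightarrow> gpeq {\<rho> l} u []" using gpeq_mono by blast
qed

lemma peel_bottom:
  assumes "k < l" and IH: "short_free (k + 1) l" and v: "gpeq (\<rho> ` {k..<l}) v []"
    and p: "confined p q v" "m + s * k < p"
  shows "gpeq (\<rho> ` {k + 1..<l}) v []"
proof (rule amalgam_embedding)
  have "{k..<l} = insert k {k + 1..<l}" using \<open>k < l\<close> by auto
  with v show "gpeq (\<rho> ` {k + 1..<l} \<union> {\<rho> k}) v []" by (elim gpeq_mono) auto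
  let ?Z1 = "{x. \<forall>i. pos x = Some i \<longrightarrow> m + s * k < i}" and ?Z2 = "{x. \<forall>i. pos x = Some i \<longrightarrow> i \<le> M + s * k}"
  show "names r \<subseteq> ?Z1" if "r \<in> \<rho> ` {k + 1..<l}" for r
  proof -
    from that obtain j where j: "r = \<rho> j" "k < j" by auto
    have "s * k < s * j" using j(2) s by simp
    then show ?thesis using j(1) range[of _ j] by fastforce
  qed
  show "names r \<subseteq> ?Z2" if "r \<in> {\<rho> k}" for r using that range[of _ k] by auto
  show "names v \<subseteq> ?Z1" using p unfolding confined_def by fastforce
  fix u assume u: "names u \<subseteq> ?Z1 \<inter> ?Z2"
  then have "confined (m + s * k + 1) (M + s * k) u" unfolding confined_def by fastforce
  then have "gpeq (\<rho> ` {k + 1..<l}) u [] \<Longrightarrow> gpeq {} u []" using IH unfolding short_free_def by fastforce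
  moreover have "gpeq {\<rho> k} u [] \<Longrightarrow> gpeq {} u []" using lo[of k] u free[of _ k u] by blast
  ultimately show "gpeq (\<rho> ` {k + 1..<l}) u [] \<longleftrightarrow> gpeq {\<rho> k} u []" using gpeq_mono by blast
qed

text \<open>One of the two outermost relators can always be peeled off: a word narrower than a
  window whose range reaches the top end of the last relator lies above the bottom end of the
  first.\<close>

lemma short_free: "short_free k (k + int n)"
proof (induction n arbitrary: k)
  case 0
  then show ?case by (simp add: short_free_def)
next
  case (Suc n)
  show ?case unfolding short_free_def
  proof (intro allI impI)
    fix v p q
    assume v: "gpeq (\<rho> ` {k..<k + int (Suc n)}) v []" and pq: "confined p q v" "q - p < M - m"
    show "gpeq {} v []"
    proof (cases "q < M + s * (k + int n)")
      case True
      have "gpeq (\<rho> ` {k..<k + int n}) v []"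
        using v by (intro peel_top[OF _ Suc.IH _ pq(1) True]) (simp_all add: algebra_simps)
      then show ?thesis using Suc.IH[of k] pq unfolding short_free_def by blast
    next
      case False
      have e: "k + int (Suc n) = k + 1 + int n" by simp
      have "s * k \<le> s * (k + int n)" using s by simp
      then have p: "m + s * k < p" using False pq(2) by linarith
      have "gpeq (\<rho> ` {k + 1..<k + 1 + int n}) v []"
        using v unfolding e by (intro peel_bottom[OF _ Suc.IH _ pq(1) p]) simp_all
      then show ?thesis using Suc.IH[of "k + 1"] pq unfolding short_free_def by blast
    qed
  qed
qed

lemma short_free': "short_free k l"
proof (cases "k \<le> l")
  case True
  then show ?thesis using short_free[of k "nat (l - k)"] by simp
next
  case False
  then show ?thesis by (auto simp: short_free_def)
qed

lemma finite_range_relators: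
  assumes "gpeq (range \<rho>) v []" shows "\<exists>n. gpeq (\<rho> ` {- int n..<1 + int n}) v []"
proof -
  obtain R where R: "finite R" "R \<subseteq> range \<rho>" "gpeq R v []"
    using gpeq_finite_relators[OF assms] by blast
  obtain K where K: "finite K" "R = \<rho> ` K" using R(1,2) by (metis finite_subset_image)
  define n where "n = nat (Max (insert 0 (abs ` K)))"
  have "\<bar>k\<bar> \<le> int n" if "k \<in> K" for k
    unfolding n_def using that K(1) by (simp add: Max_ge_iff)
  then have "K \<subseteq> {- int n..<1 + int n}" by fastforce
  then show ?thesis using R(3) K(2) by (blast intro: gpeq_mono)
qed

lemma gpeq_range_short:
  assumes "gpeq (range \<rho>) v []" "confined p q v" "q - p < M - m"
  shows "gpeq {} v []"
  using finite_range_relators[OF assms(1)] assms(2,3) short_free' unfolding short_free_def by blast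

text \<open>The window of \<open>\<rho> 0\<close> lies below the top end of every later relator and
  above the bottom end of every earlier one, so all the others are peeled off in turn.\<close>

lemma gpeq_range_single:
  assumes v: "gpeq (range \<rho>) v []" and w: "confined m M v"
  shows "gpeq {\<rho> 0} v []"
proof -
  have top: "gpeq (\<rho> ` {k..<1}) v []" if "gpeq (\<rho> ` {k..<1 + int n}) v []" "k \<le> 0" for k n
    using that(1)
  proof (induction n)
    case (Suc n)
    have "M < M + s * (1 + int n)" using s by simp
    with Suc that(2) show ?case
      using peel_top[OF _ short_free' _ w, of k "1 + int n"] by (simp add: algebra_simps)
  qed simp
  have bot: "gpeq (\<rho> ` {0..<1}) v []" if "gpeq (\<rho> ` {- int n..<1}) v []" for n
    using that
  proof (induction n)
    case (Suc n)
    have "m + s * (- int (Suc n)) < m" using s by (simp add: algebra_simps add_pos_nonneg)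
    with Suc show ?case
      using peel_bottom[OF _ short_free' _ w, of "- int (Suc n)" 1] by simp
  qed simp
  from finite_range_relators[OF v] obtain n where "gpeq (\<rho> ` {- int n..<1 + int n}) v []" ..
  then have "gpeq (\<rho> ` {- int n..<1}) v []" by (rule top) simp
  then have "gpeq (\<rho> ` {0..<1}) v []" by (rule bot)
  moreover have "{0..<1} = {0::int}" by auto
  ultimately show ?thesis by simp
qed

end

section \<open>Magnus rewriting\<close>

text \<open>The letter \<open>x\<close> read at height \<open>h\<close> is recorded as \<open>(x, h)\<close>, and the height then changes by the
  weight of \<open>x\<close>; the letter \<open>t\<close> only changes the height. With weights \<open>1\<close> for \<open>t\<close> and \<open>0\<close> for all
  other letters, \<open>(x, h)\<close> stands for \<open>t\<^sup>h x t\<^sup>-\<^sup>h\<close>.\<close>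

fun height :: "('x \<Rightarrow> int) \<Rightarrow> 'x letter list \<Rightarrow> int" where
  "height wt [] = 0"
| "height wt (Pos x # u) = height wt u + wt x"
| "height wt (Neg x # u) = height wt u - wt x"

text \<open>An inverse letter is recorded at the height reached after reading it. Both directions of
  an edge then get mutually inverse labels, so cancelling pairs rewrite to cancelling pairs.\<close>

fun emit :: "('x \<Rightarrow> int) \<Rightarrow> int \<Rightarrow> 'x letter \<Rightarrow> ('x \<times> int) letter" where
  "emit wt h (Pos x) = Pos (x, h)"
| "emit wt h (Neg x) = Neg (x, h - wt x)"

fun rewr :: "('x \<Rightarrow> int) \<Rightarrow> 'x \<Rightarrow> int \<Rightarrow> 'x letter list \<Rightarrow> ('x \<times> int) letter list" where
  "rewr wt t h [] = []"
| "rewr wt t h (a # u) =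
     (if letter_name a = t then [] else [emit wt h a]) @ rewr wt t (h + height wt [a]) u"

lemma height_append [simp]: "height wt (u @ v) = height wt u + height wt v"
  by (induction wt u rule: height.induct) auto

lemma height_Cons: "height wt (a # u) = height wt [a] + height wt u"
  by (cases a) auto

lemma rewr_append [simp]: "rewr wt t h (u @ v) = rewr wt t h u @ rewr wt t (h + height wt u) v"
proof (induction u arbitrary: h)
  case (Cons a u)
  then show ?case by (simp add: height_Cons[of wt a u] add.assoc)
qed simp

lemma rewr_shift: "rewr wt t (h + k) u = map (map_letter (\<lambda>(x, i). (x, i + k))) (rewr wt t h u)"
proof (induction u arbitrary: h)
  case (Cons a u)
  have "map_letter (\<lambda>(x, i). (x, i + k)) (emit wt h a) = emit wt (h + k) a" by (cases a) auto
  then show ?case using Cons[of "h + height wt [a]"]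
    by (simp add: ac_simps del: height.simps)
qed simp

lemma letter_name_emit: "letter_name (emit wt h a) = (letter_name a, snd (letter_name (emit wt h a)))"
  by (cases a) auto

text \<open>As the relator has weight zero, reading it leaves the height unchanged, and an
  occurrence at height \<open>k\<close> is rewritten to its \<open>k\<close>-th translate.\<close>

lemma rewr_gpeq:
  assumes "gpeq {r} u v" "height wt r = 0"
  shows "height wt u = height wt v \<and> (\<forall>h. gpeq (range (\<lambda>k. rewr wt t k r)) (rewr wt t h u) (rewr wt t h v))"
  using assms(1)
proof induction
  case (pair a)
  have "emit wt (h + height wt [a]) (letter_inv a) = letter_inv (emit wt h a)" for h by (cases a) auto
  moreover have "height wt [a, letter_inv a] = 0" by (cases a) auto
  ultimately show ?case by (simp add: gpeq.pair)
next
  case (rel r')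
  then show ?case using assms(2) by (auto intro: gpeq.rel)
next
  case (trans u v z)
  then show ?case using gpeq.trans by metis
qed (auto intro: gpeq.sym gpeq.app)

lemma reduced_single_letter:
  assumes "reduced u" "names u \<subseteq> {t}"
  shows "\<bar>height wt u\<bar> = int (length u) * \<bar>wt t\<bar>" "\<And>a. a \<in> set u \<Longrightarrow> height wt u = int (length u) * height wt [a]"
proof -
  have *: "u = replicate (length u) (hd u)" using assms
  proof (induction u)
    case (Cons a u)
    show ?case
    proof (cases u)
      case (Cons b u')
      then have "b = a" using Cons.prems letter_eq_or_inv[of b a] by (auto simp: reduced_Cons)
      then show ?thesis using Cons.IH Cons.prems Cons by (auto simp: reduced_Cons)
    qed simp
  qed simp
  have r: "height wt (replicate n a) = int n * height wt [a]" for n a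
    by (induction n) (auto simp: height_Cons[of wt a "replicate _ _"] algebra_simps)
  have a: "a = hd u" if "a \<in> set u" for a using that * by (metis in_set_replicate)
  show "height wt u = int (length u) * height wt [a]" if "a \<in> set u" for a
    using r[of "length u" "hd u"] * a[OF that] by simp
  show "\<bar>height wt u\<bar> = int (length u) * \<bar>wt t\<bar>"
  proof (cases u)
    case (Cons b u')
    have "\<bar>height wt [b]\<bar> = \<bar>wt t\<bar>" using assms(2) Cons by (cases b) auto
    then show ?thesis using r[of "length u" b] * Cons by (simp add: abs_mult)
  qed simp
qed

lemma rewr_hd:
  assumes "rewr wt t h u \<noteq> []"
  obtains u1 a u2 where "u = u1 @ a # u2" "names u1 \<subseteq> {t}" "letter_name a \<noteq> t"
    "hd (rewr wt t h u) = emit wt (h + height wt u1) a"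
  using assms
proof (induction u arbitrary: h thesis)
  case (Cons a u)
  show ?case
  proof (cases "letter_name a = t")
    case True
    with Cons.prems(2) have ne: "rewr wt t (h + height wt [a]) u \<noteq> []" by simp
    show ?thesis
    proof (rule Cons.IH[OF _ ne])
      fix u1 b u2 assume *: "u = u1 @ b # u2" "names u1 \<subseteq> {t}" "letter_name b \<noteq> t"
        "hd (rewr wt t (h + height wt [a]) u) = emit wt (h + height wt [a] + height wt u1) b"
      then show ?thesis
        using True by (intro Cons.prems(1)[of "a # u1" b u2]) (auto simp: height_Cons[of wt a u1] add.assoc)
    qed
  next
    case False
    then show ?thesis by (intro Cons.prems(1)[of "[]" a u]) auto
  qed
qed simp

text \<open>If two consecutive recorded letters cancel, the power of \<open>t\<close> deleted
  between them has height zero. As \<open>wt t\<close> is nonzero and this power is reduced, it is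
  empty, and the letters already cancelled in \<open>u\<close>.\<close>

lemma reduced_rewr:
  assumes "wt t \<noteq> 0"
  shows "reduced u \<Longrightarrow> reduced (rewr wt t h u)"
proof (induction u arbitrary: h)
  case (Cons a u)
  let ?h = "h + height wt [a]"
  have red: "reduced (rewr wt t ?h u)" using Cons by (simp add: reduced_Cons)
  have "hd (rewr wt t ?h u) \<noteq> letter_inv (emit wt h a)" if ne: "rewr wt t ?h u \<noteq> []"
  proof
    assume eq: "hd (rewr wt t ?h u) = letter_inv (emit wt h a)"
    obtain u1 b u2 where u: "u = u1 @ b # u2" "names u1 \<subseteq> {t}"
      "hd (rewr wt t ?h u) = emit wt (?h + height wt u1) b"
      using rewr_hd[OF ne] .
    have "emit wt (?h + height wt u1) b = letter_inv (emit wt h a)" by (rule HOL.trans[OF u(3)[symmetric] eq])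
    then have b: "b = letter_inv a" "height wt u1 = 0" by (cases a; cases b; simp)+
    have "reduced u1" using Cons.prems u(1) by (simp add: reduced_Cons reduced_append)
    with u(2) b(2) assms have "u1 = []" using reduced_single_letter(1)[of u1 t wt] by simp
    with u(1) b(1) Cons.prems show False by (simp add: reduced_Cons)
  qed
  with red show ?case by (auto simp: reduced_Cons)
qed simp

lemma rewr_eq_Nil: "rewr wt t h u = [] \<longleftrightarrow> names u \<subseteq> {t}"
  by (induction u arbitrary: h) auto

lemma rewr_nonempty:
  assumes "wt t \<noteq> 0" "reduced u" "height wt u = 0" "u \<noteq> []"
  shows "rewr wt t h u \<noteq> []"
  using assms reduced_single_letter(1)[of u t wt] by (auto simp: rewr_eq_Nil)

lemma length_rewr: "t \<in> names u \<Longrightarrow> length (rewr wt t h u) < length u"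
proof -
  have le: "length (rewr wt t h u) \<le> length u" for h u
    by (induction u arbitrary: h) (auto simp: le_SucI)
  show "t \<in> names u \<Longrightarrow> length (rewr wt t h u) < length u"
  proof (induction u arbitrary: h)
    case (Cons a u)
    then show ?case using le[of "h + height wt [a]" u] by (cases "letter_name a = t") (auto simp: le_imp_less_Suc)
  qed simp
qed

lemma names_rewr: "(x, i) \<in> names (rewr wt t h u) \<Longrightarrow> x \<in> names u \<and> x \<noteq> t"
proof (induction u arbitrary: h)
  case (Cons a u)
  show ?case
  proof (cases "(x, i) \<in> names (rewr wt t (h + height wt [a]) u)")
    case True
    then show ?thesis using Cons.IH by auto
  next
    case False
    then have "letter_name a \<noteq> t" "(x, i) = letter_name (emit wt h a)"
      using Cons.prems by (auto split: if_splits)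
    then show ?thesis by (cases a) auto
  qed
qed simp

lemma names_rewr_zero:
  "(x, i) \<in> names (rewr wt t h u) \<Longrightarrow> (\<And>y. y \<in> names u \<Longrightarrow> wt y = 0) \<Longrightarrow> i = h"
proof (induction u arbitrary: h)
  case (Cons a u)
  have "height wt [a] = 0" "letter_name (emit wt h a) = (letter_name a, h)"
    using Cons.prems(2)[of "letter_name a"] by (cases a; simp)+
  then show ?case using Cons by (auto split: if_splits)
qed simp

lemma ex_names_rewr: "x \<in> names u \<Longrightarrow> x \<noteq> t \<Longrightarrow> \<exists>i. (x, i) \<in> names (rewr wt t h u)"
proof (induction u arbitrary: h)
  case (Cons a u)
  show ?case
  proof (cases "x \<in> names u")
    case True
    then show ?thesis using Cons.IH[OF _ Cons.prems(2), of "h + height wt [a]"] by auto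
  next
    case False
    then have "x = letter_name a" using Cons.prems(1) by auto
    then have "letter_name (emit wt h a) = (x, snd (letter_name (emit wt h a)))" "letter_name a \<noteq> t"
      using letter_name_emit[of wt h a] Cons.prems(2) by auto
    then show ?thesis by (intro exI[of _ "snd (letter_name (emit wt h a))"]) force
  qed
qed simp

text \<open>Translation by one moves all positions by \<open>s\<close>, so it is enough to measure
  the window \<open>I\<close> of the translate at height zero. Deleting \<open>t\<close> makes the
  relator shorter, and it stays cyclically reduced because \<open>r @ r\<close> is rewritten to a
  square; so \<open>IH\<close> applies.\<close>

lemma staggered_rewr:
  fixes r :: "'x letter list" and pos :: "'x \<times> int \<Rightarrow> int option"
  assumes IH: "\<And>(r' :: ('x \<times> int) letter list) b v. length r' < length r \<Longrightarrow> reduced (r' @ r') \<Longrightarrow>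
      b \<in> names r' \<Longrightarrow> b \<notin> names v \<Longrightarrow> gpeq {r'} v [] \<Longrightarrow> gpeq {} v []"
    and r: "reduced (r @ r)" "t \<in> names r" "wt t \<noteq> 0" "height wt r = 0"
    and pos: "\<And>x i k. pos (x, i + k) = map_option (\<lambda>j. j + s * k) (pos (x, i))" and s: "s > 0"
    and I: "I = {i. \<exists>x \<in> names (rewr wt t 0 r). pos x = Some i}" "I \<noteq> {}"
  shows "staggered (\<lambda>k. rewr wt t k r) pos (Min I) (Max I) s"
proof -
  have "I \<subseteq> the ` pos ` names (rewr wt t 0 r)"
    unfolding I(1) by (auto simp: image_iff) force
  then have fin: "finite I" by (rule finite_subset) simp
  have nm: "names (rewr wt t k r) = (\<lambda>(x, i). (x, i + k)) ` names (rewr wt t 0 r)" for k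
  proof -
    have "letter_name (map_letter f a) = f (letter_name a)" for f :: "'x \<times> int \<Rightarrow> 'x \<times> int" and a
      by (cases a) auto
    then show ?thesis using rewr_shift[of wt t 0 k r] by (simp add: image_image)
  qed
  have opt: "map_option (\<lambda>j. j + s * k) p = Some i \<longleftrightarrow> p = Some (i - s * k)" for p i k
    by (cases p) auto
  have shift: "(\<exists>x \<in> names (rewr wt t k r). pos x = Some i) \<longleftrightarrow> i - s * k \<in> I" for i k
  proof -
    have "(\<exists>x \<in> names (rewr wt t k r). pos x = Some i) \<longleftrightarrow>
        (\<exists>(x, j) \<in> names (rewr wt t 0 r). pos (x, j + k) = Some i)"
      unfolding nm[of k] by (auto simp: case_prod_beta)
    also have "\<dots> \<longleftrightarrow> (\<exists>x \<in> names (rewr wt t 0 r). pos x = Some (i - s * k))"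
      unfolding pos opt by (auto simp: case_prod_beta)
    finally show ?thesis by (simp add: I(1))
  qed
  show ?thesis
  proof
    show "s > 0" by fact
    fix x k i assume "x \<in> names (rewr wt t k r)" "pos x = Some i"
    then have "i - s * k \<in> I" using shift[of k i] by blast
    then have "Min I \<le> i - s * k" "i - s * k \<le> Max I" using fin by auto
    then show "Min I + s * k \<le> i \<and> i \<le> Max I + s * k" by simp
  next
    fix k
    show "\<exists>x \<in> names (rewr wt t k r). pos x = Some (Min I + s * k)"
      "\<exists>x \<in> names (rewr wt t k r). pos x = Some (Max I + s * k)"
      by (rule shift[THEN iffD2], simp add: fin I(2))+
  next
    fix b k v
    assume b: "b \<in> names (rewr wt t k r)" "b \<notin> names v" and v: "gpeq {rewr wt t k r} v []"
    have "reduced (rewr wt t k (r @ r))" using r by (intro reduced_rewr)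
    then have "reduced (rewr wt t k r @ rewr wt t k r)" using r(4) by simp
    then show "gpeq {} v []" using IH[OF length_rewr[OF r(2)]] b v by blast
  qed
qed

section \<open>Renaming and deleting letters\<close>

lemma reduced_map:
  assumes "inj_on f (names u)" "reduced u" shows "reduced (map (map_letter f) u)"
  using assms
proof (induction u)
  case (Cons a u)
  have "map_letter f b = letter_inv (map_letter f a) \<longleftrightarrow> b = letter_inv a" if "b \<in> set u" for b
  proof -
    have "f (letter_name b) = f (letter_name a) \<longleftrightarrow> letter_name b = letter_name a"
      using that by (intro inj_on_eq_iff[OF Cons.prems(1)]) auto
    then show ?thesis by (cases a; cases b) auto
  qed
  then show ?case using Cons by (cases u) (auto simp: reduced_Cons)
qed simp

lemma gpeq_free_map_inj:
  assumes "inj_on f (names v)" "gpeq {} (map (map_letter f) v) []" shows "gpeq {} v []"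
proof -
  have "map_letter (inv_into (names v) f) (map_letter f a) = a" if "a \<in> set v" for a
    using assms(1) that by (cases a) (force intro: inv_into_f_f)+
  then have "map (map_letter (inv_into (names v) f)) (map (map_letter f) v) = v"
    by (simp add: map_idI)
  then show ?thesis using gpeq_map[OF assms(2), of "inv_into (names v) f"] by simp
qed

lemma names_map: "names (map (map_letter f) u) = f ` names u"
proof -
  have "letter_name (map_letter f a) = f (letter_name a)" for a by (cases a) auto
  then show ?thesis by (simp add: image_image)
qed

text \<open>Deleting \<open>b\<close> kills every relator. This settles the Freiheitssatz for
  relators that are powers of \<open>b\<close>.\<close>

lemma gpeq_filter:
  assumes "gpeq R u v" "\<And>r. r \<in> R \<Longrightarrow> names r \<subseteq> {b}"
  shows "gpeq {} (filter (\<lambda>a. letter_name a \<noteq> b) u) (filter (\<lambda>a. letter_name a \<noteq> b) v)"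
  using assms(1)
proof induction
  case (rel r)
  then have "filter (\<lambda>a. letter_name a \<noteq> b) r = []" using assms(2) by (auto simp: filter_empty_conv)
  then show ?case by simp
qed (auto intro: gpeq.intros)

lemma height_two:
  assumes "x \<noteq> y"
  shows "height (\<lambda>z. if z = x then i else if z = y then j else 0) u =
    i * height (\<lambda>z. if z = x then 1 else 0) u + j * height (\<lambda>z. if z = y then 1 else 0) u"
  using assms
proof (induction u)
  case (Cons a u)
  then show ?case by (cases a) (auto simp: algebra_simps)
qed simp

text \<open>The letters before and after a maximal power of \<open>t\<close> are read at different heights.\<close>

lemma rewr_two_heights:
  assumes r: "reduced (r @ r)" "t \<in> names r" "y \<in> names r" "y \<noteq> t"
    and wt: "wt = (\<lambda>z. if z = t then 1 else 0)" "height wt r = 0"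
  obtains x1 x2 i j where "(x1, i) \<in> names (rewr wt t 0 r)" "(x2, j) \<in> names (rewr wt t 0 r)" "i < j"
proof -
  obtain z where z: "z \<in> set r" "letter_name z = y" using r(3) by auto
  then obtain r1 r2 where r12: "r = r1 @ z # r2" by (meson split_list)
  let ?sil = "\<lambda>a. letter_name a = t"
  \<comment> \<open>Read \<open>r\<close> cyclically from an occurrence \<open>z\<close> of
    \<open>y\<close>. Then \<open>b # B1\<close> is the first maximal power of \<open>t\<close>,
    \<open>a\<close> is the letter before it and \<open>c\<close> the letter after it, possibly
    \<open>z\<close> on the second turn; in \<open>r @ r\<close> this stretch does not wrap
    around.\<close>
  obtain b where "b \<in> set (r2 @ r1)" "?sil b" using r(2,4) z r12 by auto
  then obtain A b B where AB: "r2 @ r1 = A @ b # B" "?sil b" "\<forall>a \<in> set A. \<not> ?sil a"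
    using split_list_first_prop[of "r2 @ r1" ?sil] by blast
  obtain B1 c B2 where B: "B @ [z] = B1 @ c # B2" "\<not> ?sil c" "\<forall>a \<in> set B1. ?sil a"
    using split_list_first_prop[of "B @ [z]" "\<lambda>a. \<not> ?sil a"] z r(4) by auto
  obtain A' a where A: "z # A = A' @ [a]" by (metis append_butlast_last_id list.distinct(1))
  have a: "\<not> ?sil a" using A AB(3) z r(4) by (metis in_set_conv_decomp set_ConsD)
  have "r @ r = r1 @ (z # A) @ b # (B @ [z]) @ r2" using r12 AB(1) by (metis append.assoc append_Cons append_Nil)
  then have rr: "r @ r = (r1 @ A') @ [a] @ (b # B1) @ [c] @ (B2 @ r2)" using A B by simp
  define h k where "h = height wt (r1 @ A')" and "k = height wt (b # B1)"
  have "reduced (b # B1)" using r(1) unfolding rr by (auto simp: reduced_append reduced_Cons)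
  moreover have "names (b # B1) \<subseteq> {t}" using AB(2) B(3) by auto
  ultimately have "\<bar>k\<bar> = int (length (b # B1))"
    using reduced_single_letter(1)[of "b # B1" t wt] wt(1) unfolding k_def by simp
  then have k: "k \<noteq> 0" by auto
  have em: "letter_name (emit wt i d) = (letter_name d, i)" "height wt [d] = 0" if "\<not> ?sil d" for d i
    using that by (cases d; simp add: wt(1))+
  have eq: "names (rewr wt t 0 r) = names (rewr wt t 0 (r @ r))" using wt(2) by (simp add: image_Un)
  have gen: "names (rewr wt t 0 (P @ [a] @ Q @ [c] @ S)) \<supseteq>
      {(letter_name a, height wt P), (letter_name c, height wt P + height wt Q)}" for P Q S
    using a B(2) em by (simp add: image_Un)
  have sub: "names (rewr wt t 0 (r @ r)) \<supseteq> {(letter_name a, h), (letter_name c, h + k)}"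
    unfolding rr h_def k_def by (rule gen)
  have *: "(letter_name a, h) \<in> names (rewr wt t 0 r)" "(letter_name c, h + k) \<in> names (rewr wt t 0 r)"
    unfolding eq using sub by (simp_all only: insert_subset)
  show ?thesis using k * that[of "letter_name a" h "letter_name c" "h + k"]
      that[of "letter_name c" "h + k" "letter_name a" h] by (cases "k > 0") auto
qed

section \<open>The theorems of Magnus and Weinbaum\<close>

text \<open>The finitely many letters of \<open>r\<close> and \<open>v\<close> embed into the
  natural numbers. The hypothesis is restricted to one length, so that the lemma can serve inside
  the induction, where rewritten words have letters in \<open>nat \<times> int\<close>, as well as
  at its end.\<close>

lemma freiheitssatz_transfer:
  fixes r v :: "'y letter list"
  assumes nat: "\<And>(r' :: nat letter list) b v. length r' = length r \<Longrightarrow> reduced (r' @ r') \<Longrightarrow>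
      b \<in> names r' \<Longrightarrow> b \<notin> names v \<Longrightarrow> gpeq {r'} v [] \<Longrightarrow> gpeq {} v []"
    and r: "reduced (r @ r)" "b \<in> names r" "b \<notin> names v" "gpeq {r} v []"
  shows "gpeq {} v []"
proof -
  define f where "f = to_nat_on (names r \<union> names v)"
  have inj: "inj_on f (names r \<union> names v)"
    unfolding f_def by (intro inj_on_to_nat_on countable_finite) simp
  have "reduced (map (map_letter f) (r @ r))"
    using r(1) inj by (intro reduced_map) (auto intro: inj_on_subset simp: image_Un)
  then have "reduced (map (map_letter f) r @ map (map_letter f) r)" by simp
  moreover have "f b \<in> names (map (map_letter f) r)" unfolding names_map using r(2) by (rule imageI)
  moreover have "f b \<notin> names (map (map_letter f) v)"
    unfolding names_map using r(2,3) by (subst inj_on_image_mem_iff[OF inj]) auto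
  moreover have "gpeq {map (map_letter f) r} (map (map_letter f) v) []"
    using gpeq_map[OF r(4), of f] by simp
  ultimately have "gpeq {} (map (map_letter f) v) []"
    by (rule nat[rotated]) simp
  moreover have "inj_on f (names v)" using inj by (rule inj_on_subset) auto
  ultimately show ?thesis by (rule gpeq_free_map_inj[rotated])
qed

text \<open>The missing letter \<open>b\<close> decides the rewriting. If its exponent sum in
  \<open>r\<close> is nonzero, another letter \<open>y\<close> is deleted and only copies of
  \<open>b\<close>, which \<open>v\<close> lacks, get positions. If it is zero, \<open>b\<close> is
  deleted; then \<open>v\<close> stays at height zero whereas \<open>r\<close> spreads over two
  heights.\<close>

lemma freiheitssatz_nat:
  fixes r :: "nat letter list"
  assumes "reduced (r @ r)" "b \<in> names r" "b \<notin> names v" "gpeq {r} v []"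
  shows "gpeq {} v []"
  using assms
proof (induction "length r" arbitrary: r b v rule: less_induct)
  case less
  note r = less.prems
  have IH: "gpeq {} v []"
    if "length r' < length r" "reduced (r' @ r')" "b \<in> names r'" "b \<notin> names v" "gpeq {r'} v []"
    for r' :: "(nat \<times> int) letter list" and b v
  proof (rule freiheitssatz_transfer[OF _ that(2-5)])
    fix r'' v and b :: nat
    assume "length r'' = length r'" "reduced (r'' @ r'')" "b \<in> names r''" "b \<notin> names v" "gpeq {r''} v []"
    then show "gpeq {} v []" using \<open>length r' < length r\<close> by (intro less.hyps) simp_all
  qed
  obtain v' where v': "reduced v'" "gpeq {} v v'" "names v' \<subseteq> names v" using ex_reduced[of v] by blast
  have v'r: "gpeq {r} v' []" by (rule gpeq.trans[OF gpeq.sym[OF gpeq_mono[OF v'(2)]] r(4)]) simp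
  have b: "b \<notin> names v'" using v'(3) r(3) by blast
  have "gpeq {} v' []"
  proof (cases "names r \<subseteq> {b}")
    case True
    have "filter (\<lambda>a. letter_name a \<noteq> b) v' = v'" using b by (intro filter_True) blast
    then show ?thesis using gpeq_filter[OF v'r, of b] True by simp
  next
    case False
    then obtain y where y: "y \<in> names r" "y \<noteq> b" by blast
    have trivial: "gpeq {} v' []"
      if "gpeq {} (rewr wt t 0 v') []" "wt t \<noteq> 0" "height wt r = 0" for wt t
    proof -
      have "rewr wt t 0 v' = []"
        by (rule reduced_gpeq_Nil[OF reduced_rewr[of wt t v' 0, OF that(2) v'(1)] that(1)])
      moreover have "height wt v' = 0" using rewr_gpeq[OF v'r that(3)] by simp
      ultimately have "v' = []" using rewr_nonempty[of wt t v'] that(2) v'(1) by blast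
      then show ?thesis by simp
    qed
    let ?count = "\<lambda>x. height (\<lambda>z. if z = x then 1 else 0) r"
    show ?thesis
    proof (cases "?count b = 0")
      case False
      \<comment> \<open>Crossed exponent sums give the relator total weight zero, and
        \<open>y\<close>, the letter to be deleted, gets the nonzero weight
        \<open>?count b\<close>.\<close>
      define wt where "wt = (\<lambda>z. if z = y then ?count b else if z = b then - ?count y else 0)"
      define pos where "pos = (\<lambda>(z, i). if z = b then Some i else (None :: int option))"
      define I where "I = {i. \<exists>x \<in> names (rewr wt y 0 r). pos x = Some i}"
      have wt: "wt y \<noteq> 0" "height wt r = 0" using False y(2) by (simp_all add: wt_def height_two)
      obtain i where "(b, i) \<in> names (rewr wt y 0 r)" using ex_names_rewr[OF r(2), of y] y(2) by blast
      then have "i \<in> I" unfolding I_def by (intro CollectI bexI[of _ "(b, i)"]) (simp_all add: pos_def)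
      then interpret staggered "\<lambda>k. rewr wt y k r" pos "Min I" "Max I" 1
        by (intro staggered_rewr[OF IH r(1) y(1) wt _ _ I_def]) (auto simp: pos_def)
      have "confined p q (rewr wt y 0 v')" for p q
        unfolding confined_def
      proof (intro ballI allI impI)
        fix x i assume x: "x \<in> names (rewr wt y 0 v')" "pos x = Some i"
        obtain z k where zk: "x = (z, k)" by (cases x)
        have "z \<noteq> b" using names_rewr[of z k wt y 0 v'] x(1) b unfolding zk by blast
        then show "p \<le> i \<and> i \<le> q" using x(2) by (simp add: zk pos_def)
      qed
      \<comment> \<open>No letter of the rewritten word has a position, so any bounds confine it.
        The bounds \<open>1\<close> and \<open>Max I - Min I\<close> qualify even when the window
        consists of one position.\<close>
      then have "gpeq {} (rewr wt y 0 v') []"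
        using rewr_gpeq[OF v'r wt(2)] gpeq_range_short[of "rewr wt y 0 v'" 1 "Max I - Min I"] by simp
      then show ?thesis using wt by (rule trivial)
    next
      case True
      define wt :: "nat \<Rightarrow> int" where "wt = (\<lambda>z. if z = b then 1 else 0)"
      have wt: "wt b \<noteq> 0" "height wt r = 0" using True by (simp_all add: wt_def)
      obtain x1 x2 i j where ij: "(x1, i) \<in> names (rewr wt b 0 r)" "(x2, j) \<in> names (rewr wt b 0 r)" "i < j"
        using rewr_two_heights[OF r(1,2) y wt_def wt(2)] .
      \<comment> \<open>The copies of \<open>x1\<close> and \<open>x2\<close> are interleaved as
        even and odd positions, so that a translate moves them by 2. At height zero at most the
        positions 0 and 1 arise, while \<open>i < j\<close> makes the window of the relator wider
        than that.\<close>
      define pos where "pos = (\<lambda>(z, i). if z = x1 then Some (2 * i) else if z = x2 then Some (2 * i + 1)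
        else (None :: int option))"
      define I where "I = {i. \<exists>x \<in> names (rewr wt b 0 r). pos x = Some i}"
      define j' where "j' = (if x1 = x2 then 2 * j else 2 * j + 1)"
      have "2 * i \<in> I" unfolding I_def using ij(1)
        by (intro CollectI bexI[of _ "(x1, i)"]) (simp_all add: pos_def)
      moreover have "j' \<in> I" unfolding I_def using ij(2)
        by (intro CollectI bexI[of _ "(x2, j)"]) (simp_all add: pos_def j'_def)
      ultimately have I: "2 * i \<in> I" "j' \<in> I" by blast+
      then interpret staggered "\<lambda>k. rewr wt b k r" pos "Min I" "Max I" 2
        by (intro staggered_rewr[OF IH r(1,2) wt _ _ I_def]) (auto simp: pos_def)
      have "I \<subseteq> the ` pos ` names (rewr wt b 0 r)" unfolding I_def by (auto simp: image_iff) force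
      then have "finite I" by (rule finite_subset) simp
      then have "Min I \<le> 2 * i" "j' \<le> Max I" using I by simp_all
      then have M: "1 - 0 < Max I - Min I" using ij(3) unfolding j'_def by (auto split: if_splits)
      have "confined 0 1 (rewr wt b 0 v')" unfolding confined_def
      proof (intro ballI allI impI)
        fix x i assume x: "x \<in> names (rewr wt b 0 v')" "pos x = Some i"
        obtain z k where zk: "x = (z, k)" by (cases x)
        have "wt y = 0" if "y \<in> names v'" for y using that b by (auto simp: wt_def)
        then have "k = 0" using names_rewr_zero[of z k wt b 0 v'] x(1) unfolding zk by blast
        then show "0 \<le> i \<and> i \<le> 1" using x(2) by (auto simp: zk pos_def split: if_splits)
      qed
      then have "gpeq {} (rewr wt b 0 v') []"
        using rewr_gpeq[OF v'r wt(2)] gpeq_range_short[of "rewr wt b 0 v'" 0 1] M by simp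
      then show ?thesis using wt by (rule trivial)
    qed
  qed
  then show ?case using v'(2) gpeq.trans by blast
qed

theorem freiheitssatz:
  assumes "reduced (r @ r)" "b \<in> names r" "b \<notin> names v" "gpeq {r} v []"
  shows "gpeq {} v []"
  using freiheitssatz_nat assms by (rule freiheitssatz_transfer)

text \<open>If a proper part \<open>v\<close> of the relator were trivial, \<open>v\<close> and
  \<open>u\<close> would have weight zero, so the rewritten relator splits into the rewritten words
  of \<open>v\<close> and \<open>u\<close>, neither of which is empty. The window argument makes the
  first one a consequence of this shorter relator alone, against the induction hypothesis.\<close>

lemma weinbaum_nat:
  fixes r :: "nat letter list"
  assumes "reduced (r @ r)" "r = v @ u" "v \<noteq> []" "u \<noteq> []"
  shows "\<not> gpeq {r} v []"
  using assms
proof (induction "length r" arbitrary: r v u rule: less_induct)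
  case less
  note r = less.prems(1) and vu = less.prems(2-4)
  have red: "reduced v" "reduced u" using r vu(1) by (simp_all add: reduced_append)
  show ?case
  proof
    assume v: "gpeq {r} v []"
    have step: False if wt: "t \<in> names r" "wt t \<noteq> 0" "height wt r = 0" and b: "b \<in> names r" "b \<noteq> t" for wt t b
    proof -
      define pos where "pos = (\<lambda>(z, i). if z = b then Some i else (None :: int option))"
      define I where "I = {i. \<exists>x \<in> names (rewr wt t 0 r). pos x = Some i}"
      obtain i where "(b, i) \<in> names (rewr wt t 0 r)" using ex_names_rewr[OF b] by blast
      then have "i \<in> I" unfolding I_def by (intro CollectI bexI[of _ "(b, i)"]) (simp_all add: pos_def)
      then interpret staggered "\<lambda>k. rewr wt t k r" pos "Min I" "Max I" 1
        by (intro staggered_rewr[OF freiheitssatz r wt _ _ I_def]) (auto simp: pos_def)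
      have v0: "height wt v = 0" and rv: "gpeq (range (\<lambda>k. rewr wt t k r)) (rewr wt t 0 v) []"
        using rewr_gpeq[OF v wt(3)] by simp_all
      have u0: "height wt u = 0" using wt(3) vu(1) v0 by simp
      have ruv: "rewr wt t 0 r = rewr wt t 0 v @ rewr wt t 0 u" using vu(1) v0 by simp
      have "confined (Min I) (Max I) (rewr wt t 0 v)"
        using range[of _ 0] unfolding confined_def ruv set_append image_Un by fastforce
      with rv have "gpeq {rewr wt t 0 r} (rewr wt t 0 v) []" by (rule gpeq_range_single)
      moreover have "reduced (rewr wt t 0 r @ rewr wt t 0 r)"
        using reduced_rewr[of wt t "r @ r" 0, OF wt(2) r] wt(3) by simp
      moreover have "rewr wt t 0 v \<noteq> []" "rewr wt t 0 u \<noteq> []"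
        using rewr_nonempty[of wt t v] rewr_nonempty[of wt t u] wt(2) red vu v0 u0 by blast+
      ultimately obtain f :: "nat \<times> int \<Rightarrow> nat" where f: "f = to_nat" by blast
      have "inj f" using f by simp
      let ?f = "map (map_letter f)"
      have "\<not> gpeq {?f (rewr wt t 0 r)} (?f (rewr wt t 0 v)) []"
      proof (rule less.hyps)
        show "length (?f (rewr wt t 0 r)) < length r" using length_rewr[OF wt(1)] by simp
        have "reduced (?f (rewr wt t 0 r @ rewr wt t 0 r))"
          using \<open>reduced (rewr wt t 0 r @ _)\<close> \<open>inj f\<close> by (intro reduced_map) (auto intro: inj_on_subset)
        then show "reduced (?f (rewr wt t 0 r) @ ?f (rewr wt t 0 r))" by simp
        show "?f (rewr wt t 0 r) = ?f (rewr wt t 0 v) @ ?f (rewr wt t 0 u)" by (simp add: ruv)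
      qed (use \<open>rewr wt t 0 v \<noteq> []\<close> \<open>rewr wt t 0 u \<noteq> []\<close> in simp_all)
      then show False using gpeq_map[OF \<open>gpeq {rewr wt t 0 r} _ _\<close>, of f] by simp
    qed
    let ?one = "\<lambda>x z. if z = x then 1 else (0 :: int)"
    obtain a v' where a: "v = a # v'" using vu(2) by (cases v) auto
    let ?b = "letter_name a"
    have b: "?b \<in> names r" using vu(1) a by simp
    show False
    proof (cases "names r \<subseteq> {?b}")
      case True
      \<comment> \<open>The relator is a power of one letter, and the exponent sum modulo its length
        is an invariant of the group; the proper part \<open>v\<close> is a shorter nonempty power
        of the same letter.\<close>
      have dvd: "height (?one ?b) r dvd height (?one ?b) v"
      proof -
        have "height (?one ?b) r dvd height (?one ?b) x - height (?one ?b) y" if "gpeq {r} x y" for x y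
          using that
        proof induction
          case (sym u v)
          then show ?case by (simp add: dvd_diff_commute)
        next
          case (trans u v z)
          show ?case using dvd_add[OF trans.IH] by simp
        next
          case (app u u' v v')
          show ?case using dvd_add[OF app.IH] by (simp add: algebra_simps)
        next
          case (pair a)
          then show ?case by (cases a) simp_all
        qed simp_all
        from this[OF v] show ?thesis by simp
      qed
      have "reduced r" using r by (simp add: reduced_append)
      then have r_len: "height (?one ?b) r = int (length r) * height (?one ?b) [a]"
        using True a vu(1) by (intro reduced_single_letter(2)) auto
      have v_len: "height (?one ?b) v = int (length v) * height (?one ?b) [a]"
        using True a vu(1) red(1) by (intro reduced_single_letter(2)) auto
      have "height (?one ?b) [a] = 1 \<or> height (?one ?b) [a] = - 1" by (cases a) simp_all
      then have "int (length r) dvd int (length v)" using dvd unfolding r_len v_len by auto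
      then have "length r dvd length v" by (simp only: int_dvd_int_iff)
      then show False using vu by (auto dest!: dvd_imp_le)
    next
      case False
      then obtain y where y: "y \<in> names r" "y \<noteq> ?b" by blast
      show False
      proof (cases "height (?one ?b) r = 0")
        case True
        then show ?thesis using step[of ?b "?one ?b" y] b y by simp
      next
        case False
        let ?wt = "\<lambda>z. if z = y then height (?one ?b) r else if z = ?b then - height (?one y) r else 0"
        have "height ?wt r = 0" using y(2) by (simp add: height_two)
        then show ?thesis using step[of y ?wt ?b] b y False by simp
      qed
    qed
  qed
qed

theorem weinbaum:
  assumes "reduced ((v @ u) @ v @ u)" "v \<noteq> []" "u \<noteq> []"
  shows "\<not> gpeq {v @ u} v []"
proof
  define f where "f = to_nat_on (names (v @ u))"
  have inj: "inj_on f (names (v @ u))"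
    unfolding f_def by (intro inj_on_to_nat_on countable_finite) simp
  let ?f = "map (map_letter f)"
  assume "gpeq {v @ u} v []"
  from gpeq_map[OF this, of f] have "gpeq {?f (v @ u)} (?f v) []" by simp
  moreover have "names ((v @ u) @ v @ u) = names (v @ u)" by auto
  then have "reduced (?f ((v @ u) @ v @ u))" using assms(1) inj by (intro reduced_map) (simp_all only:)
  ultimately show False using weinbaum_nat[of "?f (v @ u)" "?f v" "?f u"] assms(2,3) by simp
qed

section \<open>Inverse monoids\<close>

locale inverse_mon = monoid S for S (structure) +
  assumes ex1_inverse: "x \<in> carrier S \<Longrightarrow> \<exists>!y. y \<in> carrier S \<and> x \<otimes> y \<otimes> x = x \<and> y \<otimes> x \<otimes> y = y"
begin

abbreviation star :: "'a \<Rightarrow> 'a" where "star x \<equiv> inverse_elt S x"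

abbreviation le :: "'a \<Rightarrow> 'a \<Rightarrow> bool" where "le x y \<equiv> natural_le S x y"

lemma star: assumes "x \<in> carrier S"
  shows star_closed [simp]: "star x \<in> carrier S"
    and mult_star_mult: "x \<otimes> star x \<otimes> x = x" "star x \<otimes> x \<otimes> star x = star x"
  using theI'[OF ex1_inverse[OF assms]] unfolding inverse_elt_def by auto

lemma mult_star_assoc [simp]:
  assumes [simp]: "x \<in> carrier S"
  shows "x \<otimes> (star x \<otimes> x) = x" "star x \<otimes> (x \<otimes> star x) = star x"
    "y \<in> carrier S \<Longrightarrow> x \<otimes> (star x \<otimes> (x \<otimes> y)) = x \<otimes> y"
    "y \<in> carrier S \<Longrightarrow> star x \<otimes> (x \<otimes> (star x \<otimes> y)) = star x \<otimes> y"
  using mult_star_mult[OF assms] by (simp_all add: m_assoc[symmetric])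

lemma star_unique:
  assumes "x \<in> carrier S" "y \<in> carrier S" "x \<otimes> y \<otimes> x = x" "y \<otimes> x \<otimes> y = y"
  shows "star x = y"
  using ex1_inverse[OF assms(1)] star[OF assms(1)] mult_star_mult[OF assms(1)] assms(2-4) by blast

lemma star_star [simp]: "x \<in> carrier S \<Longrightarrow> star (star x) = x"
  by (rule star_unique) (simp_all add: m_assoc)

lemma star_idem: "f \<in> carrier S \<Longrightarrow> f \<otimes> f = f \<Longrightarrow> star f = f"
  by (rule star_unique) simp_all

lemma idem_mult_star [simp]:
  assumes [simp]: "x \<in> carrier S" shows "(x \<otimes> star x) \<otimes> (x \<otimes> star x) = x \<otimes> star x"
  by (simp add: m_assoc)

text \<open>If \<open>z\<close> is the inverse of \<open>f \<otimes> g\<close>, so is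
  \<open>g \<otimes> z \<otimes> f\<close>. By uniqueness both agree, which makes \<open>z\<close>
  idempotent, hence its own inverse and equal to \<open>f \<otimes> g\<close>.\<close>

lemma idem_mult:
  assumes [simp]: "f \<in> carrier S" "g \<in> carrier S" and f: "f \<otimes> f = f" and g: "g \<otimes> g = g"
  shows "(f \<otimes> g) \<otimes> (f \<otimes> g) = f \<otimes> g"
proof -
  define z where "z = star (f \<otimes> g)"
  have [simp]: "z \<in> carrier S" by (simp add: z_def)
  have f': "f \<otimes> (f \<otimes> y) = f \<otimes> y" and g': "g \<otimes> (g \<otimes> y) = g \<otimes> y" if "y \<in> carrier S" for y
    using that f g by (simp_all add: m_assoc[symmetric])
  have z1: "f \<otimes> (g \<otimes> (z \<otimes> (f \<otimes> g))) = f \<otimes> g" and z2: "z \<otimes> (f \<otimes> (g \<otimes> z)) = z"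
    using mult_star_mult[of "f \<otimes> g"] by (simp_all add: z_def m_assoc)
  have z2': "z \<otimes> (f \<otimes> (g \<otimes> (z \<otimes> y))) = z \<otimes> y" if "y \<in> carrier S" for y
  proof -
    have "(z \<otimes> (f \<otimes> (g \<otimes> z))) \<otimes> y = z \<otimes> y" by (simp only: z2)
    then show ?thesis using that by (simp add: m_assoc)
  qed
  have "star (f \<otimes> g) = g \<otimes> (z \<otimes> f)"
    by (rule star_unique) (simp_all add: m_assoc f' g' z1 z2')
  then have z: "z = g \<otimes> (z \<otimes> f)" by (simp add: z_def)
  have "z \<otimes> z = (g \<otimes> (z \<otimes> f)) \<otimes> (g \<otimes> (z \<otimes> f))" using z by simp
  also have "\<dots> = g \<otimes> (z \<otimes> f)" by (simp add: m_assoc z2')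
  finally have "z \<otimes> z = z" using z by simp
  then have "star z = z" by (intro star_idem) simp_all
  then have "z = f \<otimes> g" by (simp add: z_def)
  then show ?thesis using \<open>z \<otimes> z = z\<close> by simp
qed

lemma idem_commute:
  assumes [simp]: "f \<in> carrier S" "g \<in> carrier S" and f: "f \<otimes> f = f" and g: "g \<otimes> g = g"
  shows "f \<otimes> g = g \<otimes> f"
proof -
  have f': "f \<otimes> (f \<otimes> y) = f \<otimes> y" and g': "g \<otimes> (g \<otimes> y) = g \<otimes> y" if "y \<in> carrier S" for y
    using that f g by (simp_all add: m_assoc[symmetric])
  have "star (f \<otimes> g) = g \<otimes> f"
    using idem_mult[OF assms(1,2) f g] idem_mult[OF assms(2,1) g f]
    by (intro star_unique) (simp_all add: m_assoc f' g')
  moreover have "star (f \<otimes> g) = f \<otimes> g"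
    using idem_mult[OF assms(1,2) f g] by (intro star_idem) simp_all
  ultimately show ?thesis by simp
qed

lemma star_commute:
  assumes [simp]: "x \<in> carrier S" "y \<in> carrier S"
  shows "x \<otimes> star x \<otimes> (y \<otimes> star y) = y \<otimes> star y \<otimes> (x \<otimes> star x)"
  by (rule idem_commute) simp_all

lemma star_mult:
  assumes [simp]: "x \<in> carrier S" "y \<in> carrier S" shows "star (x \<otimes> y) = star y \<otimes> star x"
proof (rule star_unique)
  have c: "y \<otimes> star y \<otimes> (star x \<otimes> x) = star x \<otimes> x \<otimes> (y \<otimes> star y)"
    using star_commute[of y "star x"] by simp
  have "x \<otimes> y \<otimes> (star y \<otimes> star x) \<otimes> (x \<otimes> y) = x \<otimes> (y \<otimes> star y \<otimes> (star x \<otimes> x)) \<otimes> y"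
    by (simp add: m_assoc)
  also have "\<dots> = x \<otimes> y" unfolding c by (simp add: m_assoc)
  finally show "x \<otimes> y \<otimes> (star y \<otimes> star x) \<otimes> (x \<otimes> y) = x \<otimes> y" .
  have "star y \<otimes> star x \<otimes> (x \<otimes> y) \<otimes> (star y \<otimes> star x) = star y \<otimes> (star x \<otimes> x \<otimes> (y \<otimes> star y)) \<otimes> star x"
    by (simp add: m_assoc)
  also have "\<dots> = star y \<otimes> star x" unfolding c[symmetric] by (simp add: m_assoc)
  finally show "star y \<otimes> star x \<otimes> (x \<otimes> y) \<otimes> (star y \<otimes> star x) = star y \<otimes> star x" .
qed simp_all

lemma le_iff: assumes [simp]: "x \<in> carrier S" "y \<in> carrier S"
  shows "le x y \<longleftrightarrow> (\<exists>f \<in> carrier S. f \<otimes> f = f \<and> x = f \<otimes> y)"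
proof
  assume "le x y"
  then show "\<exists>f \<in> carrier S. f \<otimes> f = f \<and> x = f \<otimes> y"
    unfolding natural_le_def by (intro bexI[of _ "x \<otimes> star x"]) simp_all
next
  assume "\<exists>f \<in> carrier S. f \<otimes> f = f \<and> x = f \<otimes> y"
  then obtain f where [simp]: "f \<in> carrier S" and f: "f \<otimes> f = f" and x: "x = f \<otimes> y" by blast
  have c: "f \<otimes> (y \<otimes> star y) = y \<otimes> star y \<otimes> f" by (rule idem_commute) (simp_all add: f)
  have "x \<otimes> star x \<otimes> y = f \<otimes> (y \<otimes> star y \<otimes> f) \<otimes> y"
    using f by (simp add: x star_mult star_idem m_assoc)
  also have "\<dots> = f \<otimes> f \<otimes> y" unfolding c[symmetric] by (simp add: m_assoc)
  finally show "le x y" by (simp add: natural_le_def f x)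
qed

lemma le_idem_mult: "f \<in> carrier S \<Longrightarrow> f \<otimes> f = f \<Longrightarrow> y \<in> carrier S \<Longrightarrow> le (f \<otimes> y) y"
  by (subst le_iff) auto

lemma idem_conj:
  assumes [simp]: "f \<in> carrier S" "z \<in> carrier S" and f: "f \<otimes> f = f"
  shows "z \<otimes> f = (z \<otimes> f \<otimes> star z) \<otimes> z" "(z \<otimes> f \<otimes> star z) \<otimes> (z \<otimes> f \<otimes> star z) = z \<otimes> f \<otimes> star z"
proof -
  have c: "f \<otimes> (star z \<otimes> z) = star z \<otimes> z \<otimes> f"
    using f by (intro idem_commute) (simp_all add: m_assoc)
  have "z \<otimes> f = z \<otimes> (star z \<otimes> z \<otimes> f)" by (simp add: m_assoc)
  then show "z \<otimes> f = (z \<otimes> f \<otimes> star z) \<otimes> z" unfolding c[symmetric] by (simp add: m_assoc)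
  have "(z \<otimes> f \<otimes> star z) \<otimes> (z \<otimes> f \<otimes> star z) = z \<otimes> (f \<otimes> (star z \<otimes> z)) \<otimes> f \<otimes> star z"
    by (simp add: m_assoc)
  also have "\<dots> = z \<otimes> (f \<otimes> f) \<otimes> star z" unfolding c by (simp add: m_assoc del: f)
  finally show "(z \<otimes> f \<otimes> star z) \<otimes> (z \<otimes> f \<otimes> star z) = z \<otimes> f \<otimes> star z" by (simp add: f)
qed

lemma le_mult_idem: "f \<in> carrier S \<Longrightarrow> f \<otimes> f = f \<Longrightarrow> y \<in> carrier S \<Longrightarrow> le (y \<otimes> f) y"
  using idem_conj[of f y] by (subst le_iff) auto

lemma le_refl: "x \<in> carrier S \<Longrightarrow> le x x"
  by (simp add: natural_le_def m_assoc)

lemma le_trans: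
  assumes [simp]: "x \<in> carrier S" "y \<in> carrier S" "z \<in> carrier S" and "le x y" "le y z"
  shows "le x z"
proof -
  obtain f g where [simp]: "f \<in> carrier S" "g \<in> carrier S" and "f \<otimes> f = f" "g \<otimes> g = g"
    "x = f \<otimes> y" "y = g \<otimes> z"
    using assms(4,5) by (auto simp: le_iff)
  then show ?thesis using idem_mult[of f g]
    by (subst le_iff) (auto intro!: bexI[of _ "f \<otimes> g"] simp: m_assoc)
qed

lemma le_antisym:
  assumes [simp]: "x \<in> carrier S" "y \<in> carrier S" and "le x y" "le y x" shows "x = y"
proof -
  obtain f g where [simp]: "f \<in> carrier S" "g \<in> carrier S" and f: "f \<otimes> f = f" and g: "g \<otimes> g = g"
    and x: "x = f \<otimes> y" and y: "y = g \<otimes> x"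
    using assms(3,4) unfolding le_iff[OF assms(1,2)] le_iff[OF assms(2,1)] by blast
  have "f \<otimes> x = f \<otimes> f \<otimes> y" using x by (simp add: m_assoc)
  then have fx: "f \<otimes> x = x" using f x by simp
  have "x = f \<otimes> g \<otimes> x" using x y by (simp add: m_assoc)
  also have "\<dots> = g \<otimes> f \<otimes> x" using idem_commute[of f g] f g by simp
  also have "\<dots> = y" using fx y by (simp add: m_assoc)
  finally show ?thesis .
qed

lemma le_mult_right: 
  assumes [simp]: "x \<in> carrier S" "y \<in> carrier S" "z \<in> carrier S" and "le x y"
  shows "le (x \<otimes> z) (y \<otimes> z)"
proof -
  obtain f where [simp]: "f \<in> carrier S" and "f \<otimes> f = f" "x = f \<otimes> y"
    using assms(4) by (auto simp: le_iff)
  then show ?thesis by (simp add: m_assoc le_idem_mult)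
qed

lemma star_Units: "u \<in> Units S \<Longrightarrow> star u = inv u"
  by (rule star_unique) (simp_all add: Units_closed m_assoc)

end

lemma inverse_mon_iff: "inverse_mon S \<longleftrightarrow> inverse_monoid S"
  unfolding inverse_mon_def inverse_mon_axioms_def inverse_monoid_def by blast

text \<open>Uniqueness of inverses comes from commuting idempotents, while \<open>comm\<close>
  speaks only of the elements \<open>x \<otimes> i x\<close>. The gap closes because every
  idempotent \<open>f\<close> satisfies \<open>f = i f\<close>, hence is of this form.\<close>

lemma inverse_monoidI:
  fixes S (structure)
  assumes "monoid S"
    and cl: "\<And>x. x \<in> carrier S \<Longrightarrow> i x \<in> carrier S"
    and i1: "\<And>x. x \<in> carrier S \<Longrightarrow> x \<otimes> i x \<otimes> x = x"
    and ii: "\<And>x. x \<in> carrier S \<Longrightarrow> i (i x) = x"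
    and comm: "\<And>x y. x \<in> carrier S \<Longrightarrow> y \<in> carrier S \<Longrightarrow> (x \<otimes> i x) \<otimes> (y \<otimes> i y) = (y \<otimes> i y) \<otimes> (x \<otimes> i x)"
  shows "inverse_mon S" and "x \<in> carrier S \<Longrightarrow> inverse_elt S x = i x"
proof -
  interpret monoid S by fact
  have i2: "i x \<otimes> x \<otimes> i x = i x" if "x \<in> carrier S" for x
    using i1[OF cl[OF that]] ii[OF that] by simp
  have idem: "f = f \<otimes> i f" if [simp]: "f \<in> carrier S" and f: "f \<otimes> f = f" for f
  proof -
    note [simp] = cl
    have c: "(i f \<otimes> f) \<otimes> (f \<otimes> i f) = (f \<otimes> i f) \<otimes> (i f \<otimes> f)"
      using comm[of "i f" f] by (simp add: ii)
    have "i f = i f \<otimes> (f \<otimes> f) \<otimes> i f" using i2[of f] f by simp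
    also have "\<dots> = (f \<otimes> i f) \<otimes> (i f \<otimes> f)" using c by (simp add: m_assoc)
    finally have *: "i f = f \<otimes> i f \<otimes> i f \<otimes> f" by (simp add: m_assoc)
    have "f = f \<otimes> i f \<otimes> f" using i1[of f] by simp
    also have "\<dots> = f \<otimes> (f \<otimes> i f \<otimes> i f \<otimes> f) \<otimes> f" using * by simp
    also have "\<dots> = (f \<otimes> f) \<otimes> i f \<otimes> i f \<otimes> (f \<otimes> f)" by (simp add: m_assoc)
    also have "\<dots> = i f" using f * by simp
    finally have "f = i f" .
    then show ?thesis using f by metis
  qed
  have idem_comm: "f \<otimes> g = g \<otimes> f" if "f \<in> carrier S" "g \<in> carrier S" "f \<otimes> f = f" "g \<otimes> g = g" for f g
    using comm[of f g] idem[of f] idem[of g] that by metis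
  have uniq: "y = z" if [simp]: "x \<in> carrier S" "y \<in> carrier S" "z \<in> carrier S"
    and y: "x \<otimes> y \<otimes> x = x" "y \<otimes> x \<otimes> y = y" and z: "x \<otimes> z \<otimes> x = x" "z \<otimes> x \<otimes> z = z" for x y z
  proof -
    have c1: "(x \<otimes> z) \<otimes> (x \<otimes> y) = (x \<otimes> y) \<otimes> (x \<otimes> z)"
      using y z by (intro idem_comm) (simp_all add: m_assoc[symmetric])
    have c2: "(z \<otimes> x) \<otimes> (y \<otimes> x) = (y \<otimes> x) \<otimes> (z \<otimes> x)"
      using y z by (intro idem_comm) (simp_all add: m_assoc[symmetric])
    have "y = y \<otimes> (x \<otimes> z \<otimes> x) \<otimes> y" using y z by simp
    also have "\<dots> = y \<otimes> ((x \<otimes> z) \<otimes> (x \<otimes> y))" by (simp add: m_assoc)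
    also have "\<dots> = (y \<otimes> x \<otimes> y) \<otimes> x \<otimes> z" unfolding c1 by (simp add: m_assoc)
    finally have yx: "y = y \<otimes> x \<otimes> z" using y by simp
    have "z = z \<otimes> (x \<otimes> y \<otimes> x) \<otimes> z" using y z by simp
    also have "\<dots> = ((z \<otimes> x) \<otimes> (y \<otimes> x)) \<otimes> z" by (simp add: m_assoc)
    also have "\<dots> = y \<otimes> x \<otimes> (z \<otimes> x \<otimes> z)" unfolding c2 by (simp add: m_assoc)
    finally show ?thesis using yx z by simp
  qed
  show *: "inverse_mon S"
    unfolding inverse_mon_def inverse_mon_axioms_def
    using \<open>monoid S\<close> cl i1 i2 uniq by metis
  show "inverse_elt S x = i x" if "x \<in> carrier S"
    using inverse_mon.star_unique[OF *] that cl i1 i2 by blast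
qed

section \<open>Group congruences\<close>

lemma monoid_congruence_full:
  assumes "monoid S"
  shows "monoid_congruence S (carrier S \<times> carrier S)" "group (quotient_monoid S (carrier S \<times> carrier S))"
proof -
  interpret monoid S by fact
  show c: "monoid_congruence S (carrier S \<times> carrier S)"
    by (auto simp: monoid_congruence_def equiv_def refl_on_def sym_def trans_def)
  interpret Q: monoid "quotient_monoid S (carrier S \<times> carrier S)"
    by (rule monoid_quotient[OF \<open>monoid S\<close> c])
  have "carrier (quotient_monoid S (carrier S \<times> carrier S)) = {\<one>\<^bsub>quotient_monoid S (carrier S \<times> carrier S)\<^esub>}"
    by (auto simp: quotient_monoid_def quotient_def)
  then show "group (quotient_monoid S (carrier S \<times> carrier S))"
    by (intro Q.group_l_invI) (metis Q.l_one singletonD singletonI)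
qed

lemma monoid_congruence_min_group:
  assumes "monoid S" shows "monoid_congruence S (min_group_congruence S)"
proof -
  let ?F = "{r. monoid_congruence S r \<and> group (quotient_monoid S r)}"
  have full: "carrier S \<times> carrier S \<in> ?F" using monoid_congruence_full[OF assms] by blast
  have e: "equiv (carrier S) r" if "r \<in> ?F" for r using that by (simp add: monoid_congruence_def)
  have "equiv (carrier S) (\<Inter>?F)"
  proof (rule equivI)
    show "\<Inter>?F \<subseteq> carrier S \<times> carrier S" using full by blast
    show "refl_on (carrier S) (\<Inter>?F)"
      using e unfolding refl_on_def equiv_def by blast
    show "sym (\<Inter>?F)"
      by (rule symI) (use e in \<open>auto simp: equiv_def dest: symD\<close>)
    show "trans (\<Inter>?F)"
    proof (rule transI)
      fix x y z assume "(x, y) \<in> \<Inter>?F" "(y, z) \<in> \<Inter>?F"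
      moreover have "trans r" if "r \<in> ?F" for r using e[OF that] by (simp add: equiv_def)
      ultimately show "(x, z) \<in> \<Inter>?F" by (blast dest: transD)
    qed
  qed
  then show ?thesis unfolding min_group_congruence_def monoid_congruence_def by blast
qed

lemma group_congruence_idem:
  assumes "monoid S" "monoid_congruence S r" "group (quotient_monoid S r)"
    and f: "f \<in> carrier S" "f \<otimes>\<^bsub>S\<^esub> f = f"
  shows "(f, \<one>\<^bsub>S\<^esub>) \<in> r"
proof -
  interpret Q: group "quotient_monoid S r" by fact
  have "r `` {f} \<in> carrier (quotient_monoid S r)"
    using f by (simp add: quotient_monoid_def quotientI)
  moreover have "r `` {f} \<otimes>\<^bsub>quotient_monoid S r\<^esub> r `` {f} = r `` {f}"
    using quotient_mult[OF assms(2) f(1) f(1)] f(2) by simp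
  ultimately have "r `` {f} = \<one>\<^bsub>quotient_monoid S r\<^esub>" by (simp add: Q.l_cancel_one)
  then have "r `` {f} = r `` {\<one>\<^bsub>S\<^esub>}" by (simp add: quotient_monoid_def)
  then show ?thesis using assms(1,2) monoid.one_closed[of S]
    unfolding monoid_congruence_def by (metis eq_equiv_class)
qed

text \<open>An element below \<open>y\<close> is an idempotent times \<open>y\<close>, and group
  congruences send idempotents to 1. The hypotheses concern the single element \<open>x\<close>, so
  that the lemma also applies to the expansion, where inverses are computed directly.\<close>

lemma natural_le_min_group:
  assumes "monoid S" and x: "x \<in> carrier S" "y \<in> carrier S" "inverse_elt S x \<in> carrier S"
    and "x \<otimes>\<^bsub>S\<^esub> inverse_elt S x \<otimes>\<^bsub>S\<^esub> x = x" "natural_le S x y"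
  shows "(x, y) \<in> min_group_congruence S"
proof -
  interpret monoid S by fact
  let ?f = "x \<otimes>\<^bsub>S\<^esub> inverse_elt S x"
  have f: "?f \<in> carrier S" "?f \<otimes>\<^bsub>S\<^esub> ?f = ?f"
    using assms(2-5) by (simp_all add: m_assoc[symmetric])
  have "(?f \<otimes>\<^bsub>S\<^esub> y, \<one>\<^bsub>S\<^esub> \<otimes>\<^bsub>S\<^esub> y) \<in> r" if r: "monoid_congruence S r" "group (quotient_monoid S r)" for r
  proof -
    have "(y, y) \<in> r" using r(1) x(2) by (meson monoid_congruence_def equivE refl_onD)
    then show ?thesis using r group_congruence_idem[OF \<open>monoid S\<close> r f] by (simp add: monoid_congruence_def)
  qed
  moreover have "?f \<otimes>\<^bsub>S\<^esub> y = x" using assms(6) by (simp add: natural_le_def)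
  ultimately show ?thesis using x(2) by (simp add: min_group_congruence_def)
qed

section \<open>Special inverse monoids\<close>

lemma carrier_free_inverse_monoid: "carrier free_inverse_monoid = range free_inverse_elt"
  by (auto simp: free_inverse_monoid_def quotient_monoid_def quotient_def word_monoid_def
      free_inverse_elt_def)

text \<open>The universal property of the special inverse monoid, skipping the intermediate free
  inverse monoid. The invariants used below are instances of it: formal inversion, the group image
  and partial actions.\<close>

lemma special_elt_eqD:
  fixes w :: "'x letter list"
  assumes c: "monoid_congruence word_monoid c"
    and V1: "\<And>u. (u @ word_inv u @ u, u) \<in> c"
    and V2: "\<And>u v. (u @ word_inv u @ v @ word_inv v, v @ word_inv v @ u @ word_inv u) \<in> c"
    and W: "(w, []) \<in> c"
    and eq: "special_elt w u = special_elt w v"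
  shows "(u, v) \<in> c"
proof -
  have equiv: "equiv UNIV c" and mult: "\<And>a b a' b'. (a, b) \<in> c \<Longrightarrow> (a', b') \<in> c \<Longrightarrow> (a @ a', b @ b') \<in> c"
    using c by (auto simp: monoid_congruence_def word_monoid_def)
  have sym: "(b, a) \<in> c" if "(a, b) \<in> c" for a b using equiv that by (meson equivE symD)
  have trans: "(a, d) \<in> c" if "(a, b) \<in> c" "(b, d) \<in> c" for a b d
    using equiv that by (meson equivE transD)
  have sub: "vagner_congruence \<subseteq> c"
    unfolding vagner_congruence_def generated_congruence_def using c V1 V2 by (intro Inter_lower) auto
  have free: "(a, b) \<in> c" if "free_inverse_elt a = free_inverse_elt b" for a b
  proof -
    have cong: "monoid_congruence word_monoid (vagner_congruence :: ('x letter list \<times> _) set)"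
      by (rule vagner_congruence)
    have "equiv UNIV (vagner_congruence :: ('x letter list \<times> _) set)"
      using cong by (simp add: monoid_congruence_def word_monoid_def)
    then have "(a, b) \<in> vagner_congruence"
      using that unfolding free_inverse_elt_def by (intro eq_equiv_class) auto
    then show ?thesis using sub by blast
  qed
  define r where "r = {(free_inverse_elt a, free_inverse_elt b) |a b. (a, b) \<in> c}"
  have rD: "(a, b) \<in> c" if "(free_inverse_elt a, free_inverse_elt b) \<in> r" for a b
  proof -
    from that obtain a' b' where *: "free_inverse_elt a = free_inverse_elt a'" "free_inverse_elt b = free_inverse_elt b'"
      and c': "(a', b') \<in> c"
      unfolding r_def by blast
    show ?thesis by (rule trans[OF free[OF *(1)] trans[OF c' sym[OF free[OF *(2)]]]])
  qed
  have "equiv (carrier free_inverse_monoid) r"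
  proof (rule equivI)
    show "r \<subseteq> carrier free_inverse_monoid \<times> carrier free_inverse_monoid"
      by (auto simp: r_def free_inverse_elt(1))
    show "refl_on (carrier free_inverse_monoid) r"
      using equiv by (auto simp: refl_on_def r_def carrier_free_inverse_monoid equiv_def)
    show "sym r" using sym by (auto simp: r_def intro!: symI)
    show "trans r"
    proof (rule transI)
      fix x y z assume "(x, y) \<in> r" "(y, z) \<in> r"
      then obtain a b b' d where *: "x = free_inverse_elt a" "y = free_inverse_elt b"
        "z = free_inverse_elt d" "(a, b) \<in> c" "(b', d) \<in> c" "free_inverse_elt b = free_inverse_elt b'"
        unfolding r_def by blast
      have "(a, d) \<in> c" by (rule trans[OF *(4) trans[OF free[OF *(6)] *(5)]])
      then show "(x, z) \<in> r" unfolding r_def using *(1,3) by blast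
    qed
  qed
  moreover have "(x \<otimes>\<^bsub>free_inverse_monoid\<^esub> y, x' \<otimes>\<^bsub>free_inverse_monoid\<^esub> y') \<in> r"
    if "(x, x') \<in> r" "(y, y') \<in> r" for x x' y y'
  proof -
    from that obtain a a' b b' where *: "x = free_inverse_elt a" "x' = free_inverse_elt a'"
      "y = free_inverse_elt b" "y' = free_inverse_elt b'" and c': "(a, a') \<in> c" "(b, b') \<in> c"
      unfolding r_def by blast
    show ?thesis using mult[OF c'] unfolding r_def * free_inverse_elt(2) by blast
  qed
  ultimately have "monoid_congruence free_inverse_monoid r"
    unfolding monoid_congruence_def by blast
  moreover have "(free_inverse_elt w, \<one>\<^bsub>free_inverse_monoid\<^esub>) \<in> r"
    using W by (auto simp: r_def free_inverse_elt(3))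
  ultimately have "special_congruence w \<subseteq> r"
    unfolding special_congruence_def generated_congruence_def by (intro Inter_lower) auto
  moreover have "(free_inverse_elt u, free_inverse_elt v) \<in> special_congruence w"
    using eq special_congruence(1)[of w] unfolding special_elt_def monoid_congruence_def
    by (intro eq_equiv_class[where A = "carrier free_inverse_monoid"]) (auto simp: free_inverse_elt(1))
  ultimately show ?thesis using rD by blast
qed

lemma carrier_special_inverse_monoid: "carrier (special_inverse_monoid w) = range (special_elt w)"
  by (auto simp: special_inverse_monoid_def quotient_monoid_def quotient_def
      carrier_free_inverse_monoid special_elt_def)

lemma word_congruenceI:
  assumes "\<And>u. c u u" "\<And>u v. c u v \<Longrightarrow> c v u" "\<And>u v z. c u v \<Longrightarrow> c v z \<Longrightarrow> c u z"
    "\<And>u u' v v'. c u u' \<Longrightarrow> c v v' \<Longrightarrow> c (u @ v) (u' @ v')"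
  shows "monoid_congruence word_monoid {(u, v). c u v}"
proof -
  have "equiv UNIV {(u, v). c u v}"
    by (intro equivI refl_onI symI transI) (use assms(1-3) in blast)+
  then show ?thesis using assms(4) by (simp add: monoid_congruence_def word_monoid_def)
qed

type_synonym 'y mon_elt = "'y letter list set set"

type_synonym 'y grp_elt = "'y letter list set set set"

locale special =
  fixes w :: "'x letter list"
begin

abbreviation M :: "'x mon_elt monoid" where "M \<equiv> special_inverse_monoid w"
abbreviation e :: "'x letter list \<Rightarrow> 'x mon_elt" where "e \<equiv> special_elt w"

lemma e_mult: "e u \<otimes>\<^bsub>M\<^esub> e v = e (u @ v)"
  by (rule special_elt(2))

lemma e_cong: "e u = e u' \<Longrightarrow> e v = e v' \<Longrightarrow> e (u @ v) = e (u' @ v')"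
  by (metis special_elt(2))

lemma free_inverse_elt_eq: "(u, v) \<in> vagner_congruence \<Longrightarrow> e u = e v"
  using vagner_congruence unfolding special_elt_def free_inverse_elt_def monoid_congruence_def
  by (metis equiv_class_eq)

lemma e_inv: "e (u @ word_inv u @ u) = e u"
  by (intro free_inverse_elt_eq) (auto simp: vagner_congruence_def generated_congruence_def)

lemma e_commute: "e (u @ word_inv u @ v @ word_inv v) = e (v @ word_inv v @ u @ word_inv u)"
  by (intro free_inverse_elt_eq) (auto simp: vagner_congruence_def generated_congruence_def)

text \<open>Inversion permutes Vagner's relations; for the relator, \<open>w = 1\<close> and
  \<open>w w' w = w\<close> give \<open>w' = 1\<close> for the inverse word \<open>w'\<close>. So
  inverses are well defined on classes.\<close>

lemma e_word_inv_cong: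
  assumes "e u = e v" shows "e (word_inv u) = e (word_inv v)"
proof -
  let ?c = "\<lambda>u v. e (word_inv u) = e (word_inv v)"
  have "(u, v) \<in> {(u, v). ?c u v}"
  proof (rule special_elt_eqD[OF _ _ _ _ assms])
    show "monoid_congruence word_monoid {(u, v). ?c u v}"
      by (rule word_congruenceI) (simp_all add: e_mult[symmetric])
    show "(u @ word_inv u @ u, u) \<in> {(u, v). ?c u v}" for u
      using e_inv[of "word_inv u"] by simp
    show "(u @ word_inv u @ v @ word_inv v, v @ word_inv v @ u @ word_inv u) \<in> {(u, v). ?c u v}" for u v
      using e_commute[of v u] by simp
    have "e (word_inv w) = e (w @ word_inv w)"
      using e_cong[OF special_elt(4) HOL.refl, of "word_inv w"] by simp
    also have "\<dots> = e ((w @ word_inv w) @ w)"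
      using e_cong[OF HOL.refl special_elt(4), of "w @ word_inv w"] by simp
    also have "\<dots> = e []" using e_inv[of w] special_elt(4)[of w] by simp
    finally show "(w, []) \<in> {(u, v). ?c u v}" by simp
  qed
  then show ?thesis by simp
qed

definition star_word :: "'x mon_elt \<Rightarrow> 'x mon_elt" where
  "star_word m = e (word_inv (SOME u. e u = m))"

lemma star_word_e: "star_word (e u) = e (word_inv u)"
  unfolding star_word_def by (rule e_word_inv_cong) (rule someI, rule HOL.refl)

lemma inverse_mon_M: "inverse_mon M" and inverse_elt_M: "x \<in> carrier M \<Longrightarrow> inverse_elt M x = star_word x"
proof -
  show "inverse_mon M" "x \<in> carrier M \<Longrightarrow> inverse_elt M x = star_word x"
    by (rule inverse_monoidI[OF monoid_special_inverse_monoid, where i = star_word];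
        force simp: carrier_special_inverse_monoid star_word_e e_mult e_inv e_commute)+
qed

sublocale inverse_mon M
  by (rule inverse_mon_M)

lemma e_closed [simp]: "e u \<in> carrier M"
  by (rule special_elt(1))

lemma carrier_M: "carrier M = range e"
  by (rule carrier_special_inverse_monoid)

lemma star_e [simp]: "star (e u) = e (word_inv u)"
  by (simp add: inverse_elt_M star_word_e)

lemma one_M: "\<one>\<^bsub>M\<^esub> = e []"
  by (rule special_elt(3))

lemma e_relator: "e w = e []"
  by (rule special_elt(4))

subsection \<open>The maximum group image\<close>

abbreviation \<sigma> where "\<sigma> \<equiv> min_group_congruence M"

lemma gpeq_e: "e u = e v \<Longrightarrow> gpeq {w} u v"
proof -
  assume "e u = e v"
  have "(u, v) \<in> {(u, v). gpeq {w} u v}"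
  proof (rule special_elt_eqD[OF _ _ _ _ \<open>e u = e v\<close>])
    show "monoid_congruence word_monoid {(u, v). gpeq {w} u v}"
      by (rule word_congruenceI) (fact gpeq.refl gpeq.sym gpeq.trans gpeq.app)+
    show "(u @ word_inv u @ u, u) \<in> {(u, v). gpeq {w} u v}" for u
      using gpeq.app[OF gpeq.refl gpeq_word_inv_left, of "{w}" u u] by simp
    show "(u @ word_inv u @ v @ word_inv v, v @ word_inv v @ u @ word_inv u) \<in> {(u, v). gpeq {w} u v}" for u v
    proof -
      have "gpeq {w} ((u @ word_inv u) @ v @ word_inv v) ([] @ [])" for u v
        by (intro gpeq.app gpeq_word_inv_right)
      from this[of u v] this[of v u] show ?thesis by (metis append.assoc case_prodI gpeq.sym gpeq.trans mem_Collect_eq)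
    qed
    show "(w, []) \<in> {(u, v). gpeq {w} u v}" by (simp add: gpeq.rel)
  qed
  then show ?thesis by simp
qed

lemma gpeq_group_congruence:
  assumes r: "monoid_congruence M r" "group (quotient_monoid M r)" and "gpeq {w} u v"
  shows "(e u, e v) \<in> r"
proof -
  have eq: "equiv (carrier M) r" using r(1) by (simp add: monoid_congruence_def)
  from assms(3) show ?thesis
  proof induction
    case (refl u)
    then show ?case using eq by (meson e_closed equivE refl_onD)
  next
    case (sym u v)
    then show ?case using eq by (meson equivE symD)
  next
    case (trans u v z)
    then show ?case using eq by (meson equivE transD)
  next
    case (app u u' v v')
    then show ?case using r(1) unfolding monoid_congruence_def by (metis e_mult)
  next
    case (pair a)
    have "e [a, letter_inv a] \<otimes>\<^bsub>M\<^esub> e [a, letter_inv a] = e [a, letter_inv a]"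
      using idem_mult_star[of "e [a]"] by (simp add: e_mult)
    then show ?case using group_congruence_idem[OF _ r, of "e [a, letter_inv a]"]
      by (simp add: monoid_axioms one_M)
  next
    case (rel r)
    then show ?case using e_relator eq by (metis e_closed equivE refl_onD singletonD)
  qed
qed

text \<open>The maximum group image is the one-relator group of \<open>w\<close>: every group
  congruence contains the derivable equalities, and these form a group congruence
  themselves.\<close>

lemma sigma_iff: "(e u, e v) \<in> \<sigma> \<longleftrightarrow> gpeq {w} u v"
proof
  show "(e u, e v) \<in> \<sigma>" if "gpeq {w} u v"
    using gpeq_group_congruence[OF _ _ that] unfolding min_group_congruence_def by blast
  define r where "r = {(e u, e v) |u v. gpeq {w} u v}"
  have rD: "(e u, e v) \<in> r \<longleftrightarrow> gpeq {w} u v" for u v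
  proof
    assume "(e u, e v) \<in> r"
    then obtain u' v' where "e u = e u'" "e v = e v'" "gpeq {w} u' v'" unfolding r_def by blast
    then show "gpeq {w} u v" using gpeq_e gpeq.sym gpeq.trans by metis
  qed (auto simp: r_def)
  have "equiv (carrier M) r"
  proof (rule equivI)
    show "r \<subseteq> carrier M \<times> carrier M" by (auto simp: r_def)
    show "refl_on (carrier M) r" by (auto simp: refl_on_def rD carrier_M)
    show "sym r" by (auto simp: r_def intro!: symI intro: gpeq.sym)
    show "trans r"
    proof (rule transI)
      fix x y z assume xyz: "(x, y) \<in> r" "(y, z) \<in> r"
      then obtain u v v' z' where *: "x = e u" "y = e v" "z = e z'" unfolding r_def by blast
      show "(x, z) \<in> r" using xyz unfolding * rD by (rule gpeq.trans)
    qed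
  qed
  moreover have "(x \<otimes>\<^bsub>M\<^esub> y, x' \<otimes>\<^bsub>M\<^esub> y') \<in> r" if "(x, x') \<in> r" "(y, y') \<in> r" for x x' y y'
    using that unfolding r_def by (auto simp: e_mult) (blast intro: gpeq.app)
  ultimately have c: "monoid_congruence M r"
    unfolding monoid_congruence_def by blast
  interpret Q: monoid "quotient_monoid M r" by (rule monoid_quotient[OF monoid_axioms c])
  have "group (quotient_monoid M r)"
  proof (rule Q.group_l_invI)
    fix x assume "x \<in> carrier (quotient_monoid M r)"
    then obtain u where x: "x = r `` {e u}" by (auto simp: quotient_monoid_def quotient_def carrier_M)
    have "r `` {e (word_inv u)} \<otimes>\<^bsub>quotient_monoid M r\<^esub> x = r `` {e (word_inv u @ u)}"
      by (simp add: x quotient_mult[OF c] e_mult)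
    also have "\<dots> = r `` {e []}"
      by (rule equiv_class_eq[OF \<open>equiv (carrier M) r\<close>]) (simp add: rD gpeq_word_inv_left)
    also have "\<dots> = \<one>\<^bsub>quotient_monoid M r\<^esub>" by (simp add: quotient_monoid_def one_M)
    finally show "\<exists>y \<in> carrier (quotient_monoid M r). y \<otimes>\<^bsub>quotient_monoid M r\<^esub> x = \<one>\<^bsub>quotient_monoid M r\<^esub>"
      by (intro bexI[of _ "r `` {e (word_inv u)}"]) (auto simp: quotient_monoid_def quotientI)
  qed
  with c have "\<sigma> \<subseteq> r" unfolding min_group_congruence_def by blast
  then show "(e u, e v) \<in> \<sigma> \<Longrightarrow> gpeq {w} u v" using rD by blast
qed

lemma sigma_congruence: "monoid_congruence M \<sigma>"
  by (rule monoid_congruence_min_group[OF monoid_axioms])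

definition g :: "'x letter list \<Rightarrow> 'x grp_elt" where
  "g u = \<sigma> `` {e u}"

abbreviation G where "G \<equiv> quotient_monoid M \<sigma>"

abbreviation \<gamma> :: "'x \<Rightarrow> 'x grp_elt" where
  "\<gamma> \<equiv> (\<lambda>x. \<sigma> `` {special_gen w x})"

lemma g_mult [simp]: "g u \<otimes>\<^bsub>G\<^esub> g v = g (u @ v)"
  unfolding g_def by (subst quotient_mult[OF sigma_congruence]) (simp_all add: e_mult)

lemma g_eq_iff: "g u = g v \<longleftrightarrow> gpeq {w} u v"
  using sigma_congruence unfolding g_def monoid_congruence_def sigma_iff[symmetric]
  by (metis e_closed eq_equiv_class_iff)

lemma carrier_G: "carrier G = range g"
  by (auto simp: quotient_monoid_def quotient_def carrier_M g_def)

lemma one_G: "\<one>\<^bsub>G\<^esub> = g []"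
  by (simp add: quotient_monoid_def one_M g_def)

lemma g_closed [simp]: "g u \<in> carrier G"
  by (simp add: carrier_G)

lemma g_word_inv [simp]: "g (word_inv u @ u) = g []" "g (u @ word_inv u) = g []"
  by (simp_all add: g_eq_iff gpeq_word_inv_left gpeq_word_inv_right)

lemma group_G: "group G"
proof -
  interpret Q: monoid G by (rule monoid_quotient[OF monoid_axioms sigma_congruence])
  show ?thesis
  proof (rule Q.group_l_invI)
    fix x assume "x \<in> carrier G"
    then obtain u where "x = g u" by (auto simp: carrier_G)
    then show "\<exists>y \<in> carrier G. y \<otimes>\<^bsub>G\<^esub> x = \<one>\<^bsub>G\<^esub>"
      by (intro bexI[of _ "g (word_inv u)"]) (simp_all add: one_G)
  qed
qed

lemma inv_g: "inv\<^bsub>G\<^esub> (g u) = g (word_inv u)"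
  by (rule group.inv_equality[OF group_G]) (simp_all add: one_G)

lemma letter_val_G: "letter_val G \<gamma> a = g [a]"
  using inv_g[of "[Pos _]"] by (cases a) (simp_all add: special_gen_def g_def[symmetric])

lemma e_mem_g: "e u \<in> g v \<longleftrightarrow> g u = g v"
  by (auto simp: g_def sigma_iff g_eq_iff[unfolded g_def] intro: gpeq.sym)

lemma g_subset: "x \<in> g v \<Longrightarrow> x \<in> carrier M"
  using sigma_congruence by (auto simp: g_def monoid_congruence_def equiv_def)

end

context special
begin

section \<open>The expansion in terms of words\<close>

abbreviation E where "E \<equiv> margolis_meakin G \<gamma>"

definition vts :: "'x letter list \<Rightarrow> 'x grp_elt set" where
  "vts u = {g p |p. prefix p u}"

definition ars :: "'x letter list \<Rightarrow> ('x grp_elt \<times> 'x letter) set" where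
  "ars u = {(g p, a) |p a. prefix (p @ [a]) u} \<union> {(g (p @ [a]), letter_inv a) |p a. prefix (p @ [a]) u}"

definition gr :: "'x grp_elt set \<Rightarrow> ('x grp_elt \<times> 'x letter) set \<Rightarrow>
    ('x grp_elt, 'x grp_elt \<times> 'x letter) pre_digraph" where
  "gr V A = (cayley G \<gamma>)\<lparr> verts := V, arcs := A \<rparr>"

definition \<eta> :: "'x letter list \<Rightarrow> ('x grp_elt, 'x grp_elt \<times> 'x letter) pre_digraph
    \<times> 'x grp_elt" where
  "\<eta> u = (gr (vts u) (ars u), g u)"

definition simple :: "'x letter list \<Rightarrow> bool" where
  "simple u \<longleftrightarrow> (\<forall>p q. prefix p u \<longrightarrow> prefix q u \<longrightarrow> g p = g q \<longrightarrow> p = q)"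

definition transl :: "'x letter list \<Rightarrow> ('x grp_elt \<times> 'x letter) set \<Rightarrow> ('x grp_elt \<times> 'x letter) set" where
  "transl u A = (\<lambda>(h, a). (g u \<otimes>\<^bsub>G\<^esub> h, a)) ` A"

lemma gr_simps [simp]:
  "verts (gr V A) = V" "arcs (gr V A) = A" "tail (gr V A) = fst"
  "head (gr V A) = (\<lambda>(h, a). h \<otimes>\<^bsub>G\<^esub> g [a])"
  by (simp_all add: gr_def cayley_def letter_val_G)

lemma gr_eq_iff [simp]: "gr V A = gr V' A' \<longleftrightarrow> V = V' \<and> A = A'"
  by (metis gr_simps(1,2))

lemma union_gr: "Digraph_Component.union (gr V A) (gr V' A') = gr (V \<union> V') (A \<union> A')"
  by (simp add: Digraph_Component.union_def gr_def cayley_def)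

lemma translate_gr: "translate G (g u) (gr V A) = gr ((\<lambda>h. g u \<otimes>\<^bsub>G\<^esub> h) ` V) (transl u A)"
  by (simp add: translate_def gr_def cayley_def transl_def)

lemma mult_E: "(gr V A, h) \<otimes>\<^bsub>E\<^esub> (gr V' A', h') =
    (Digraph_Component.union (gr V A) (translate G h (gr V' A')), h \<otimes>\<^bsub>G\<^esub> h')"
  by (simp add: margolis_meakin_def)

lemma edge_inv_G: "edge_inv G \<gamma> (g p, a) = (g (p @ [a]), letter_inv a)"
  by (simp add: edge_inv_def cayley_def letter_val_G)

lemma g_pair [simp]: "g (p @ [a, letter_inv a]) = g p"
  by (simp add: g_eq_iff) (metis append_Nil2 gpeq.pair gpeq_append_left_iff)

lemma g_pair' [simp]: "g (p @ [letter_inv a, a]) = g p"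
  using g_pair[of p "letter_inv a"] by simp

lemma vts_append: "vts (u @ v) = vts u \<union> (\<lambda>h. g u \<otimes>\<^bsub>G\<^esub> h) ` vts v"
  unfolding vts_def by (auto simp: prefix_append image_iff) (metis g_mult)+

lemma prefix_snoc_append:
  "prefix (p @ [a]) (u @ v) \<longleftrightarrow> prefix (p @ [a]) u \<or> (\<exists>q. p = u @ q \<and> prefix (q @ [a]) v)"
proof -
  have "p = u @ q \<and> z = q @ [a]" if "p @ [a] = u @ z" "z \<noteq> []" "q = butlast z" for z q
    using that by (metis append_butlast_last_id append_assoc butlast_append butlast_snoc last_appendR last_snoc)
  then show ?thesis unfolding prefix_append by (metis append.assoc append_Nil2 prefix_order.refl)
qed

lemma ars_fwd: "prefix (p @ [a]) u \<Longrightarrow> (g p, a) \<in> ars u"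
  and ars_bwd: "prefix (p @ [a]) u \<Longrightarrow> (g (p @ [a]), letter_inv a) \<in> ars u"
  by (auto simp: ars_def)

lemma arsE:
  assumes "x \<in> ars u"
  obtains p a where "prefix (p @ [a]) u" "x = (g p, a) \<or> x = (g (p @ [a]), letter_inv a)"
  using assms unfolding ars_def by blast

lemma translI: "(h, a) \<in> A \<Longrightarrow> (g u \<otimes>\<^bsub>G\<^esub> h, a) \<in> transl u A"
  by (force simp: transl_def)

lemma ars_append: "ars (u @ v) = ars u \<union> transl u (ars v)"
proof (intro equalityI subsetI)
  fix x assume "x \<in> ars (u @ v)"
  then obtain p a where pa: "prefix (p @ [a]) (u @ v)" "x = (g p, a) \<or> x = (g (p @ [a]), letter_inv a)"
    by (rule arsE)
  from pa(1) consider "prefix (p @ [a]) u" | q where "p = u @ q" "prefix (q @ [a]) v"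
    unfolding prefix_snoc_append by blast
  then show "x \<in> ars u \<union> transl u (ars v)"
  proof cases
    case 1
    then show ?thesis using pa(2) ars_fwd ars_bwd by blast
  next
    case 2
    then show ?thesis using pa(2) translI[OF ars_fwd[OF 2(2)], of u] translI[OF ars_bwd[OF 2(2)], of u]
      by auto
  qed
next
  fix x assume "x \<in> ars u \<union> transl u (ars v)"
  then consider "x \<in> ars u" | h b where "(h, b) \<in> ars v" "x = (g u \<otimes>\<^bsub>G\<^esub> h, b)"
    unfolding transl_def by auto
  then show "x \<in> ars (u @ v)"
  proof cases
    case 1
    then show ?thesis by (auto elim!: arsE intro: ars_fwd ars_bwd)
  next
    case 2
    from 2(1) obtain p a where pa: "prefix (p @ [a]) v" "(h, b) = (g p, a) \<or> (h, b) = (g (p @ [a]), letter_inv a)"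
      by (rule arsE)
    have "prefix ((u @ p) @ [a]) (u @ v)" using pa(1) by simp
    then show ?thesis using pa(2) 2(2) ars_fwd[of "u @ p" a "u @ v"] ars_bwd[of "u @ p" a "u @ v"] by auto
  qed
qed

lemma vts_Nil [simp]: "vts [] = {g []}" and ars_Nil [simp]: "ars [] = {}"
  by (auto simp: vts_def ars_def)

lemma vts_single: "vts [a] = {g [], g [a]}"
  by (auto simp: vts_def prefix_Cons)

lemma ars_single: "ars [a] = {(g [], a), (g [a], letter_inv a)}"
proof -
  have "prefix (p @ [b]) [a] \<longleftrightarrow> p = [] \<and> b = a" for p b by (auto simp: prefix_Cons)
  then show ?thesis by (auto simp: ars_def)
qed

lemma vts_subset: "vts u \<subseteq> carrier G" and ars_subset: "ars u \<subseteq> carrier G \<times> UNIV"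
  by (auto simp: vts_def ars_def)

lemma transl_transl: "A \<subseteq> carrier G \<times> UNIV \<Longrightarrow> transl u (transl v A) = transl (u @ v) A"
proof -
  interpret G: group G by (rule group_G)
  have "g u \<otimes>\<^bsub>G\<^esub> (g v \<otimes>\<^bsub>G\<^esub> h) = g (u @ v) \<otimes>\<^bsub>G\<^esub> h" if "h \<in> carrier G" for h
    using that by (subst g_mult[symmetric]) (simp only: G.m_assoc g_closed)
  then have *: "A \<subseteq> carrier G \<times> UNIV \<Longrightarrow> (\<lambda>x. (g u \<otimes>\<^bsub>G\<^esub> (g v \<otimes>\<^bsub>G\<^esub> fst x), snd x)) ` A =
      (\<lambda>x. (g (u @ v) \<otimes>\<^bsub>G\<^esub> fst x, snd x)) ` A"
    by (intro image_cong) auto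
  show "A \<subseteq> carrier G \<times> UNIV \<Longrightarrow> ?thesis"
    using * by (simp add: transl_def image_image case_prod_beta)
qed

lemma transl_cong: "g u = g v \<Longrightarrow> transl u A = transl v A"
  by (simp add: transl_def)

lemma transl_mono: "A \<subseteq> B \<Longrightarrow> transl u A \<subseteq> transl u B"
  by (auto simp: transl_def)

lemma transl_Nil: "A \<subseteq> carrier G \<times> UNIV \<Longrightarrow> transl [] A = A"
proof -
  interpret G: group G by (rule group_G)
  have "g [] \<otimes>\<^bsub>G\<^esub> h = h" if "h \<in> carrier G" for h using that by (simp add: one_G[symmetric])
  then have *: "A \<subseteq> carrier G \<times> UNIV \<Longrightarrow> (\<lambda>x. (g [] \<otimes>\<^bsub>G\<^esub> fst x, snd x)) ` A = (\<lambda>x. x) ` A"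
    by (intro image_cong) auto
  show "A \<subseteq> carrier G \<times> UNIV \<Longrightarrow> ?thesis"
    using * by (simp add: transl_def case_prod_beta)
qed

lemma ars_inv_closed: "(h, a) \<in> ars u \<Longrightarrow> (h \<otimes>\<^bsub>G\<^esub> g [a], letter_inv a) \<in> ars u"
  unfolding ars_def by auto

lemma ars_ends: "(h, a) \<in> ars u \<Longrightarrow> h \<in> vts u \<and> h \<otimes>\<^bsub>G\<^esub> g [a] \<in> vts u"
  unfolding ars_def vts_def by (auto dest: append_prefixD)

text \<open>Apart from the root, needed for the empty word, the vertices are read off the arcs; so
  elements of the expansion are compared by \<open>ars\<close> and \<open>g\<close> only.\<close>

lemma vts_ars: "vts u = insert (g []) (fst ` ars u)"
proof
  show "vts u \<subseteq> insert (g []) (fst ` ars u)"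
  proof
    fix h assume "h \<in> vts u"
    then obtain p where p: "h = g p" "prefix p u" by (auto simp: vts_def)
    show "h \<in> insert (g []) (fst ` ars u)"
    proof (cases p rule: rev_cases)
      case (snoc q a)
      then have "(h, letter_inv a) \<in> ars u" using p by (auto simp: ars_def)
      then show ?thesis by force
    qed (simp add: p)
  qed
  show "insert (g []) (fst ` ars u) \<subseteq> vts u"
    using ars_ends by (auto simp: vts_def)
qed

lemma \<eta>_eq_iff: "\<eta> u = \<eta> v \<longleftrightarrow> ars u = ars v \<and> g u = g v"
  by (auto simp: \<eta>_def vts_ars)

lemma ars_word_inv: "transl u (ars (word_inv u)) = ars u"
proof (induction u)
  case (Cons a u)
  have A: "ars v \<subseteq> carrier G \<times> UNIV" for v by (rule ars_subset)
  have "ars (word_inv (a # u)) = ars (word_inv u) \<union> transl (word_inv u) (ars [letter_inv a])"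
    by (simp add: ars_append)
  then have "transl (a # u) (ars (word_inv (a # u))) =
      transl (a # u) (ars (word_inv u)) \<union> transl (a # u) (transl (word_inv u) (ars [letter_inv a]))"
    by (simp only: transl_def image_Un)
  also have "transl (a # u) (ars (word_inv u)) = transl [a] (ars u)"
    using transl_transl[OF A, of "[a]" u "word_inv u"] Cons by simp
  also have "transl (a # u) (transl (word_inv u) (ars [letter_inv a])) = transl [a] (ars [letter_inv a])"
  proof -
    have "g ((a # u) @ word_inv u) = g [a]"
      using g_mult[of "[a]" "u @ word_inv u"] by (simp add: g_eq_iff) (metis append_Nil2 append_Cons append_Nil gpeq_append_left_iff gpeq_word_inv_right)
    then show ?thesis by (metis A transl_transl transl_cong)
  qed
  also have "transl [a] (ars [letter_inv a]) = ars [a]"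
    using g_pair[of "[]" a] by (simp add: ars_single transl_def insert_commute)
  finally show ?case using ars_append[of "[a]" u] by auto
qed (simp add: transl_def)

lemma ars_mult_inv: "ars (u @ word_inv u) = ars u"
  by (simp add: ars_append ars_word_inv)

lemma \<eta>_mult: "\<eta> u \<otimes>\<^bsub>E\<^esub> \<eta> v = \<eta> (u @ v)"
  by (simp add: \<eta>_def mult_E translate_gr union_gr vts_append ars_append)

lemma \<eta>_one: "\<one>\<^bsub>E\<^esub> = \<eta> []"
  by (simp add: \<eta>_def margolis_meakin_def gr_def one_G)

lemma \<eta>_gen: "margolis_meakin_gen G \<gamma> x = \<eta> [Pos x]"
proof -
  have "\<gamma> x = g [Pos x]" by (simp add: special_gen_def g_def)
  then show ?thesis using edge_inv_G[of "[]" "Pos x"]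
    by (simp add: \<eta>_def margolis_meakin_gen_def gr_def one_G vts_single ars_single)
qed

section \<open>Words span exactly the elements of the expansion\<close>

lemma finite_ars: "finite (ars u)"
proof -
  have "ars u \<subseteq> (\<lambda>p. (g (butlast p), last p)) ` {p. prefix p u} \<union> (\<lambda>p. (g p, letter_inv (last p))) ` {p. prefix p u}"
    unfolding ars_def by (auto simp: image_iff) (metis butlast_snoc last_snoc)+
  moreover have "{p. prefix p u} = set (prefixes u)" by auto
  ultimately show ?thesis by (metis (no_types, lifting) List.finite_set finite_UnI finite_imageI finite_subset)
qed

lemma finite_vts: "finite (vts u)"
  by (simp add: vts_ars finite_ars)

lemma wf_gr:
  assumes "\<And>h a. (h, a) \<in> A \<Longrightarrow> h \<in> V \<and> h \<otimes>\<^bsub>G\<^esub> g [a] \<in> V" shows "wf_digraph (gr V A)"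
  using assms by unfold_locales auto

lemma cayley_gr: "cayley G \<gamma> = gr (carrier G) (carrier G \<times> UNIV)"
  by (simp add: gr_def cayley_def)

lemma reachable_gr: "h \<rightarrow>\<^sup>*\<^bsub>mk_symmetric (gr V A)\<^esub> h' \<longleftrightarrow>
    (h, h') \<in> rtrancl_on V (\<Union>(x, a) \<in> A. {(x, x \<otimes>\<^bsub>G\<^esub> g [a]), (x \<otimes>\<^bsub>G\<^esub> g [a], x)})"
proof -
  have "arcs_ends (with_proj (mk_symmetric (gr V A))) =
      (\<Union>(x, a) \<in> A. {(x, x \<otimes>\<^bsub>G\<^esub> g [a]), (x \<otimes>\<^bsub>G\<^esub> g [a], x)})"
    by (simp add: mk_symmetric_def case_prod_beta)
  then show ?thesis unfolding reachable_def by simp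
qed

lemma \<eta>_closed: "\<eta> u \<in> carrier E"
proof -
  have wf: "wf_digraph (gr (vts u) (ars u))" by (rule wf_gr) (rule ars_ends)
  have wf': "wf_digraph (cayley G \<gamma>)"
    unfolding cayley_gr by (rule wf_gr) (auto simp: carrier_G)
  have "subgraph (gr (vts u) (ars u)) (cayley G \<gamma>)"
    unfolding subgraph_def using wf wf' vts_subset ars_subset
    by (simp add: cayley_gr compatible_def)
  moreover have "edge_inv G \<gamma> x \<in> ars u" if "x \<in> ars u" for x
  proof -
    obtain h a where x: "x = (h, a)" by (cases x)
    with that ars_subset[of u] obtain p where "h = g p" by (auto simp: carrier_G)
    then show ?thesis using ars_inv_closed[of h a u] that x by (simp add: edge_inv_G)
  qed
  ultimately have "cayley_subgraph G \<gamma> (gr (vts u) (ars u))" by (simp add: cayley_subgraph_def)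
  moreover have "Digraph_Component.connected (gr (vts u) (ars u))"
    unfolding Digraph_Component.connected_def
  proof (rule strongly_connectedI)
    let ?R = "\<Union>(x, a) \<in> ars u. {(x, x \<otimes>\<^bsub>G\<^esub> g [a]), (x \<otimes>\<^bsub>G\<^esub> g [a], x)}"
    have r: "(g [], g p) \<in> rtrancl_on (vts u) ?R \<and> (g p, g []) \<in> rtrancl_on (vts u) ?R" if "prefix p u" for p
      using that
    proof (induction p rule: rev_induct)
      case Nil
      then show ?case by (auto simp: vts_def)
    next
      case (snoc a p)
      then have IH: "(g [], g p) \<in> rtrancl_on (vts u) ?R" "(g p, g []) \<in> rtrancl_on (vts u) ?R"
        by (auto dest: append_prefixD)
      have a: "(g p, a) \<in> ars u" using snoc.prems by (auto simp: ars_def)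
      then have "(g p, g (p @ [a])) \<in> ?R" "(g (p @ [a]), g p) \<in> ?R"
        using UN_I[of "(g p, a)" "ars u" _ "\<lambda>(x, a). {(x, x \<otimes>\<^bsub>G\<^esub> g [a]), (x \<otimes>\<^bsub>G\<^esub> g [a], x)}"] by simp_all
      moreover have "g p \<in> vts u" "g (p @ [a]) \<in> vts u" using ars_ends[OF a] by simp_all
      ultimately have "(g p, g (p @ [a])) \<in> rtrancl_on (vts u) ?R" "(g (p @ [a]), g p) \<in> rtrancl_on (vts u) ?R"
        by (meson rtrancl_on_refl rtrancl_on_into_rtrancl_on)+
      with IH show ?case by (blast intro: rtrancl_on_trans)
    qed
    fix h h' assume "h \<in> verts (mk_symmetric (gr (vts u) (ars u)))" "h' \<in> verts (mk_symmetric (gr (vts u) (ars u)))"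
    then obtain p q where "h = g p" "prefix p u" "h' = g q" "prefix q u" by (auto simp: vts_def)
    then show "h \<rightarrow>\<^sup>*\<^bsub>mk_symmetric (gr (vts u) (ars u))\<^esub> h'"
      unfolding reachable_gr using r by (blast intro: rtrancl_on_trans)
  qed (auto simp: vts_def)
  moreover have "g [] \<in> vts u" "g u \<in> vts u" by (auto simp: vts_def)
  ultimately show ?thesis
    by (simp add: margolis_meakin_def \<eta>_def one_G finite_vts finite_ars)
qed

lemma ars_prefix: "prefix p u \<Longrightarrow> ars p \<subseteq> ars u"
  by (auto simp: prefix_def ars_append)

text \<open>A word spanning a largest possible part of a finite connected subgraph spans all of it: otherwise
  it could be extended by a detour along a further edge.\<close>

lemma carrier_E: "carrier E = range \<eta>"
proof
  show "range \<eta> \<subseteq> carrier E" using \<eta>_closed by blast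
  show "carrier E \<subseteq> range \<eta>"
  proof
    fix x assume x: "x \<in> carrier E"
    obtain \<Gamma> h where xh: "x = (\<Gamma>, h)" by (cases x)
    define V A where "V = verts \<Gamma>" and "A = arcs \<Gamma>"
    have sub: "cayley_subgraph G \<gamma> \<Gamma>" and fin: "finite V" "finite A" and conn: "Digraph_Component.connected \<Gamma>"
      and V: "g [] \<in> V" "h \<in> V"
      using x by (simp_all add: xh margolis_meakin_def V_def A_def one_G)
    have "tail \<Gamma> = tail (cayley G \<gamma>)" "head \<Gamma> = head (cayley G \<gamma>)"
      using sub by (auto simp: cayley_subgraph_def subgraph_def compatible_def)
    then have \<Gamma>: "\<Gamma> = gr V A" by (simp add: V_def A_def gr_def cayley_def)
    have AG: "A \<subseteq> carrier G \<times> UNIV" and VG: "V \<subseteq> carrier G"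
      using sub by (auto simp: cayley_subgraph_def subgraph_def V_def A_def cayley_def)
    have ends: "y \<in> V \<and> y \<otimes>\<^bsub>G\<^esub> g [a] \<in> V" if "(y, a) \<in> A" for y a
    proof -
      have "wf_digraph (gr V A)" using sub \<Gamma> by (simp add: cayley_subgraph_def subgraph_def)
      from wf_digraph.wellformed[OF this, of "(y, a)"] that show ?thesis by simp
    qed
    have inv: "(y \<otimes>\<^bsub>G\<^esub> g [a], letter_inv a) \<in> A" if "(y, a) \<in> A" for y a
    proof -
      from that AG obtain p where "y = g p" by (auto simp: carrier_G)
      moreover have "edge_inv G \<gamma> (y, a) \<in> A" using sub that by (simp add: cayley_subgraph_def A_def)
      ultimately show ?thesis by (simp add: edge_inv_G)
    qed
    let ?P = "\<lambda>u. vts u \<subseteq> V \<and> ars u \<subseteq> A"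
    have "?P []" using V by simp
    moreover have "\<forall>u. ?P u \<longrightarrow> card (ars u) < Suc (card A)" using fin by (auto simp: less_Suc_eq_le intro: card_mono)
    ultimately obtain u where u: "?P u" and max: "\<And>v. ?P v \<Longrightarrow> card (ars v) \<le> card (ars u)"
      using ex_has_greatest_nat[of ?P "[]" "\<lambda>u. card (ars u)" "Suc (card A)"] by blast
    have adj: "(y, a) \<in> ars u" if y: "y \<in> vts u" "(y, a) \<in> A" for y a
    proof (rule ccontr)
      assume na: "(y, a) \<notin> ars u"
      obtain p where p: "y = g p" "prefix p u" using y(1) by (auto simp: vts_def)
      \<comment> \<open>Walk to the edge, cross it, return, and only then follow \<open>u\<close>:
        the detour ends at the root and adds just this edge.\<close>
      let ?v = "((p @ [a]) @ word_inv (p @ [a])) @ u"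
      have "g ((p @ [a]) @ word_inv (p @ [a])) = g []" by (rule g_word_inv)
      then have "ars ?v = ars (p @ [a]) \<union> ars u"
        using transl_cong[of "(p @ [a]) @ word_inv (p @ [a])" "[]" "ars u"] transl_Nil[OF ars_subset]
        by (simp only: ars_append[of _ u] ars_mult_inv)
      then have v: "ars ?v = ars u \<union> {(g p, a), (g (p @ [a]), letter_inv a)}"
        using ars_prefix[OF p(2)] by (auto simp: ars_append[of p] ars_single transl_def)
      then have "?P ?v" using u y(2) inv[OF y(2)] ends V(1) by (auto simp: p vts_ars)
      then have "card (ars ?v) \<le> card (ars u)" by (rule max)
      moreover have "card (insert (g p, a) (ars u)) \<le> card (ars ?v)"
        by (rule card_mono[OF finite_ars]) (use v in blast)
      ultimately have "card (insert (g p, a) (ars u)) \<le> card (ars u)" by simp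
      then show False using na p finite_ars[of u] by simp
    qed
    have reach: "y \<in> vts u" if "(g [], y) \<in> rtrancl_on V (\<Union>(x, a) \<in> A. {(x, x \<otimes>\<^bsub>G\<^esub> g [a]), (x \<otimes>\<^bsub>G\<^esub> g [a], x)})" for y
      using that
    proof (induction rule: rtrancl_on_induct)
      case base
      then show ?case by (auto simp: vts_def)
    next
      case (step y z)
      from step.hyps obtain x a where xa: "(x, a) \<in> A" "(y = x \<and> z = x \<otimes>\<^bsub>G\<^esub> g [a]) \<or> (y = x \<otimes>\<^bsub>G\<^esub> g [a] \<and> z = x)"
        by auto
      obtain p where p: "x = g p" using xa(1) AG by (auto simp: carrier_G)
      from xa(2) show ?case
      proof
        assume "y = x \<and> z = x \<otimes>\<^bsub>G\<^esub> g [a]"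
        moreover from this have "(x, a) \<in> ars u" using adj[of x a] xa(1) step by blast
        ultimately show ?thesis using ars_ends[of x a u] by simp
      next
        assume yz: "y = x \<otimes>\<^bsub>G\<^esub> g [a] \<and> z = x"
        then have "(y, letter_inv a) \<in> ars u" using adj[of y "letter_inv a"] inv[OF xa(1)] step by blast
        then show ?thesis using ars_ends[of y "letter_inv a" u] yz p by simp
      qed
    qed
    have "V \<subseteq> vts u"
    proof
      fix y assume "y \<in> V"
      then have "g [] \<rightarrow>\<^sup>*\<^bsub>mk_symmetric (gr V A)\<^esub> y"
        using conn V(1) unfolding \<Gamma> Digraph_Component.connected_def strongly_connected_def by simp
      then show "y \<in> vts u" using reach unfolding reachable_gr by blast
    qed
    then have uV: "vts u = V" "ars u = A" using u adj ends by auto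
    obtain p where p: "h = g p" "prefix p u" using V(2) uV(1) by (auto simp: vts_def)
    have "g (u @ word_inv u) = g []" by (rule g_word_inv)
    then have "ars ((u @ word_inv u) @ p) = A" "g ((u @ word_inv u) @ p) = h"
      using transl_cong[of "u @ word_inv u" "[]" "ars p"] transl_Nil[OF ars_subset] ars_prefix[OF p(2)] uV p
        g_mult[of "u @ word_inv u" p] g_mult[of "[]" p]
      by (auto simp only: ars_append[of _ p] ars_mult_inv append_Nil)
    then have "\<eta> ((u @ word_inv u) @ p) = x"
      using uV(1) vts_ars[of u] vts_ars[of "(u @ word_inv u) @ p"] uV(2) by (simp add: \<eta>_def xh \<Gamma>)
    then show "x \<in> range \<eta>" by blast
  qed
qed

section \<open>Inverses, natural order and simple paths in the expansion\<close>

lemma monoid_E: "monoid E"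
  by (rule monoidI) (auto simp: carrier_E \<eta>_mult \<eta>_one)

lemma \<eta>_inv: "\<eta> (u @ word_inv u @ u) = \<eta> u"
proof -
  have "g (u @ word_inv u @ u) = g u"
    by (simp add: g_eq_iff) (metis append_Nil2 gpeq_append_left_iff gpeq_word_inv_left)
  moreover have "transl (u @ word_inv u) (ars u) = ars u"
    using transl_cong[OF g_word_inv(2)] transl_Nil[OF ars_subset] by metis
  then have "ars ((u @ word_inv u) @ u) = ars u"
    using ars_append[of "u @ word_inv u" u] ars_mult_inv by simp
  ultimately show ?thesis by (simp add: \<eta>_eq_iff)
qed

lemma inverse_elt_E: "inverse_elt E (\<eta> u) = \<eta> (word_inv u)"
proof -
  have inv: "ars v = transl (word_inv u) (ars u) \<and> g v = g (word_inv u)"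
    if "\<eta> (u @ v @ u) = \<eta> u" "\<eta> (v @ u @ v) = \<eta> v" for v
  proof -
    have "gpeq {w} (u @ v @ u) (u @ [])" using that(1) by (simp add: \<eta>_eq_iff g_eq_iff)
    then have "gpeq {w} (v @ u) (word_inv u @ u)"
      by (metis gpeq.sym gpeq.trans gpeq_append_left_iff gpeq_word_inv_left)
    then have gv: "g v = g (word_inv u)" by (simp add: g_eq_iff)
    have "transl u (ars v) \<subseteq> ars u" using that(1) ars_append[of u "v @ u"] ars_append[of v u]
      by (auto simp: \<eta>_eq_iff transl_def)
    then have "transl (word_inv u) (transl u (ars v)) \<subseteq> transl (word_inv u) (ars u)"
      by (rule transl_mono)
    then have "ars v \<subseteq> transl (word_inv u) (ars u)"
      using transl_transl[OF ars_subset] transl_cong[OF g_word_inv(1)] transl_Nil[OF ars_subset] by metis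
    moreover have "transl v (ars u) \<subseteq> ars v" using that(2) ars_append[of v "u @ v"] ars_append[of u v]
      by (auto simp: \<eta>_eq_iff transl_def)
    ultimately show ?thesis using gv transl_cong[OF gv] by blast
  qed
  show ?thesis unfolding inverse_elt_def
  proof (rule the_equality)
    show *: "\<eta> (word_inv u) \<in> carrier E \<and> \<eta> u \<otimes>\<^bsub>E\<^esub> \<eta> (word_inv u) \<otimes>\<^bsub>E\<^esub> \<eta> u = \<eta> u \<and>
        \<eta> (word_inv u) \<otimes>\<^bsub>E\<^esub> \<eta> u \<otimes>\<^bsub>E\<^esub> \<eta> (word_inv u) = \<eta> (word_inv u)"
      using \<eta>_inv[of u] \<eta>_inv[of "word_inv u"] by (simp add: \<eta>_closed \<eta>_mult)
    fix y assume y: "y \<in> carrier E \<and> \<eta> u \<otimes>\<^bsub>E\<^esub> y \<otimes>\<^bsub>E\<^esub> \<eta> u = \<eta> u \<and> y \<otimes>\<^bsub>E\<^esub> \<eta> u \<otimes>\<^bsub>E\<^esub> y = y"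
    then obtain v where v: "y = \<eta> v" by (auto simp: carrier_E)
    from y * show "y = \<eta> (word_inv u)"
      using inv[of v] inv[of "word_inv u"] by (simp add: v \<eta>_mult \<eta>_eq_iff)
  qed
qed

lemma natural_le_E: "natural_le E (\<eta> u) (\<eta> v) \<longleftrightarrow> ars v \<subseteq> ars u \<and> g u = g v"
proof -
  have "transl (u @ word_inv u) (ars v) = ars v"
    using transl_cong[OF g_word_inv(2)] transl_Nil[OF ars_subset] by metis
  then have "ars ((u @ word_inv u) @ v) = ars u \<union> ars v"
    using ars_append[of "u @ word_inv u" v] ars_mult_inv by simp
  moreover have "g ((u @ word_inv u) @ v) = g v"
    by (metis append_Nil g_mult g_word_inv(2))
  ultimately show ?thesis unfolding natural_le_def inverse_elt_E \<eta>_mult \<eta>_eq_iff by auto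
qed

lemma natural_le_E_sigma:
  assumes "natural_le E (\<eta> u) (\<eta> v)" shows "(\<eta> u, \<eta> v) \<in> min_group_congruence E"
  using assms \<eta>_inv[of u]
  by (intro natural_le_min_group[OF monoid_E]) (simp_all add: \<eta>_closed inverse_elt_E \<eta>_mult)

text \<open>Take a shortest word with the two other properties: a loop between two visits of a
  vertex could be cut out without adding edges or moving the end.\<close>

lemma ex_simple: "\<exists>v. simple v \<and> ars v \<subseteq> ars u \<and> g v = g u"
proof -
  let ?P = "\<lambda>v. ars v \<subseteq> ars u \<and> g v = g u"
  obtain v where v: "?P v" and min: "\<And>z. ?P z \<Longrightarrow> length v \<le> length z"
    using ex_has_least_nat[of ?P u length] by blast
  have False if pq: "prefix p q" "p \<noteq> q" "prefix q v" "g p = g q" for p q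
  proof -
    obtain r where r: "v = q @ r" using pq(3) by (auto simp: prefix_def)
    have "ars (p @ r) \<subseteq> ars v"
      using ars_prefix[OF pq(1)] transl_cong[OF pq(4)] by (auto simp: r ars_append)
    moreover have "g (p @ r) = g v" using pq(4) by (metis g_mult r)
    ultimately have "length v \<le> length (p @ r)" using v min[of "p @ r"] by auto
    then show False using pq(1,2) r by (auto simp: prefix_def)
  qed
  then have "simple v" unfolding simple_def by (metis prefix_same_cases)
  then show ?thesis using v by blast
qed

text \<open>This makes the elements spanned by simple paths maximal in the expansion. For an edge of
  \<open>u\<close>, let \<open>?S\<close> be the vertices up to its start. A path inside the graph
  of \<open>u\<close> with the same end must leave \<open>?S\<close>, and the only arc doing so is
  the given edge.\<close>

lemma simple_minimal:
  assumes u: "simple u" and v: "ars v \<subseteq> ars u" "g v = g u"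
  shows "ars v = ars u"
proof -
  have "(g q, a) \<in> ars v" if qa: "prefix (q @ [a]) u" for q a
  proof -
    let ?S = "{g p |p. prefix p q}"
    have pu: "prefix p u" if "prefix p q" for p using that qa by (meson append_prefixD prefix_order.trans)
    have S: "g p \<in> ?S \<longleftrightarrow> prefix p q" if "prefix p u" for p
      using that u pu unfolding simple_def by blast
    have "\<not> prefix u q" using prefix_order.trans[OF qa, of q] by auto
    then have "g v \<notin> ?S" using S[of u] v(2) by simp
    then have "\<exists>p b. prefix (p @ [b]) v \<and> g p \<in> ?S \<and> g (p @ [b]) \<notin> ?S"
    proof (induction v rule: rev_induct)
      case Nil
      then show ?case by auto
    next
      case (snoc b v)
      show ?case
      proof (cases "g v \<in> ?S")
        case True
        then show ?thesis using snoc.prems by blast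
      next
        case False
        then obtain p c where "prefix (p @ [c]) v" "g p \<in> ?S" "g (p @ [c]) \<notin> ?S"
          using snoc.IH by blast
        then show ?thesis by (intro exI[of _ p] exI[of _ c]) (simp add: prefix_snoc)
      qed
    qed
    then obtain p b where p: "prefix (p @ [b]) v" "g p \<in> ?S" "g (p @ [b]) \<notin> ?S" by blast
    have pb: "(g p, b) \<in> ars v" using p(1) by (auto simp: ars_def)
    with v(1) have "(g p, b) \<in> ars u" by blast
    then consider (fwd) p' where "g p = g p'" "prefix (p' @ [b]) u"
      | (bwd) p' c where "g p = g (p' @ [c])" "b = letter_inv c" "prefix (p' @ [c]) u"
      unfolding ars_def by blast
    then show ?thesis
    proof cases
      case fwd
      then have "prefix p' q" using S[of p'] p(2) by (auto dest: append_prefixD)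
      moreover have "g (p @ [b]) = g (p' @ [b])" using fwd(1) by (metis g_mult)
      then have np: "\<not> prefix (p' @ [b]) q" using S[OF fwd(2)] p(3) by auto
      ultimately obtain r where r: "q = p' @ r" by (auto simp: prefix_def)
      obtain z where z: "u = (p' @ [b]) @ z" using fwd(2) by (auto simp: prefix_def)
      obtain z' where z': "u = (q @ [a]) @ z'" using qa by (auto simp: prefix_def)
      have zz: "u = p' @ b # z" "u = p' @ r @ a # z'" using z z' r by simp_all
      have "r = []" using zz np r by (cases r) auto
      then show ?thesis using zz r pb fwd(1) by simp
    next
      case bwd
      then have "prefix (p' @ [c]) q" using S p(2) by auto
      then have "g p' \<in> ?S" using append_prefixD by blast
      moreover have "g (p @ [b]) = g p'" using bwd(1,2) g_mult[of p "[b]"] g_mult[of "p' @ [c]" "[b]"] by simp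
      ultimately show ?thesis using p(3) by simp
    qed
  qed
  then have "ars u \<subseteq> ars v"
    using ars_inv_closed[of "g _" _ v] unfolding ars_def[of u] by fastforce
  then show ?thesis using v(1) by blast
qed

end

section \<open>Right units\<close>

context inverse_mon
begin

lemma right_unit_prefix:
  assumes [simp]: "x \<in> carrier S" "y \<in> carrier S" and xy: "(x \<otimes> y) \<otimes> star (x \<otimes> y) = \<one>"
  shows "x \<otimes> star x = \<one>"
proof -
  have "x \<otimes> star x \<otimes> ((x \<otimes> y) \<otimes> star (x \<otimes> y)) = (x \<otimes> y) \<otimes> star (x \<otimes> y)"
    by (simp add: star_mult m_assoc)
  then show ?thesis by (simp add: xy)
qed

lemma right_unit_le:
  assumes "x \<in> carrier S" "y \<in> carrier S" "x \<otimes> star x = \<one>" "le x y" shows "x = y"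
  using assms by (simp add: natural_le_def)

lemma right_unit_back:
  assumes [simp]: "m \<in> carrier S" "x \<in> carrier S"
    and m: "m \<otimes> star m = \<one>" and mx: "(m \<otimes> x) \<otimes> star (m \<otimes> x) = \<one>"
  shows "m \<otimes> x \<otimes> star x = m"
proof (rule right_unit_le)
  show "le (m \<otimes> x \<otimes> star x) m"
    using le_mult_idem[of "x \<otimes> star x" m] by (simp add: m_assoc)
  show "m \<otimes> x \<otimes> star x \<otimes> star (m \<otimes> x \<otimes> star x) = \<one>"
    using mx by (simp add: star_mult m_assoc)
qed simp_all

lemma UnitsI:
  assumes "x \<in> carrier S" "x \<otimes> star x = \<one>" "star x \<otimes> x = \<one>" shows "x \<in> Units S"
  using assms by (auto simp: Units_def intro!: bexI[of _ "star x"])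

lemma Units_iff: "x \<in> Units S \<longleftrightarrow> x \<in> carrier S \<and> x \<otimes> star x = \<one> \<and> star x \<otimes> x = \<one>"
  using UnitsI star_Units Units_r_inv Units_l_inv Units_closed by metis

end

primrec prun :: "('x letter \<Rightarrow> 's \<Rightarrow> 's option) \<Rightarrow> 'x letter list \<Rightarrow> 's \<Rightarrow> 's option" where
  "prun \<delta> [] s = Some s"
| "prun \<delta> (a # u) s = (case \<delta> a s of None \<Rightarrow> None | Some s' \<Rightarrow> prun \<delta> u s')"

lemma prun_append: "prun \<delta> (u @ v) s = (case prun \<delta> u s of None \<Rightarrow> None | Some s' \<Rightarrow> prun \<delta> v s')"
  by (induction u arbitrary: s) (auto split: option.split)

context special
begin

text \<open>Letters acting by mutually inverse partial injections satisfy Vagner's relations, since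
  \<open>u @ word_inv u\<close> acts as a partial identity and partial identities commute. If
  \<open>w\<close> moreover fixes every state, this is a model of the monoid.\<close>

lemma prun_cong:
  assumes cl: "\<And>a s s'. s \<in> \<Omega> \<Longrightarrow> \<delta> a s = Some s' \<Longrightarrow> s' \<in> \<Omega>"
    and inv: "\<And>a s s'. s \<in> \<Omega> \<Longrightarrow> \<delta> a s = Some s' \<Longrightarrow> \<delta> (letter_inv a) s' = Some s"
    and W: "\<And>s. s \<in> \<Omega> \<Longrightarrow> prun \<delta> w s = Some s"
    and "e u = e v" "s \<in> \<Omega>"
  shows "prun \<delta> u s = prun \<delta> v s"
proof -
  have cl': "s' \<in> \<Omega>" if "s \<in> \<Omega>" "prun \<delta> u s = Some s'" for u s s'
    using that by (induction u arbitrary: s) (auto split: option.splits dest: cl)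
  have inv': "prun \<delta> (word_inv u) s' = Some s" if "s \<in> \<Omega>" "prun \<delta> u s = Some s'" for u s s'
    using that
  proof (induction u arbitrary: s)
    case (Cons a u)
    then obtain s1 where s1: "\<delta> a s = Some s1" "prun \<delta> u s1 = Some s'" by (auto split: option.splits)
    then have "prun \<delta> (word_inv u) s' = Some s1" using Cons cl by blast
    then show ?case using inv[OF Cons.prems(1) s1(1)] by (simp add: prun_append)
  qed simp
  have idem: "prun \<delta> (u @ word_inv u) s = (if prun \<delta> u s = None then None else Some s)" if "s \<in> \<Omega>" for u s
    using inv'[OF that] by (auto simp: prun_append split: option.split)
  let ?c = "\<lambda>u v. \<forall>s \<in> \<Omega>. prun \<delta> u s = prun \<delta> v s"
  have "(u, v) \<in> {(u, v). ?c u v}"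
  proof (rule special_elt_eqD[OF _ _ _ _ \<open>e u = e v\<close>])
    show "monoid_congruence word_monoid {(u, v). ?c u v}"
    proof (rule word_congruenceI)
      show "?c (u @ v) (u' @ v')" if "?c u u'" "?c v v'" for u u' v v'
        using that cl' by (auto simp: prun_append split: option.split)
    qed auto
    show "(u @ word_inv u @ u, u) \<in> {(u, v). ?c u v}" for u
      using inv' by (auto simp: prun_append split: option.split)
    show "(u @ word_inv u @ v @ word_inv v, v @ word_inv v @ u @ word_inv u) \<in> {(u, v). ?c u v}" for u v
    proof -
      have "prun \<delta> ((u @ word_inv u) @ v @ word_inv v) s =
          (if prun \<delta> u s = None \<or> prun \<delta> v s = None then None else Some s)" if "s \<in> \<Omega>" for u v s
        using that by (subst prun_append) (simp add: idem)
      from this[of _ u v] this[of _ v u] show ?thesis by simp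
    qed
    show "(w, []) \<in> {(u, v). ?c u v}" using W by simp
  qed
  then show ?thesis using \<open>s \<in> \<Omega>\<close> by simp
qed

text \<open>Two copies of the Schuetzenberger graph of \<open>1\<close>, whose vertices are the right units, joined at their
  roots by an edge labelled \<open>b\<close>.\<close>

lemma edge_model:
  assumes b: "e [b] \<otimes>\<^bsub>M\<^esub> star (e [b]) \<noteq> \<one>\<^bsub>M\<^esub>" "star (e [b]) \<otimes>\<^bsub>M\<^esub> e [b] \<noteq> \<one>\<^bsub>M\<^esub>"
    and c: "c \<noteq> b" "e [c] \<otimes>\<^bsub>M\<^esub> star (e [c]) \<noteq> \<one>\<^bsub>M\<^esub>"
  shows "e [b] \<noteq> e (c # v)"
proof
  assume eq: "e [b] = e (c # v)"
  define R where "R = {m \<in> carrier M. m \<otimes>\<^bsub>M\<^esub> star m = \<one>\<^bsub>M\<^esub>}"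
  \<comment> \<open>The edges inside the two copies take precedence; at the roots there is no
    conflict with the joining edge, as neither \<open>b\<close> nor its inverse represents a right
    unit.\<close>
  define \<delta> where "\<delta> a = (\<lambda>(i, m). if m \<otimes>\<^bsub>M\<^esub> e [a] \<in> R then Some (i, m \<otimes>\<^bsub>M\<^esub> e [a])
    else if i = False \<and> m = \<one>\<^bsub>M\<^esub> \<and> a = b then Some (True, \<one>\<^bsub>M\<^esub>)
    else if i = True \<and> m = \<one>\<^bsub>M\<^esub> \<and> a = letter_inv b then Some (False, \<one>\<^bsub>M\<^esub>) else None)" for a
  have one: "\<one>\<^bsub>M\<^esub> \<in> R" using star_idem[of "\<one>\<^bsub>M\<^esub>"] by (simp add: R_def)
  have b': "e [b] \<notin> R" "e [letter_inv b] \<notin> R" and c': "e [c] \<notin> R"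
    using b c star_e[of "[b]"] star_star[of "e [b]"] by (auto simp: R_def)
  have "prun \<delta> [b] (False, \<one>\<^bsub>M\<^esub>) = prun \<delta> (c # v) (False, \<one>\<^bsub>M\<^esub>)"
  proof (rule prun_cong[OF _ _ _ eq, where \<Omega> = "UNIV \<times> R"])
    fix a and s s' :: "bool \<times> 'x mon_elt" assume s: "s \<in> UNIV \<times> R" "\<delta> a s = Some s'"
    obtain i m where im: "s = (i, m)" by (cases s)
    show "s' \<in> UNIV \<times> R" using s one by (auto simp: \<delta>_def split: if_splits)
    have m: "m \<in> R" using s im by simp
    show "\<delta> (letter_inv a) s' = Some s"
    proof (cases "m \<otimes>\<^bsub>M\<^esub> e [a] \<in> R")
      case True
      have "m \<otimes>\<^bsub>M\<^esub> e [a] \<otimes>\<^bsub>M\<^esub> star (e [a]) = m"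
        using m True by (intro right_unit_back) (auto simp: R_def)
      then have "m \<otimes>\<^bsub>M\<^esub> e [a] \<otimes>\<^bsub>M\<^esub> e [letter_inv a] = m" by simp
      then show ?thesis using s(2) True m by (auto simp: im \<delta>_def)
    next
      case False
      then show ?thesis using s(2) b' by (auto simp: im \<delta>_def split: if_splits)
    qed
  next
    have run: "prun \<delta> u (i, m) = Some (i, m \<otimes>\<^bsub>M\<^esub> e u)" if "m \<in> R" "m \<otimes>\<^bsub>M\<^esub> e u \<in> R" for u i m
      using that
    proof (induction u arbitrary: m)
      case Nil
      then show ?case by (simp add: one_M[symmetric] R_def)
    next
      case (Cons a u)
      have m: "m \<in> carrier M" using Cons.prems by (simp add: R_def)
      have eu: "m \<otimes>\<^bsub>M\<^esub> e [a] \<otimes>\<^bsub>M\<^esub> e u = m \<otimes>\<^bsub>M\<^esub> e (a # u)"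
        using m by (simp add: m_assoc e_mult)
      then have "m \<otimes>\<^bsub>M\<^esub> e [a] \<in> R"
        using Cons.prems right_unit_prefix[of "m \<otimes>\<^bsub>M\<^esub> e [a]" "e u"] m by (simp add: R_def)
      then show ?case using Cons.IH[of "m \<otimes>\<^bsub>M\<^esub> e [a]"] Cons.prems eu by (simp add: \<delta>_def)
    qed
    fix s :: "bool \<times> 'x mon_elt" assume "s \<in> UNIV \<times> R"
    moreover have "m \<otimes>\<^bsub>M\<^esub> e w = m" if "m \<in> R" for m
      using that by (simp add: e_relator one_M[symmetric] R_def)
    ultimately show "prun \<delta> w s = Some s" using run by (cases s) auto
  qed (use one in simp)
  moreover have "prun \<delta> [b] (False, \<one>\<^bsub>M\<^esub>) = Some (True, \<one>\<^bsub>M\<^esub>)" using b' by (simp add: \<delta>_def)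
  \<comment> \<open>The letter \<open>c\<close> has no edge at this root: it is not a right unit,
    and the joining edge carries \<open>b\<close>.\<close>
  moreover have "prun \<delta> (c # v) (False, \<one>\<^bsub>M\<^esub>) = None" using c(1) c' by (simp add: \<delta>_def)
  ultimately show False by simp
qed

section \<open>Pieces of a strongly F-inverse monoid\<close>

lemma canonical_\<eta>:
  assumes "canonical_morphism E (margolis_meakin_gen G \<gamma>) M (special_gen w) \<phi>"
  shows "\<phi> (\<eta> u) = e u"
proof -
  have hom: "\<phi> \<in> hom E M" and "\<phi> \<one>\<^bsub>E\<^esub> = \<one>\<^bsub>M\<^esub>"
    and "\<And>x. \<phi> (margolis_meakin_gen G \<gamma> x) = special_gen w x"
    using assms unfolding canonical_morphism_def by blast+
  then have one: "\<phi> (\<eta> []) = e []" and "\<And>x. \<phi> (\<eta> [Pos x]) = special_gen w x"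
    by (simp_all only: \<eta>_one one_M \<eta>_gen)
  then have gen: "\<phi> (\<eta> [Pos x]) = e [Pos x]" for x by (simp add: special_gen_def)
  have mult: "\<phi> (\<eta> (u @ v)) = \<phi> (\<eta> u) \<otimes>\<^bsub>M\<^esub> \<phi> (\<eta> v)" for u v
    using hom_mult[OF hom \<eta>_closed \<eta>_closed] by (simp add: \<eta>_mult)
  have cl: "\<phi> (\<eta> u) \<in> carrier M" for u by (rule hom_in_carrier[OF hom \<eta>_closed])
  have letter: "\<phi> (\<eta> [a]) = e [a]" for a
  proof (cases a)
    case (Neg x)
    have "star (e [Pos x]) = \<phi> (\<eta> [Neg x])"
    proof (rule star_unique)
      show "e [Pos x] \<otimes>\<^bsub>M\<^esub> \<phi> (\<eta> [Neg x]) \<otimes>\<^bsub>M\<^esub> e [Pos x] = e [Pos x]"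
        using \<eta>_inv[of "[Pos x]"] by (simp add: gen[symmetric] mult[symmetric])
      show "\<phi> (\<eta> [Neg x]) \<otimes>\<^bsub>M\<^esub> e [Pos x] \<otimes>\<^bsub>M\<^esub> \<phi> (\<eta> [Neg x]) = \<phi> (\<eta> [Neg x])"
        using \<eta>_inv[of "[Neg x]"] by (simp add: gen[symmetric] mult[symmetric])
    qed (simp_all add: cl)
    then show ?thesis by (simp add: Neg)
  qed (simp add: gen)
  show ?thesis
  proof (induction u)
    case (Cons a u)
    then show ?case using mult[of "[a]" u] letter[of a] e_mult[of "[a]" u] by simp
  qed (simp add: one)
qed

lemma sigma_E_subset: "(x, y) \<in> min_group_congruence E \<Longrightarrow> x \<in> carrier E \<and> y \<in> carrier E"
  using monoid_congruence_min_group[OF monoid_E] by (auto simp: monoid_congruence_def equiv_def)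

text \<open>Simple paths span maximal elements, so both \<open>e u\<close> and \<open>e v\<close>
  are the maximum of the same \<open>\<sigma>\<close>-class.\<close>

lemma strongly_F_inverse_simple:
  assumes S: "strongly_F_inverse M (special_gen w)" and uv: "simple u" "simple v" "g u = g v"
  shows "e u = e v"
proof -
  obtain \<phi> where \<phi>: "canonical_morphism E (margolis_meakin_gen G \<gamma>) M (special_gen w) \<phi>"
    and max: "\<And>C \<Gamma> h. C \<in> carrier E // min_group_congruence E \<Longrightarrow> is_maximal E C (\<Gamma>, h) \<Longrightarrow>
      is_maximum M h (\<phi> (\<Gamma>, h))"
    using S unfolding strongly_F_inverse_def Let_def by blast
  have "is_maximum M (g u) (e u)" if u: "simple u" for u
  proof -
    let ?C = "min_group_congruence E `` {\<eta> u}"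
    have "\<eta> u \<in> ?C"
      using monoid_congruence_min_group[OF monoid_E] \<eta>_closed[of u]
      unfolding monoid_congruence_def by (auto simp: equiv_def refl_on_def)
    moreover have "x = \<eta> u" if x: "x \<in> ?C" "natural_le E (\<eta> u) x" for x
    proof -
      obtain v where v: "x = \<eta> v" using x(1) sigma_E_subset[of "\<eta> u" x] by (auto simp: carrier_E)
      then show ?thesis using x(2) simple_minimal[OF u, of v] by (simp add: natural_le_E \<eta>_eq_iff)
    qed
    ultimately have "is_maximal E ?C (\<eta> u)" unfolding is_maximal_def by blast
    then have "is_maximum M (g u) (\<phi> (\<eta> u))"
      using max[of ?C "gr (vts u) (ars u)" "g u"] \<eta>_closed[of u] by (simp add: quotientI \<eta>_def[symmetric])
    then show ?thesis using canonical_\<eta>[OF \<phi>] by simp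
  qed
  from this[OF uv(1)] this[OF uv(2)] have "le (e u) (e v)" "le (e v) (e u)"
    using uv(3) unfolding is_maximum_def by simp_all
  then show ?thesis by (intro le_antisym e_closed)
qed

text \<open>A class containing \<open>w\<close> when it is cyclically reduced, and closed under
  rotation and inversion. The condition that \<open>w\<close> follows from \<open>r\<close> carries
  triviality modulo \<open>w\<close> to triviality modulo \<open>r\<close>, where Weinbaum's theorem
  applies.\<close>

definition cyclic_conj :: "'x letter list \<Rightarrow> bool" where
  "cyclic_conj r \<longleftrightarrow> reduced (r @ r) \<and> gpeq {r} w []"

lemma cyclic_conj_rotate: "cyclic_conj (u @ v) \<Longrightarrow> cyclic_conj (v @ u)"
proof -
  assume uv: "cyclic_conj (u @ v)"
  have "gpeq {v @ u} (u @ v) []" by (subst gpeq_rotate) (simp add: gpeq.rel)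
  then have "gpeq {v @ u} w []"
    using uv unfolding cyclic_conj_def by (blast intro: gpeq_relators)
  moreover have "reduced ((v @ u) @ v @ u)"
    using uv unfolding cyclic_conj_def by (cases "u = []"; cases "v = []") (auto simp: reduced_append)
  ultimately show ?thesis by (simp add: cyclic_conj_def)
qed

lemma cyclic_conj_word_inv: "cyclic_conj r \<Longrightarrow> cyclic_conj (word_inv r)"
proof -
  assume r: "cyclic_conj r"
  have "gpeq {word_inv r} (word_inv r) []" by (rule gpeq.rel) simp
  then have "gpeq {word_inv r} r []" by (simp only: gpeq_word_inv_Nil_iff)
  then have "gpeq {word_inv r} w []" using r unfolding cyclic_conj_def by (blast intro: gpeq_relators)
  moreover have "reduced (word_inv r @ word_inv r)"
    using r reduced_word_inv[of "r @ r"] by (simp add: cyclic_conj_def)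
  ultimately show ?thesis by (simp add: cyclic_conj_def)
qed

lemma cyclic_conj_nontrivial:
  assumes "cyclic_conj (u @ v)" "u \<noteq> []" "v \<noteq> []" shows "\<not> gpeq {w} u []"
proof
  assume "gpeq {w} u []"
  then have "gpeq {u @ v} u []" using assms(1) unfolding cyclic_conj_def by (blast intro: gpeq_relators)
  then show False using weinbaum[of u v] assms unfolding cyclic_conj_def by simp
qed

text \<open>A repeated vertex cuts out a nonempty proper subword \<open>z\<close> that is trivial in
  the group, and after rotation \<open>z\<close> is a proper prefix of the word.\<close>

lemma cyclic_conj_simple:
  assumes "cyclic_conj (u @ v)" "v \<noteq> []" shows "simple u"
proof -
  have False if pq: "prefix p q" "p \<noteq> q" "prefix q u" "g p = g q" for p q
  proof -
    obtain z where z: "q = p @ z" "z \<noteq> []" using pq(1,2) by (auto simp: prefix_def)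
    obtain r where r: "u = q @ r" using pq(3) by (auto simp: prefix_def)
    have "cyclic_conj (z @ r @ v @ p)"
      using cyclic_conj_rotate[of p "z @ r @ v"] assms(1) by (simp add: r z)
    then have "\<not> gpeq {w} z []" using z assms(2) by (intro cyclic_conj_nontrivial[of z "r @ v @ p"]) auto
    moreover have "gpeq {w} (p @ []) (p @ z)" using pq(4) by (simp add: z g_eq_iff)
    ultimately show False using gpeq.sym gpeq_append_left_iff by blast
  qed
  then show ?thesis unfolding simple_def by (metis prefix_same_cases)
qed

lemma pieces_if_strongly_F_inverse:
  assumes S: "strongly_F_inverse M (special_gen w)" and red: "cyclically_reduced w"
    and ws: "minimal_invertible_pieces w ws" and u: "u \<in> set ws"
  shows "length u \<le> 2"
proof (rule ccontr)
  assume "\<not> length u \<le> 2"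
  then obtain y b z where ybz: "u = y # b # z" "z \<noteq> []"
    by (cases u; cases "tl u"; cases "tl (tl u)") auto
  have Uu: "e u \<in> Units M"
    and pre: "\<And>p. p \<noteq> [] \<Longrightarrow> strict_prefix p u \<Longrightarrow> e p \<notin> Units M"
    and suf: "\<And>p. p \<noteq> [] \<Longrightarrow> strict_suffix p u \<Longrightarrow> e p \<notin> Units M"
    using ws u unfolding minimal_invertible_pieces_def represents_unit_def by blast+
  have ny: "e [y] \<notin> Units M" by (rule pre) (auto simp: ybz strict_prefix_def)
  have nz: "e z \<notin> Units M" using ybz by (intro suf) (auto simp: strict_suffix_def suffix_def)
  obtain ws1 ws2 where "ws = ws1 @ u # ws2" using u by (meson split_list)
  then have w: "w = concat ws1 @ u @ concat ws2" using ws by (auto simp: minimal_invertible_pieces_def)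
  \<comment> \<open>The rest of the relator read cyclically after \<open>b\<close>; its inverse
    \<open>?v\<close> leads to the same vertex as \<open>b\<close>, the other way round the closed
    path.\<close>
  let ?t = "z @ concat ws2 @ concat ws1 @ [y]"
  let ?v = "word_inv ?t"
  have "cyclic_conj w" using red by (simp add: cyclic_conj_def cyclically_reduced_iff gpeq.rel)
  then have conj: "cyclic_conj ([b] @ ?t)"
    using cyclic_conj_rotate[of "concat ws1 @ [y]" "[b] @ z @ concat ws2"] by (simp add: w ybz)
  have "simple [b]" using conj by (rule cyclic_conj_simple) simp
  moreover have "simple ?v"
    using cyclic_conj_word_inv[OF conj] by (intro cyclic_conj_simple[of ?v "[letter_inv b]"]) auto
  moreover have "gpeq {w} ([b] @ ?t) []"
    using gpeq_rotate[of "{w}" "concat ws1 @ [y]" "[b] @ z @ concat ws2"] gpeq.rel[of w "{w}"]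
    by (simp add: w ybz)
  then have "g [b] = g ?v" unfolding g_eq_iff by (subst gpeq_iff_Nil) simp
  ultimately have eb: "e [b] = e ?v" by (rule strongly_F_inverse_simple[OF S])
  \<comment> \<open>As a proper prefix of a unit, \<open>y\<close> is a right unit but not a unit,
    so its inverse is not a right unit; dually, \<open>z\<close> is not a right unit.\<close>
  have "e u = e [y] \<otimes>\<^bsub>M\<^esub> e (b # z)" by (simp add: ybz e_mult)
  then have "e [y] \<otimes>\<^bsub>M\<^esub> star (e [y]) = \<one>\<^bsub>M\<^esub>"
    using Uu right_unit_prefix[of "e [y]" "e (b # z)"] unfolding Units_iff by simp
  then have y: "e [letter_inv y] \<otimes>\<^bsub>M\<^esub> star (e [letter_inv y]) \<noteq> \<one>\<^bsub>M\<^esub>"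
    using ny unfolding Units_iff by simp
  have "star (e u) = star (e z) \<otimes>\<^bsub>M\<^esub> star (e [y, b])" by (simp add: ybz e_mult)
  then have "star (e z) \<otimes>\<^bsub>M\<^esub> star (star (e z)) = \<one>\<^bsub>M\<^esub>"
    using Uu right_unit_prefix[of "star (e z)" "star (e [y, b])"] star_star[OF e_closed, of u] unfolding Units_iff by simp
  then have z: "e z \<otimes>\<^bsub>M\<^esub> star (e z) \<noteq> \<one>\<^bsub>M\<^esub>"
    using nz unfolding Units_iff by simp
  have v: "?v = letter_inv y # word_inv (z @ concat ws2 @ concat ws1)" by simp
  have eyv: "e ?v = e [letter_inv y] \<otimes>\<^bsub>M\<^esub> e (word_inv (z @ concat ws2 @ concat ws1))"
    unfolding v by (simp add: e_mult)
  have ezv: "star (e ?v) = e z \<otimes>\<^bsub>M\<^esub> e (concat ws2 @ concat ws1 @ [y])"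
    by (simp add: e_mult)
  \<comment> \<open>A right unit has only right units as prefixes, but \<open>?v\<close> begins with
    the inverse of \<open>y\<close>, and the inverse of \<open>?v\<close> begins with
    \<open>z\<close>.\<close>
  have "e [b] \<otimes>\<^bsub>M\<^esub> star (e [b]) \<noteq> \<one>\<^bsub>M\<^esub>"
    using y right_unit_prefix[OF e_closed e_closed, of "[letter_inv y]"] unfolding eb eyv by blast
  moreover have "star (e [b]) \<otimes>\<^bsub>M\<^esub> e [b] \<noteq> \<one>\<^bsub>M\<^esub>"
    using z right_unit_prefix[OF e_closed e_closed, of z] ezv star_star[OF e_closed, of ?v] unfolding eb by metis
  moreover have "letter_inv y \<noteq> b"
    using red w ybz by (auto simp: cyclically_reduced_def reduced_append reduced_Cons)
  ultimately show False using edge_model[of b "letter_inv y"] y eb v by metis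
qed

end

context special
begin

section \<open>Normal forms\<close>

definition right_unit :: "'x letter \<Rightarrow> bool" where
  "right_unit a \<longleftrightarrow> e [a] \<otimes>\<^bsub>M\<^esub> star (e [a]) = \<one>\<^bsub>M\<^esub>"

definition right_only :: "'x letter \<Rightarrow> bool" where
  "right_only a \<longleftrightarrow> right_unit a \<and> \<not> right_unit (letter_inv a)"

text \<open>One free generator for each class of right-only letters, up to unit factors on the left.
  The chosen property depends on the class alone, so letters of one class get the same
  \<open>rep\<close>.\<close>

definition rep :: "'x letter \<Rightarrow> 'x letter" where
  "rep a = (SOME c. right_only c \<and> (\<exists>m \<in> Units M. e [a] = m \<otimes>\<^bsub>M\<^esub> e [c]))"

definition coeff :: "'x letter \<Rightarrow> 'x mon_elt" where
  "coeff a = (SOME m. m \<in> Units M \<and> e [a] = m \<otimes>\<^bsub>M\<^esub> e [rep a])"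

lemma unit_letter_iff: "e [a] \<in> Units M \<longleftrightarrow> right_unit a \<and> right_unit (letter_inv a)"
  using star_e[of "[a]"] star_star[of "e [a]"] by (auto simp: Units_iff right_unit_def)

lemma rep:
  assumes "right_only a"
  shows "right_only (rep a)" "coeff a \<in> Units M" "e [a] = coeff a \<otimes>\<^bsub>M\<^esub> e [rep a]"
proof -
  have "\<exists>c. right_only c \<and> (\<exists>m \<in> Units M. e [a] = m \<otimes>\<^bsub>M\<^esub> e [c])"
    using assms by (intro exI[of _ a]) (auto intro!: bexI[of _ "\<one>\<^bsub>M\<^esub>"])
  then have *: "right_only (rep a) \<and> (\<exists>m \<in> Units M. e [a] = m \<otimes>\<^bsub>M\<^esub> e [rep a])"
    unfolding rep_def by (rule someI_ex)
  then have "\<exists>m. m \<in> Units M \<and> e [a] = m \<otimes>\<^bsub>M\<^esub> e [rep a]" by blast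
  then have "coeff a \<in> Units M \<and> e [a] = coeff a \<otimes>\<^bsub>M\<^esub> e [rep a]"
    unfolding coeff_def by (rule someI_ex)
  with * show "right_only (rep a)" "coeff a \<in> Units M" "e [a] = coeff a \<otimes>\<^bsub>M\<^esub> e [rep a]" by blast+
qed

lemma rep_cong:
  assumes m: "m \<in> Units M" and a: "e [a] = m \<otimes>\<^bsub>M\<^esub> e [c]"
  shows "rep a = rep c"
proof -
  have [simp]: "m \<in> carrier M" "inv\<^bsub>M\<^esub> m \<in> carrier M" using m by auto
  have c: "e [c] = inv\<^bsub>M\<^esub> m \<otimes>\<^bsub>M\<^esub> e [a]" using m by (simp add: a m_assoc[symmetric])
  have "(\<exists>k \<in> Units M. e [a] = k \<otimes>\<^bsub>M\<^esub> e [d]) \<longleftrightarrow> (\<exists>k \<in> Units M. e [c] = k \<otimes>\<^bsub>M\<^esub> e [d])" for d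
  proof safe
    fix k assume k: "k \<in> Units M" "e [a] = k \<otimes>\<^bsub>M\<^esub> e [d]"
    then have "e [c] = (inv\<^bsub>M\<^esub> m \<otimes>\<^bsub>M\<^esub> k) \<otimes>\<^bsub>M\<^esub> e [d]" unfolding c using m by (simp add: m_assoc Units_closed)
    then show "\<exists>k \<in> Units M. e [c] = k \<otimes>\<^bsub>M\<^esub> e [d]" using m k by blast
  next
    fix k assume k: "k \<in> Units M" "e [c] = k \<otimes>\<^bsub>M\<^esub> e [d]"
    then have "e [a] = (m \<otimes>\<^bsub>M\<^esub> k) \<otimes>\<^bsub>M\<^esub> e [d]" unfolding a using m by (simp add: m_assoc Units_closed)
    then show "\<exists>k \<in> Units M. e [a] = k \<otimes>\<^bsub>M\<^esub> e [d]" using m k by blast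
  qed
  then show ?thesis by (simp add: rep_def)
qed

text \<open>When all pieces have length at most two, the maximum group image is a free product of the group of
  units with a free group, whose generators are the letters \<open>rep a\<close> and those letters that are neither
  left nor right units. A state \<open>([(h\<^sub>n, t\<^sub>n), \<dots>, (h\<^sub>1, t\<^sub>1)], h)\<close> is the normal form
  \<open>h\<^sub>1 t\<^sub>1 \<dots> h\<^sub>n t\<^sub>n h\<close> with units \<open>h\<^sub>i\<close> and \<open>h\<close>.\<close>

type_synonym 'y normal_form = "('y mon_elt \<times> 'y letter) list \<times> 'y mon_elt"

definition mul :: "'x mon_elt \<Rightarrow> 'x normal_form \<Rightarrow> 'x normal_form" where
  "mul m = (\<lambda>(s, h). (s, h \<otimes>\<^bsub>M\<^esub> m))"

text \<open>The unit in front of \<open>t\<close> is stored with it, leaving 1 as the trailing unit.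
  Generators cancel only when nothing but 1 stands between them.\<close>

fun push :: "'x letter \<Rightarrow> 'x normal_form \<Rightarrow> 'x normal_form" where
  "push t ([], h) = ([(h, t)], \<one>\<^bsub>M\<^esub>)"
| "push t ((h', t') # s, h) =
     (if h = \<one>\<^bsub>M\<^esub> \<and> t' = letter_inv t then (s, h') else ((h, t) # (h', t') # s, \<one>\<^bsub>M\<^esub>))"

text \<open>A right-only letter is its coefficient followed by its generator; the inverse of such a
  letter is read in the opposite order. A letter that is a unit on neither side is its own
  generator.\<close>

definition act :: "'x letter \<Rightarrow> 'x normal_form \<Rightarrow> 'x normal_form" where
  "act a = (if e [a] \<in> Units M then mul (e [a])
     else if right_only a then push (rep a) \<circ> mul (coeff a)
     else if right_only (letter_inv a) then mul (inv\<^bsub>M\<^esub> (coeff (letter_inv a))) \<circ> push (letter_inv (rep (letter_inv a)))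
     else push a)"

fun stack_ok :: "('x mon_elt \<times> 'x letter) list \<Rightarrow> bool" where
  "stack_ok [] \<longleftrightarrow> True"
| "stack_ok [(h, t)] \<longleftrightarrow> h \<in> Units M"
| "stack_ok ((h, t) # (h', t') # s) \<longleftrightarrow>
     h \<in> Units M \<and> \<not> (h = \<one>\<^bsub>M\<^esub> \<and> t' = letter_inv t) \<and> stack_ok ((h', t') # s)"

definition nf :: "'x normal_form set" where
  "nf = {(s, h). stack_ok s \<and> h \<in> Units M}"

fun val :: "'x normal_form \<Rightarrow> 'x mon_elt" where
  "val ([], h) = h"
| "val ((h', t) # s, h) = val (s, h') \<otimes>\<^bsub>M\<^esub> e [t] \<otimes>\<^bsub>M\<^esub> h"

definition state :: "'x letter list \<Rightarrow> 'x normal_form" where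
  "state u = fold act u ([], \<one>\<^bsub>M\<^esub>)"

section \<open>The action on normal forms and their values\<close>

lemma stack_ok_Cons: "stack_ok ((h, t) # s) \<Longrightarrow> h \<in> Units M \<and> stack_ok s"
  by (cases s) auto

lemma mul_nf: "\<omega> \<in> nf \<Longrightarrow> m \<in> Units M \<Longrightarrow> mul m \<omega> \<in> nf"
  by (auto simp: nf_def mul_def)

lemma push_nf: "\<omega> \<in> nf \<Longrightarrow> push t \<omega> \<in> nf"
proof -
  assume "\<omega> \<in> nf"
  then obtain s h where "\<omega> = (s, h)" "stack_ok s" "h \<in> Units M" by (auto simp: nf_def)
  then show ?thesis by (cases s) (auto simp: nf_def dest: stack_ok_Cons)
qed

lemma push_push: "\<omega> \<in> nf \<Longrightarrow> push (letter_inv t) (push t \<omega>) = \<omega>"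
proof -
  assume "\<omega> \<in> nf"
  then obtain s h where \<omega>: "\<omega> = (s, h)" "stack_ok s" "h \<in> Units M" by (auto simp: nf_def)
  show ?thesis
  proof (cases s)
    case (Cons p s')
    obtain h' t' where p: "p = (h', t')" by (cases p)
    show ?thesis using \<omega>(2) by (cases s') (auto simp: \<omega>(1) Cons p)
  qed (simp add: \<omega>)
qed

lemma mul_mul: "\<omega> \<in> nf \<Longrightarrow> m \<in> Units M \<Longrightarrow> k \<in> Units M \<Longrightarrow> mul k (mul m \<omega>) = mul (m \<otimes>\<^bsub>M\<^esub> k) \<omega>"
  by (auto simp: nf_def mul_def m_assoc Units_closed)

lemma mul_one: "\<omega> \<in> nf \<Longrightarrow> mul \<one>\<^bsub>M\<^esub> \<omega> = \<omega>"
  by (auto simp: nf_def mul_def Units_closed)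

lemma act_nf: "\<omega> \<in> nf \<Longrightarrow> act a \<omega> \<in> nf"
  using rep[of a] rep[of "letter_inv a"] by (auto simp: act_def mul_nf push_nf)

lemma act_act: assumes "\<omega> \<in> nf" shows "act (letter_inv a) (act a \<omega>) = \<omega>"
proof -
  have inv: "mul (inv\<^bsub>M\<^esub> m) (mul m \<omega>) = \<omega>" "mul m (mul (inv\<^bsub>M\<^esub> m) \<omega>) = \<omega>" if "m \<in> Units M" "\<omega> \<in> nf" for m \<omega>
    using that by (simp_all add: mul_mul mul_one)
  have unit: "e [letter_inv a] \<in> Units M \<longleftrightarrow> e [a] \<in> Units M" by (auto simp: unit_letter_iff)
  have no: "\<not> (right_only a \<and> right_only (letter_inv a))" "right_only a \<Longrightarrow> e [a] \<notin> Units M"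
    by (auto simp: right_only_def unit_letter_iff)
  consider "e [a] \<in> Units M" | "right_only a" | "right_only (letter_inv a)" "e [a] \<notin> Units M"
    | "e [a] \<notin> Units M" "\<not> right_only a" "\<not> right_only (letter_inv a)" by blast
  then show ?thesis
  proof cases
    case 1
    then have "e [letter_inv a] = inv\<^bsub>M\<^esub> (e [a])"
      using star_Units[OF 1] star_e[of "[a]"] by (simp del: star_e)
    then show ?thesis using 1 unit inv assms by (simp add: act_def)
  next
    case 2
    then show ?thesis using rep[OF 2] no unit assms by (simp add: act_def push_push mul_nf inv)
  next
    case 3
    then show ?thesis using rep[OF 3(1)] no unit assms push_push[of \<omega> "letter_inv (rep (letter_inv a))"]
      by (auto simp: act_def push_nf inv)
  next
    case 4
    then show ?thesis using unit assms by (simp add: act_def push_push)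
  qed
qed

lemma fold_act_nf: "\<omega> \<in> nf \<Longrightarrow> fold act u \<omega> \<in> nf"
  by (induction u arbitrary: \<omega>) (simp_all add: act_nf)

lemma one_nf: "([], \<one>\<^bsub>M\<^esub>) \<in> nf"
  by (simp add: nf_def)

lemma state_nf: "state u \<in> nf"
  by (simp add: state_def fold_act_nf one_nf)

lemma state_snoc: "state (u @ [a]) = act a (state u)"
  by (simp add: state_def)

lemma val_closed [simp]: "\<omega> \<in> nf \<Longrightarrow> val \<omega> \<in> carrier M"
  by (induction \<omega> rule: val.induct) (auto simp: nf_def Units_closed dest: stack_ok_Cons)

lemma val_mul: "\<omega> \<in> nf \<Longrightarrow> m \<in> Units M \<Longrightarrow> val (mul m \<omega>) = val \<omega> \<otimes>\<^bsub>M\<^esub> m"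
proof -
  assume "\<omega> \<in> nf" and m: "m \<in> Units M"
  then obtain s h where \<omega>: "\<omega> = (s, h)" "stack_ok s" "h \<in> Units M" by (auto simp: nf_def)
  show ?thesis
  proof (cases s)
    case (Cons p s')
    obtain h' t' where p: "p = (h', t')" by (cases p)
    have "(s', h') \<in> nf" using \<omega>(2) stack_ok_Cons[of h' t' s'] by (simp add: Cons p nf_def)
    then show ?thesis using \<omega>(3) m by (simp add: \<omega>(1) Cons p mul_def m_assoc Units_closed)
  qed (simp add: \<omega> mul_def)
qed

lemma push_cases:
  obtains (push) s h where "\<omega> = (s, h)" "push t \<omega> = ((h, t) # s, \<one>\<^bsub>M\<^esub>)"
  | (pop) s' h' where "\<omega> = ((h', letter_inv t) # s', \<one>\<^bsub>M\<^esub>)" "push t \<omega> = (s', h')"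
proof -
  obtain s h where \<omega>: "\<omega> = (s, h)" by (cases \<omega>)
  show ?thesis
  proof (cases s)
    case Nil
    then show ?thesis using push \<omega> by simp
  next
    case (Cons p s')
    obtain h' t' where p: "p = (h', t')" by (cases p)
    show ?thesis
      using push[of s h] pop[of h' s'] by (cases "h = \<one>\<^bsub>M\<^esub> \<and> t' = letter_inv t") (auto simp: \<omega> Cons p)
  qed
qed

text \<open>Only cancelling \<open>t\<^sup>-\<^sup>1 t\<close> for a letter \<open>t\<close> that is not a left unit loses information.\<close>

lemma val_push:
  assumes "\<omega> \<in> nf"
  shows "le (val \<omega> \<otimes>\<^bsub>M\<^esub> e [t]) (val (push t \<omega>))"
    and "right_unit (letter_inv t) \<or> (\<forall>h' s'. \<omega> \<noteq> ((h', letter_inv t) # s', \<one>\<^bsub>M\<^esub>)) \<Longrightarrow>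
      val \<omega> \<otimes>\<^bsub>M\<^esub> e [t] = val (push t \<omega>)"
proof -
  have "le (val \<omega> \<otimes>\<^bsub>M\<^esub> e [t]) (val (push t \<omega>)) \<and>
    (right_unit (letter_inv t) \<or> (\<forall>h' s'. \<omega> \<noteq> ((h', letter_inv t) # s', \<one>\<^bsub>M\<^esub>)) \<longrightarrow>
      val \<omega> \<otimes>\<^bsub>M\<^esub> e [t] = val (push t \<omega>))"
  proof (cases \<omega> t rule: push_cases)
    case (push s h)
    have eq: "val \<omega> \<otimes>\<^bsub>M\<^esub> e [t] = val (push t \<omega>)"
      using val_closed[OF assms] push by simp
    have "le (val \<omega> \<otimes>\<^bsub>M\<^esub> e [t]) (val (push t \<omega>))"
      unfolding eq by (rule le_refl) (simp add: push_nf assms)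
    with eq show ?thesis by blast
  next
    case (pop s' h')
    have "stack_ok ((h', letter_inv t) # s')" using assms pop(1) by (simp add: nf_def)
    then have nf: "(s', h') \<in> nf" using stack_ok_Cons[of h' "letter_inv t" s'] by (simp add: nf_def)
    have inv: "e [letter_inv t] = star (e [t])" by simp
    have "val \<omega> \<otimes>\<^bsub>M\<^esub> e [t] = val (s', h') \<otimes>\<^bsub>M\<^esub> (star (e [t]) \<otimes>\<^bsub>M\<^esub> e [t])"
      unfolding pop(1) val.simps inv using nf by (simp add: m_assoc del: star_e)
    moreover have "le (val (s', h') \<otimes>\<^bsub>M\<^esub> (star (e [t]) \<otimes>\<^bsub>M\<^esub> e [t])) (val (s', h'))"
      using nf by (intro le_mult_idem) (simp_all add: m_assoc del: star_e)
    moreover have "star (e [t]) \<otimes>\<^bsub>M\<^esub> e [t] = \<one>\<^bsub>M\<^esub>" if "right_unit (letter_inv t)"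
      using that star_star[of "e [t]"] by (simp add: right_unit_def)
    ultimately show ?thesis using pop nf by (simp del: star_e)
  qed
  then show "le (val \<omega> \<otimes>\<^bsub>M\<^esub> e [t]) (val (push t \<omega>))"
    "right_unit (letter_inv t) \<or> (\<forall>h' s'. \<omega> \<noteq> ((h', letter_inv t) # s', \<one>\<^bsub>M\<^esub>)) \<Longrightarrow>
      val \<omega> \<otimes>\<^bsub>M\<^esub> e [t] = val (push t \<omega>)" by blast+
qed

lemma right_only_inv:
  assumes "right_only (letter_inv a)"
  shows "e [a] = e [letter_inv (rep (letter_inv a))] \<otimes>\<^bsub>M\<^esub> inv\<^bsub>M\<^esub> (coeff (letter_inv a))"
proof -
  let ?c = "letter_inv a"
  note r = rep[OF assms]
  have "e [a] = star (e [?c])" by simp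
  also have "\<dots> = star (e [rep ?c]) \<otimes>\<^bsub>M\<^esub> star (coeff ?c)"
    unfolding r(3) using r(2) by (intro star_mult) (simp_all add: Units_closed)
  finally show ?thesis using star_Units[OF r(2)] by simp
qed

lemma val_act_le:
  assumes "\<omega> \<in> nf" shows "le (val \<omega> \<otimes>\<^bsub>M\<^esub> e [a]) (val (act a \<omega>))"
proof -
  consider "e [a] \<in> Units M" | "right_only a" "e [a] \<notin> Units M"
    | "right_only (letter_inv a)" "\<not> right_only a" "e [a] \<notin> Units M"
    | "e [a] \<notin> Units M" "\<not> right_only a" "\<not> right_only (letter_inv a)" by blast
  then show ?thesis
  proof cases
    case 1
    then show ?thesis using assms by (simp add: act_def val_mul le_refl)
  next
    case 2
    note r = rep[OF 2(1)]
    have "val \<omega> \<otimes>\<^bsub>M\<^esub> e [a] = val (mul (coeff a) \<omega>) \<otimes>\<^bsub>M\<^esub> e [rep a]"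
      using assms r(2) unfolding r(3) by (simp add: val_mul m_assoc Units_closed)
    then show ?thesis using 2 val_push(1)[OF mul_nf[OF assms r(2)]] by (simp add: act_def)
  next
    case 3
    note r = rep[OF 3(1)]
    let ?k = "inv\<^bsub>M\<^esub> (coeff (letter_inv a))" and ?t = "letter_inv (rep (letter_inv a))"
    have k: "?k \<in> Units M" using r(2) by simp
    have "val \<omega> \<otimes>\<^bsub>M\<^esub> e [a] = val \<omega> \<otimes>\<^bsub>M\<^esub> e [?t] \<otimes>\<^bsub>M\<^esub> ?k"
      unfolding right_only_inv[OF 3(1)] using assms k by (simp add: m_assoc Units_closed)
    moreover have "le (val \<omega> \<otimes>\<^bsub>M\<^esub> e [?t] \<otimes>\<^bsub>M\<^esub> ?k) (val (push ?t \<omega>) \<otimes>\<^bsub>M\<^esub> ?k)"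
      using assms k by (intro le_mult_right val_push) (simp_all add: push_nf Units_closed)
    ultimately show ?thesis using 3 assms k by (simp add: act_def val_mul push_nf)
  next
    case 4
    then show ?thesis using val_push(1)[OF assms] by (simp add: act_def)
  qed
qed

text \<open>Reading a letter changes the value as in the monoid, except that a cancellation may drop
  an idempotent; so the value can only grow.\<close>

lemma e_le_val: "le (e u) (val (state u))"
proof (induction u rule: rev_induct)
  case Nil
  then show ?case by (simp add: state_def one_M[symmetric] le_refl)
next
  case (snoc a u)
  have le: "le (e u \<otimes>\<^bsub>M\<^esub> e [a]) (val (state u) \<otimes>\<^bsub>M\<^esub> e [a])"
    using snoc by (intro le_mult_right) (simp_all add: state_nf)
  have "le (e u \<otimes>\<^bsub>M\<^esub> e [a]) (val (act a (state u)))"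
    by (rule le_trans[OF _ _ _ le val_act_le[OF state_nf]]) (simp_all add: state_nf act_nf)
  then show ?case by (simp add: e_mult state_snoc)
qed

section \<open>Simple paths attain the bound\<close>

lemma natural_le_sigma: "x \<in> carrier M \<Longrightarrow> y \<in> carrier M \<Longrightarrow> le x y \<Longrightarrow> (x, y) \<in> \<sigma>"
  by (intro natural_le_min_group[OF monoid_axioms]) (simp_all add: m_assoc)

lemma state_eq_imp: assumes "state u = state v" shows "g u = g v"
proof -
  obtain z where z: "val (state u) = e z" using val_closed[OF state_nf, of u] by (auto simp: carrier_M)
  have "(e u, e z) \<in> \<sigma>" "(e v, e z) \<in> \<sigma>"
    using e_le_val[of u] e_le_val[of v] assms z by (auto intro!: natural_le_sigma)
  then have "g u = g z" "g v = g z" by (simp_all only: sigma_iff g_eq_iff)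
  then show ?thesis by simp
qed

text \<open>For each stacked generator \<open>t\<close> that is not a right unit, the state just
  below it is that of a prefix. Right units are exempt because \<open>act\<close> pushes them only
  after multiplying by a coefficient, possibly at a state that no prefix has.\<close>

definition visited :: "'x letter list \<Rightarrow> ('x mon_elt \<times> 'x letter) list \<Rightarrow> bool" where
  "visited u s \<longleftrightarrow> (\<forall>s1 h t s'. s = s1 @ (h, t) # s' \<longrightarrow> \<not> right_unit t \<longrightarrow> (\<exists>p. prefix p u \<and> state p = (s', h)))"

lemma visited_snoc: "visited u s \<Longrightarrow> visited (u @ [a]) s"
  unfolding visited_def prefix_snoc by blast

lemma visited_Cons:
  "visited u ((h, t) # s) \<longleftrightarrow> (\<not> right_unit t \<longrightarrow> (\<exists>p. prefix p u \<and> state p = (s, h))) \<and> visited u s"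
  unfolding visited_def
  by (auto simp: Cons_eq_append_conv)

lemma fst_mul [simp]: "fst (mul m \<omega>) = fst \<omega>"
  by (simp add: mul_def case_prod_beta)

lemma visited_push:
  assumes "visited u (fst \<omega>)" "right_unit t \<or> (\<exists>p. prefix p u \<and> state p = \<omega>)"
  shows "visited u (fst (push t \<omega>))"
  using assms by (cases \<omega> t rule: push_cases) (auto simp: visited_Cons)

lemma visited_state: "visited u (fst (state u))"
proof (induction u rule: rev_induct)
  case Nil
  then show ?case by (simp add: state_def visited_def)
next
  case (snoc a u)
  then have IH: "visited (u @ [a]) (fst (state u))" by (rule visited_snoc)
  have u: "\<exists>p. prefix p (u @ [a]) \<and> state p = state u" by (intro exI[of _ u]) simp
  show ?case
    unfolding state_snoc act_def using IH u rep(1)[of a] by (auto simp: right_only_def intro!: visited_push)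
qed

lemma simple_state:
  assumes "simple u" shows "e u = val (state u)"
proof -
  have "e v = val (state v)" if "prefix v u" for v
    using that
  proof (induction v rule: rev_induct)
    case Nil
    then show ?case by (simp add: state_def one_M[symmetric])
  next
    case (snoc a v)
    have v: "prefix v u" using snoc.prems by (rule append_prefixD)
    have new: "state p \<noteq> act a (state v)" if "prefix p v" for p
    proof
      assume "state p = act a (state v)"
      then have "g p = g (v @ [a])" by (intro state_eq_imp) (simp add: state_snoc)
      moreover have "prefix p u" using that v by (rule prefix_order.trans)
      ultimately have "p = v @ [a]" using assms snoc.prems unfolding simple_def by blast
      then show False using that by simp
    qed
    \<comment> \<open>A lossy cancellation would return to a state recorded by
      \<open>visited\<close>, that is, to the vertex of an earlier prefix. Here
      \<open>\<omega>\<close> may differ from \<open>state v\<close> in the trailing unit, since a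
      coefficient may have been multiplied before the push.\<close>
    have lossless: "\<omega> \<noteq> ((h', letter_inv t) # s', \<one>\<^bsub>M\<^esub>)"
      if lossy: "\<not> right_unit (letter_inv t)" and fst_eq: "fst \<omega> = fst (state v)" and act_eq: "push t \<omega> = act a (state v)" for t \<omega> h' s'
    proof
      assume \<omega>: "\<omega> = ((h', letter_inv t) # s', \<one>\<^bsub>M\<^esub>)"
      then have "visited v ((h', letter_inv t) # s')" using visited_state[of v] fst_eq by simp
      then obtain p where "prefix p v" "state p = (s', h')" using lossy by (auto simp: visited_Cons)
      then show False using new[of p] act_eq \<omega> by simp
    qed
    let ?\<omega> = "state v"
    have IH: "e (v @ [a]) = val ?\<omega> \<otimes>\<^bsub>M\<^esub> e [a]" using snoc.IH[OF v] by (simp add: e_mult[symmetric])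
    consider "e [a] \<in> Units M" | "right_only a" "e [a] \<notin> Units M"
      | "right_only (letter_inv a)" "\<not> right_only a" "e [a] \<notin> Units M"
      | "e [a] \<notin> Units M" "\<not> right_only a" "\<not> right_only (letter_inv a)" by blast
    then have "val ?\<omega> \<otimes>\<^bsub>M\<^esub> e [a] = val (act a ?\<omega>)"
    proof cases
      case 1
      then show ?thesis by (simp add: act_def val_mul state_nf)
    next
      case 2
      note r = rep[OF 2(1)]
      let ?\<omega>' = "mul (coeff a) ?\<omega>"
      have act: "act a ?\<omega> = push (rep a) ?\<omega>'" using 2 by (simp add: act_def)
      have "val ?\<omega> \<otimes>\<^bsub>M\<^esub> e [a] = val ?\<omega>' \<otimes>\<^bsub>M\<^esub> e [rep a]"
        using r(2) unfolding r(3) by (simp add: val_mul m_assoc Units_closed state_nf)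
      also have "\<dots> = val (push (rep a) ?\<omega>')"
        using lossless[of "rep a" ?\<omega>'] act by (intro val_push(2)) (auto simp: mul_nf state_nf r)
      finally show ?thesis by (simp add: act)
    next
      case 3
      note r = rep[OF 3(1)]
      let ?k = "inv\<^bsub>M\<^esub> (coeff (letter_inv a))" and ?t = "letter_inv (rep (letter_inv a))"
      have k: "?k \<in> Units M" using r(2) by simp
      have "val ?\<omega> \<otimes>\<^bsub>M\<^esub> e [a] = val ?\<omega> \<otimes>\<^bsub>M\<^esub> e [?t] \<otimes>\<^bsub>M\<^esub> ?k"
        unfolding right_only_inv[OF 3(1)] using k by (simp add: m_assoc Units_closed state_nf)
      \<comment> \<open>The only letter that can be cancelled here is
        \<open>rep (letter_inv a)\<close>, a right unit, so no information is lost.\<close>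
      also have "val ?\<omega> \<otimes>\<^bsub>M\<^esub> e [?t] = val (push ?t ?\<omega>)"
        using r(1) by (intro val_push(2)) (simp_all add: state_nf right_only_def)
      finally show ?thesis using 3 k by (simp add: act_def val_mul push_nf state_nf)
    next
      case 4
      then have act: "act a ?\<omega> = push a ?\<omega>" by (simp add: act_def)
      show ?thesis unfolding act
        using lossless[of a ?\<omega>] act by (intro val_push(2)) (auto simp: state_nf)
    qed
    then show ?case using IH by (simp add: state_snoc)
  qed
  then show ?thesis by simp
qed

section \<open>Pieces of length at most two\<close>

text \<open>A piece of length two is \<open>a\<close> followed by the inverse of \<open>c\<close>.
  Minimality leaves \<open>a\<close> and \<open>c\<close> right units but not units, and the unit
  \<open>m\<close> of the piece satisfies \<open>m \<otimes> e [c] = e [a]\<close>, so they share a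
  generator. It is pushed and popped at once, leaving \<open>coeff a\<close> times the inverse of
  \<open>coeff c\<close>, which is \<open>m\<close>.\<close>

lemma fold_act_piece:
  assumes u: "e u \<in> Units M" "u \<noteq> []" "length u \<le> 2" and \<omega>: "\<omega> \<in> nf"
    and pre: "\<And>p. p \<noteq> [] \<Longrightarrow> strict_prefix p u \<Longrightarrow> e p \<notin> Units M"
    and suf: "\<And>p. p \<noteq> [] \<Longrightarrow> strict_suffix p u \<Longrightarrow> e p \<notin> Units M"
  shows "fold act u \<omega> = mul (e u) \<omega>"
proof -
  consider a where "u = [a]" | a b where "u = [a, b]"
    using u(2,3) by (cases u; cases "tl u"; cases "tl (tl u)") auto
  then show ?thesis
  proof cases
    case 1
    then show ?thesis using u(1) by (simp add: act_def)
  next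
    case (2 a b)
    define c where "c = letter_inv b"
    have b: "b = letter_inv c" by (simp add: c_def)
    have na: "e [a] \<notin> Units M" by (rule pre) (auto simp: 2 strict_prefix_def)
    have nb: "e [b] \<notin> Units M" by (rule suf) (auto simp: 2 strict_suffix_def suffix_def)
    define m where "m = e u"
    have mU: "m \<in> Units M" using u(1) by (simp add: m_def)
    have m: "m = e [a] \<otimes>\<^bsub>M\<^esub> star (e [c])" by (simp add: m_def 2 c_def e_mult)
    have "right_unit a"
      using mU right_unit_prefix[of "e [a]" "star (e [c])"] by (auto simp: m Units_iff right_unit_def)
    then have a: "right_only a" using na by (simp add: right_only_def unit_letter_iff)
    have "star m = e [c] \<otimes>\<^bsub>M\<^esub> star (e [a])"
      unfolding m by (simp add: star_mult del: star_e)
    then have "right_unit c"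
      using mU right_unit_prefix[of "e [c]" "star (e [a])"] star_star[of m]
      by (simp add: Units_iff right_unit_def del: star_e)
    then have c: "right_only c" using nb by (simp add: right_only_def unit_letter_iff b)
    have "m \<otimes>\<^bsub>M\<^esub> e [c] = e [a]"
    proof (rule right_unit_le)
      have "m \<otimes>\<^bsub>M\<^esub> e [c] = e [a] \<otimes>\<^bsub>M\<^esub> (star (e [c]) \<otimes>\<^bsub>M\<^esub> e [c])"
        unfolding m by (simp add: m_assoc del: star_e)
      then show "le (m \<otimes>\<^bsub>M\<^esub> e [c]) (e [a])"
        using le_mult_idem[of "star (e [c]) \<otimes>\<^bsub>M\<^esub> e [c]" "e [a]"] by (simp add: m_assoc del: star_e)
      have "m \<otimes>\<^bsub>M\<^esub> e [c] \<otimes>\<^bsub>M\<^esub> star (m \<otimes>\<^bsub>M\<^esub> e [c]) = m \<otimes>\<^bsub>M\<^esub> (e [c] \<otimes>\<^bsub>M\<^esub> star (e [c])) \<otimes>\<^bsub>M\<^esub> star m"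
        using mU by (simp add: star_mult m_assoc Units_closed del: star_e)
      then show "m \<otimes>\<^bsub>M\<^esub> e [c] \<otimes>\<^bsub>M\<^esub> star (m \<otimes>\<^bsub>M\<^esub> e [c]) = \<one>\<^bsub>M\<^esub>"
        using mU c by (simp add: right_only_def right_unit_def Units_iff del: star_e)
    qed (use mU in \<open>simp_all add: Units_closed\<close>)
    then have rep_eq: "rep a = rep c" using rep_cong[OF mU] by simp
    note ra = rep[OF a] and rc = rep[OF c]
    have "m = coeff a \<otimes>\<^bsub>M\<^esub> (e [rep c] \<otimes>\<^bsub>M\<^esub> star (e [rep c])) \<otimes>\<^bsub>M\<^esub> star (coeff c)"
      unfolding m ra(3) rc(3) rep_eq using ra(2) rc(2)
      by (simp add: star_mult m_assoc Units_closed del: star_e)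
    also have "\<dots> = coeff a \<otimes>\<^bsub>M\<^esub> inv\<^bsub>M\<^esub> (coeff c)"
      using rc(1,2) ra(2) star_Units[OF rc(2)]
      by (simp add: right_only_def right_unit_def Units_closed del: star_e)
    finally have m': "m = coeff a \<otimes>\<^bsub>M\<^esub> inv\<^bsub>M\<^esub> (coeff c)" .
    have "\<not> right_only b" using c by (auto simp: right_only_def b)
    then have "fold act u \<omega> = mul (inv\<^bsub>M\<^esub> (coeff c)) (push (letter_inv (rep c)) (push (rep c) (mul (coeff a) \<omega>)))"
      using a c na nb by (simp add: 2 act_def rep_eq b)
    also have "\<dots> = mul m \<omega>"
      using \<omega> ra(2) rc(2) by (simp add: push_push mul_nf mul_mul m')
    finally show ?thesis by (simp add: m_def)
  qed
qed

lemma fold_act_relator: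
  assumes ws: "minimal_invertible_pieces w ws" "\<forall>u \<in> set ws. length u \<le> 2" and \<omega>: "\<omega> \<in> nf"
  shows "fold act w \<omega> = \<omega>"
proof -
  have "e (concat vs) \<in> Units M \<and> fold act (concat vs) \<omega> = mul (e (concat vs)) \<omega>"
    if "set vs \<subseteq> set ws" "\<omega> \<in> nf" for vs \<omega>
    using that
  proof (induction vs arbitrary: \<omega>)
    case Nil
    then show ?case by (simp add: one_M[symmetric] mul_one)
  next
    case (Cons u vs)
    have u: "e u \<in> Units M" "u \<noteq> []" "length u \<le> 2"
      and pre: "\<And>p. p \<noteq> [] \<Longrightarrow> strict_prefix p u \<Longrightarrow> e p \<notin> Units M"
      and suf: "\<And>p. p \<noteq> [] \<Longrightarrow> strict_suffix p u \<Longrightarrow> e p \<notin> Units M"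
      using ws Cons.prems(1) unfolding minimal_invertible_pieces_def represents_unit_def by auto
    have "fold act u \<omega> = mul (e u) \<omega>" by (rule fold_act_piece[OF u Cons.prems(2) pre suf])
    moreover have "mul (e u) \<omega> \<in> nf" using Cons.prems(2) u(1) by (rule mul_nf)
    ultimately show ?case
      using Cons u(1) by (simp add: e_mult[symmetric] mul_mul)
  qed
  from this[of ws \<omega>] show ?thesis
    using ws(1) \<omega> by (simp add: minimal_invertible_pieces_def e_relator one_M[symmetric] mul_one)
qed

section \<open>From short pieces to strong F-inverseness\<close>

context
  fixes ws
  assumes ws: "minimal_invertible_pieces w ws" "\<forall>u \<in> set ws. length u \<le> 2"
begin

lemma state_cong: "g u = g v \<Longrightarrow> state u = state v"
  unfolding state_def g_eq_iff
  by (erule gpeq_action[where \<Omega> = nf]) (auto simp: act_nf act_act fold_act_relator[OF ws] one_nf)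

lemma simple_max: "simple v \<Longrightarrow> g u = g v \<Longrightarrow> le (e u) (e v)"
  using e_le_val[of u] simple_state[of v] state_cong[of u v] by simp

lemma simple_is_maximum:
  assumes "simple v" shows "is_maximum M (g v) (e v)"
  unfolding is_maximum_def
proof (intro conjI ballI)
  show "e v \<in> g v" by (simp add: e_mem_g)
  fix x assume x: "x \<in> g v"
  then obtain u where u: "x = e u" using g_subset[OF x] by (auto simp: carrier_M)
  then show "natural_le M x (e v)" using x simple_max[OF assms, of u] by (simp add: e_mem_g)
qed

lemma F_inverse_M: "F_inverse M"
  unfolding F_inverse_def
proof (intro conjI ballI)
  show "inverse_monoid M" using inverse_mon_M by (simp add: inverse_mon_iff)
  fix C assume "C \<in> carrier M // \<sigma>"
  then obtain u where C: "C = g u" by (auto simp: quotient_def carrier_M g_def)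
  obtain v where "simple v" "g v = g u" using ex_simple by blast
  then show "\<exists>m. is_maximum M C m" using simple_is_maximum[of v] C by auto
qed

lemma X_generated_M: "X_generated M (special_gen w)"
proof -
  let ?I = "inverse_submonoid_generated M (range (special_gen w))"
  have "?I \<subseteq> carrier M"
  proof
    fix x assume "x \<in> ?I"
    then show "x \<in> carrier M" by induction (auto simp: special_gen_def)
  qed
  moreover have "e u \<in> ?I" for u
  proof (induction u)
    case Nil
    then show ?case by (metis inverse_submonoid_generated.one one_M)
  next
    case (Cons a u)
    have pos: "e [Pos x] \<in> ?I" for x
      using inverse_submonoid_generated.incl[OF rangeI, of "special_gen w" x M] by (simp add: special_gen_def)
    have "e [a] \<in> ?I"
    proof (cases a)
      case (Neg x)
      then show ?thesis using inverse_submonoid_generated.inv[OF pos[of x]] by simp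
    qed (simp add: pos)
    from inverse_submonoid_generated.mult[OF this Cons] show ?case by (simp add: e_mult)
  qed
  ultimately show ?thesis by (auto simp: X_generated_def carrier_M special_gen_def)
qed

text \<open>Well-definedness of the canonical morphism. If the path of \<open>p\<close> stays in the
  graph of \<open>u\<close>, then \<open>F u \<otimes> F p = F u\<close>; among such words
  \<open>F u \<otimes> e p\<close> depends only on the end vertex, because each lies below the
  maximum of its class, given by a simple path.\<close>

lemma \<eta>_determines_e: assumes "\<eta> u = \<eta> v" shows "e u = e v"
proof -
  define F where "F u = e u \<otimes>\<^bsub>M\<^esub> star (e u)" for u
  have F [simp]: "F u \<in> carrier M" "F u \<otimes>\<^bsub>M\<^esub> F u = F u" for u
    unfolding F_def by (simp_all del: star_e)
  have comm: "F u \<otimes>\<^bsub>M\<^esub> F v = F v \<otimes>\<^bsub>M\<^esub> F u" for u v by (rule idem_commute) simp_all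
  have Fmax: "F u \<otimes>\<^bsub>M\<^esub> e p = F u \<otimes>\<^bsub>M\<^esub> e q" if "F u \<otimes>\<^bsub>M\<^esub> F p = F u" "F u \<otimes>\<^bsub>M\<^esub> F q = F u" "g p = g q" for u p q
  proof -
    obtain v where v: "simple v" "g v = g p" using ex_simple by blast
    have "F u \<otimes>\<^bsub>M\<^esub> e z = F u \<otimes>\<^bsub>M\<^esub> e v" if z: "F u \<otimes>\<^bsub>M\<^esub> F z = F u" "g z = g v" for z
    proof -
      have "e z = F z \<otimes>\<^bsub>M\<^esub> e v" using simple_max[OF v(1) z(2)] by (simp add: natural_le_def F_def)
      then have "F u \<otimes>\<^bsub>M\<^esub> e z = (F u \<otimes>\<^bsub>M\<^esub> F z) \<otimes>\<^bsub>M\<^esub> e v" by (simp add: m_assoc)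
      then show ?thesis by (simp add: z(1))
    qed
    from this[of p] this[of q] show ?thesis using that v(2) by simp
  qed
  have FF: "F u \<otimes>\<^bsub>M\<^esub> F p = (F u \<otimes>\<^bsub>M\<^esub> e p) \<otimes>\<^bsub>M\<^esub> star (F u \<otimes>\<^bsub>M\<^esub> e p)" for u p
  proof -
    have "(F u \<otimes>\<^bsub>M\<^esub> e p) \<otimes>\<^bsub>M\<^esub> star (F u \<otimes>\<^bsub>M\<^esub> e p) = F u \<otimes>\<^bsub>M\<^esub> F p \<otimes>\<^bsub>M\<^esub> F u"
      using star_idem[of "F u"] by (simp add: star_mult F_def[of p] m_assoc del: star_e)
    also have "\<dots> = F u \<otimes>\<^bsub>M\<^esub> (F u \<otimes>\<^bsub>M\<^esub> F p)" using comm[of p u] by (simp add: m_assoc)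
    also have "\<dots> = F u \<otimes>\<^bsub>M\<^esub> F u \<otimes>\<^bsub>M\<^esub> F p" by (simp only: m_assoc F(1))
    finally show ?thesis by simp
  qed
  have pref: "F u \<otimes>\<^bsub>M\<^esub> F p = F u" if "prefix p u" for u p
  proof -
    from that obtain z where u: "e u = e p \<otimes>\<^bsub>M\<^esub> e z" by (auto simp: prefix_def e_mult)
    have "F p \<otimes>\<^bsub>M\<^esub> F u = (F p \<otimes>\<^bsub>M\<^esub> e u) \<otimes>\<^bsub>M\<^esub> star (e u)" by (simp add: F_def[of u] m_assoc del: star_e)
    also have "F p \<otimes>\<^bsub>M\<^esub> e u = e u" unfolding u F_def by (simp add: m_assoc del: star_e)
    finally show ?thesis using comm by (simp add: F_def)
  qed
  \<comment> \<open>Each further arc of \<open>p\<close> is traversed by \<open>u\<close> in one of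
    the two directions. By \<open>Fmax\<close> the part of \<open>p\<close> before it may be
    replaced by the prefix of \<open>u\<close> that ends at the same vertex.\<close>
  have dom: "F u \<otimes>\<^bsub>M\<^esub> F p = F u" if "ars p \<subseteq> ars u" for u p
    using that
  proof (induction p rule: rev_induct)
    case Nil
    then show ?case using pref[of "[]" u] by simp
  next
    case (snoc a p)
    then have IH: "F u \<otimes>\<^bsub>M\<^esub> F p = F u" and pa: "(g p, a) \<in> ars u"
      using ars_fwd[of p a "p @ [a]"] ars_prefix[of p "p @ [a]"] by auto
    have "F u \<otimes>\<^bsub>M\<^esub> e (q @ [a]) = F u \<otimes>\<^bsub>M\<^esub> e q \<otimes>\<^bsub>M\<^esub> e [a]" for q by (simp add: m_assoc e_mult)
    then have step: "F u \<otimes>\<^bsub>M\<^esub> F (p @ [a]) = F u \<otimes>\<^bsub>M\<^esub> F (q @ [a])" if "F u \<otimes>\<^bsub>M\<^esub> F q = F u" "g p = g q" for q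
      unfolding FF[of u "_ @ [a]"] using Fmax[OF IH that] by simp
    from pa consider (fwd) q where "g p = g q" "prefix (q @ [a]) u"
      | (bwd) q c where "g p = g (q @ [c])" "a = letter_inv c" "prefix (q @ [c]) u"
      unfolding ars_def by blast
    then show ?case
    proof cases
      case fwd
      then show ?thesis using step[of q] pref[of q u] pref[of "q @ [a]" u] append_prefixD by metis
    next
      case bwd
      have "F ((q @ [c]) @ [a]) = F (q @ [c])"
      proof -
        have "e ((q @ [c]) @ [a]) = e q \<otimes>\<^bsub>M\<^esub> (e [c] \<otimes>\<^bsub>M\<^esub> star (e [c]))" by (simp add: bwd(2) e_mult)
        moreover have "e (q @ [c]) = e q \<otimes>\<^bsub>M\<^esub> e [c]" by (simp add: e_mult)
        ultimately show ?thesis unfolding F_def by (simp add: star_mult m_assoc del: star_e)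
      qed
      then show ?thesis using step[of "q @ [c]"] pref[of "q @ [c]" u] bwd by simp
    qed
  qed
  have "F u = F v" using dom[of u v] dom[of v u] comm[of u v] assms by (simp add: \<eta>_eq_iff)
  moreover have "F u \<otimes>\<^bsub>M\<^esub> e u = F u \<otimes>\<^bsub>M\<^esub> e v"
    using assms dom[of v u] by (intro Fmax) (simp_all add: \<eta>_eq_iff)
  moreover have "F u \<otimes>\<^bsub>M\<^esub> e u = e u" "F v \<otimes>\<^bsub>M\<^esub> e v = e v"
    unfolding F_def by (simp_all add: m_assoc del: star_e)
  ultimately show ?thesis by simp
qed

lemma strongly_F_inverse_if_pieces: "strongly_F_inverse M (special_gen w)"
proof -
  define \<phi> where "\<phi> x = e (SOME u. \<eta> u = x)" for x
  have \<phi>: "\<phi> (\<eta> u) = e u" for u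
    unfolding \<phi>_def by (rule \<eta>_determines_e) (rule someI[of _ u], rule HOL.refl)
  have "\<phi> \<in> hom E M" by (rule homI) (auto simp: carrier_E \<eta>_mult \<phi> e_mult)
  moreover have "\<phi> (margolis_meakin_gen G \<gamma> x) = special_gen w x" for x
    unfolding \<eta>_gen \<phi> by (simp add: special_gen_def)
  ultimately have "canonical_morphism E (margolis_meakin_gen G \<gamma>) M (special_gen w) \<phi>"
    unfolding canonical_morphism_def \<eta>_one \<phi> one_M by blast
  moreover have "is_maximum M h (\<phi> (\<Gamma>, h))"
    if C: "C \<in> carrier E // min_group_congruence E" and max: "is_maximal E C (\<Gamma>, h)" for C \<Gamma> h
  proof -
    from C obtain x where x: "C = min_group_congruence E `` {x}" by (auto simp: quotient_def)
    then have xC: "(x, (\<Gamma>, h)) \<in> min_group_congruence E" using max by (auto simp: is_maximal_def)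
    then obtain u where u: "(\<Gamma>, h) = \<eta> u" using sigma_E_subset[OF xC] by (auto simp: carrier_E)
    \<comment> \<open>A simple path inside the graph of \<open>u\<close> spans an element above
      \<open>\<eta> u\<close>, hence \<open>\<eta> u\<close> itself by maximality.\<close>
    obtain v where v: "simple v" "ars v \<subseteq> ars u" "g v = g u" using ex_simple by blast
    have le: "natural_le E (\<eta> u) (\<eta> v)" using v by (simp add: natural_le_E)
    have "trans (min_group_congruence E)"
      using monoid_congruence_min_group[OF monoid_E] by (simp add: monoid_congruence_def equiv_def)
    then have "\<eta> v \<in> C" using xC natural_le_E_sigma[OF le] unfolding x u by (blast dest: transD)
    then have uv: "\<eta> v = \<eta> u" using max le unfolding u is_maximal_def by blast
    moreover have "h = g u" using u by (simp add: \<eta>_def)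
    ultimately show ?thesis using simple_is_maximum[OF v(1)] v(3) u \<phi>[of v] by simp
  qed
  ultimately show ?thesis
    unfolding strongly_F_inverse_def Let_def using F_inverse_M X_generated_M by blast
qed

end

end

theorem theorem4p7:
  fixes w :: "'x letter list" and ws :: "'x letter list list"
  assumes "\<exists>x y :: 'x. x \<noteq> y"
    and "cyclically_reduced w"
    and "minimal_invertible_pieces w ws"
  shows "strongly_F_inverse (special_inverse_monoid w) (special_gen w) \<longleftrightarrow>
    (\<forall>u \<in> set ws. length u \<le> 2)"
  using special.pieces_if_strongly_F_inverse[OF _ assms(2,3)] special.strongly_F_inverse_if_pieces[OF assms(3)]
  by blast

end
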